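(* Let the pair $(A_d(t),C)$, where $A_d(t)=A+\alpha I+DF(\hat z_P(t),t)$, be uniformly detectable, and let the pair $(A_d(t),W^{1/2}(t))$ be uniformly stabilizable. Assume that there exist a time $T>0$ and positive numbers $m>1$, $\epsilon_\phi>0$ and $\delta_\phi>0$ such that if $\|e\|_{\mathcal H}\le\epsilon_\phi$ then $$\|\phi(e,t)\|_{\mathcal H}\le\delta_\phi\|e\|_{\mathcal H}^m,\qquad 0\le t\le T,$$ where, for $z,\hat z_P\in\mathcal H$ and $e=z-\hat z_P$, $\phi(e,t)=F(z,t)-F(z-e,t)-DF(z-e,t)e$. Then, in the absence of disturbances ($\omega\equiv0$, $\eta\equiv0$), there exist $\epsilon>0$, $M_e>0$ and $\alpha_e>0$ such that if $\|e(0)\|_{\mathcal H}=\|z(0)-\hat z_P(0)\|_{\mathcal H}<\epsilon$ then for all $t\ge0$ $$\|z(t)-\hat z_P(t)\|_{\mathcal H}\le M_e\exp(-\alpha_e t)\,\|z(0)-\hat z_P(0)\|_{\mathcal H}.$$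
   Context: $\mathcal H,\mathcal H_1,\mathcal H_2$ are Hilbert spaces, $p\ge1$, $\alpha>0$. All data are given for $t\in[0,\infty)$. Data. $A$ generates a $C_0$-semigroup $T(t)$ on $\mathcal H$; $T_\alpha(t)$ is the $C_0$-semigroup generated by $A+\alpha I$. $B\in\mathcal L(\mathcal H_1,\mathcal H)$, $G\in\mathcal L(\mathcal H_2,\mathcal H)$, $C\in\mathcal L(\mathcal H,\mathbb R^p)$; the control $u$ ($\mathcal H_1$-valued), the input disturbance $\omega$ ($\mathcal H_2$-valued) and the output disturbance $\eta$ ($\mathbb R^p$-valued) are continuous in time. $F:\mathcal H\times[0,\infty)\to\mathcal H$ is a nonlinear operator, strongly continuous in time, with $F(0,t)=0$ for all $t$, Fréchet differentiable in the first argument with derivative $DF(\cdot,t)$; there is $\delta_{DF}>0$ with $\|DF(x,t)\|\le\delta_{DF}$ for all $x,t$; and for every $\delta>0$ there is $\iota_{DF}>0$ with $\|DF(x,t)-DF(y,t)\|\le\iota_{DF}\|x-y\|$ whenever $\|x-y\|<\delta$, for all $t$. $P_0\in\mathcal L(\mathcal H)$ is self-adjoint and positive definite ($(v,P_0v)>0$ for $v\ne0$); $W(t)\in\mathcal L(\mathcal H)$ and $R(t)\in\mathcal L(\mathbb R^p)$ are self-adjoint, continuous and uniformly bounded in time; $W(t)$ is nonnegative definite; $R(t)$ is coercive uniformly in time. System: $z$ is the mild solution of $\dot z=Az+F(z,t)+Bu+G\omega$, $z(0)=z_0\in\mathcal H$, i.e. $z(t)=T(t)z_0+\int_0^tT(t-s)(F(z(s),s)+Bu(s)+G\omega(s))\,ds$;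 the measurement is $y(t)=Cz(t)+\eta(t)$. Observer: $\hat z_P$ is the mild solution of $\dot{\hat z}_P=A\hat z_P+F(\hat z_P,t)+Bu+L(t)[y-C\hat z_P]$, $\hat z_P(0)=\hat z_0\in\mathcal H$, with gain $L(t)=P(t)C^*R^{-1}(t)$, where $P(t)\in\mathcal L(\mathcal H)$ is the solution of the coupled integral Riccati equations, for all $w\in\mathcal H$, $$U_\alpha(t,s)w=T_\alpha(t-s)w+\int_s^tT_\alpha(t-r)DF(\hat z_P(r),r)U_\alpha(r,s)w\,dr,$$ $$U_{P,\alpha}(t,s)w=U_\alpha(t,s)w-\int_s^tU_\alpha(t,r)P(r)C^*R^{-1}(r)C\,U_{P,\alpha}(r,s)w\,dr,$$ $$P(t)w=U_{P,\alpha}(t,0)P_0U_{P,\alpha}^*(t,0)w+\int_0^tU_{P,\alpha}(t,s)\big(W(s)+P(s)C^*R^{-1}(s)CP(s)\big)U_{P,\alpha}^*(t,s)w\,ds.$$ The estimation error is $e(t)=z(t)-\hat z_P(t)$. Evolution operators, stability, detectability. An evolution operator is a family $Y(t,s)\in\mathcal L(\mathcal H)$, $0\le s\le t$, with $Y(t,t)=I$, $Y(t,r)Y(r,s)=Y(t,s)$ for $s\le r\le t$, strongly continuous in each variable. It is exponentially stable if there are $M\ge0$, $\beta>0$ with $\|Y(t,s)\|\le Me^{-\beta(t-s)}$ for all $t\ge s$. The evolution operator generated by $A_d(t)$ is $U_\alpha(t,s)$. The pair $(A_d(t),C)$ is uniformly detectable if there is a linear, uniformly bounded and continuous in time operator $\Lambda(t)\in\mathcal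 L(\mathbb R^p,\mathcal H)$ such that the evolution operator $Y_\Lambda$ satisfying $Y_\Lambda(t,s)w=U_\alpha(t,s)w+\int_s^tU_\alpha(t,r)\Lambda(r)C\,Y_\Lambda(r,s)w\,dr$, $w\in\mathcal H$, is exponentially stable. The pair $(A_d(t),W^{1/2}(t))$ is uniformly stabilizable if there is a linear, uniformly bounded and continuous in time operator $K(t)\in\mathcal L(\mathcal H)$ such that the evolution operator $Y_K$ satisfying $Y_K(t,s)w=U_\alpha(t,s)w+\int_s^tU_\alpha(t,r)W^{1/2}(r)K(r)Y_K(r,s)w\,dr$, $w\in\mathcal H$, is exponentially stable. *)

theory Defs
  imports "HOL-Analysis.Analysis"
begin

text \<open>
  Hilbert spaces are real and are rendered by the sort \<open>{real_inner, banach}\<close>; bounded operators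
  are elements of the type of bounded linear functions. Time-dependent objects are functions on
  \<open>real\<close> of which only the values at times \<open>\<ge> 0\<close> (for two-parameter families, \<open>0 \<le> s \<le> t\<close>) matter.
  Every integral equation includes the Henstock--Kurzweil integrability of its integrand, so that
  the default value of \<open>integral\<close> is never used. Hilbert adjoints are given by the library constant
  \<open>adjoint\<close>.
\<close>

definition selfadjoint :: "('a::real_inner \<Rightarrow>\<^sub>L 'a) \<Rightarrow> bool" where
  "selfadjoint S \<longleftrightarrow> (\<forall>v w. S v \<bullet> w = v \<bullet> S w)"

definition nonneg_definite :: "('a::real_inner \<Rightarrow>\<^sub>L 'a) \<Rightarrow> bool" where
  "nonneg_definite S \<longleftrightarrow> (\<forall>v. 0 \<le> v \<bullet> S v)"

definition pos_definite :: "('a::real_inner \<Rightarrow>\<^sub>L 'a) \<Rightarrow> bool" where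
  "pos_definite S \<longleftrightarrow> (\<forall>v. v \<noteq> 0 \<longrightarrow> 0 < v \<bullet> S v)"

definition uniformly_coercive :: "(real \<Rightarrow> 'a::real_inner \<Rightarrow>\<^sub>L 'a) \<Rightarrow> bool" where
  "uniformly_coercive R \<longleftrightarrow> (\<exists>\<rho>>0. \<forall>t\<ge>0. \<forall>v. \<rho> * (norm v)\<^sup>2 \<le> v \<bullet> R t v)"

definition is_sqrt_of :: "('a::real_inner \<Rightarrow>\<^sub>L 'a) \<Rightarrow> ('a \<Rightarrow>\<^sub>L 'a) \<Rightarrow> bool" where
  "is_sqrt_of S W \<longleftrightarrow> selfadjoint S \<and> nonneg_definite S \<and> S o\<^sub>L S = W"

definition C0_semigroup :: "(real \<Rightarrow> 'a::banach \<Rightarrow>\<^sub>L 'a) \<Rightarrow> bool" where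
  "C0_semigroup T \<longleftrightarrow>
     T 0 = id_blinfun \<and>
     (\<forall>s\<ge>0. \<forall>t\<ge>0. T (s + t) = T s o\<^sub>L T t) \<and>
     (\<forall>x. continuous_on {0..} (\<lambda>t. T t x))"

text \<open>The unbounded operator \<open>A\<close> with domain \<open>D\<close> is the infinitesimal generator of \<open>T\<close>.\<close>

definition generates :: "'a set \<Rightarrow> ('a \<Rightarrow> 'a) \<Rightarrow> (real \<Rightarrow> 'a::banach \<Rightarrow>\<^sub>L 'a) \<Rightarrow> bool" where
  "generates D A T \<longleftrightarrow>
     C0_semigroup T \<and>
     D = {x. \<exists>y. ((\<lambda>h. (T h x - x) /\<^sub>R h) \<longlongrightarrow> y) (at_right 0)} \<and>
     (\<forall>x\<in>D. ((\<lambda>h. (T h x - x) /\<^sub>R h) \<longlongrightarrow> A x) (at_right 0))"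

definition mild_solution ::
  "(real \<Rightarrow> 'a::banach \<Rightarrow>\<^sub>L 'a) \<Rightarrow> ('a \<Rightarrow> real \<Rightarrow> 'a) \<Rightarrow> 'a \<Rightarrow> (real \<Rightarrow> 'a) \<Rightarrow> bool" where
  "mild_solution T f x0 x \<longleftrightarrow>
     continuous_on {0..} x \<and>
     (\<forall>t\<ge>0. (\<lambda>s. T (t - s) (f (x s) s)) integrable_on {0..t} \<and>
             x t = T t x0 + integral {0..t} (\<lambda>s. T (t - s) (f (x s) s)))"

definition evolution_operator :: "(real \<Rightarrow> real \<Rightarrow> 'a::banach \<Rightarrow>\<^sub>L 'a) \<Rightarrow> bool" where
  "evolution_operator Y \<longleftrightarrow>
     (\<forall>t\<ge>0. Y t t = id_blinfun) \<and>
     (\<forall>s\<ge>0. \<forall>r\<ge>s. \<forall>t\<ge>r. Y t r o\<^sub>L Y r s = Y t s) \<and>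
     (\<forall>s\<ge>0. \<forall>x. continuous_on {s..} (\<lambda>t. Y t s x)) \<and>
     (\<forall>t\<ge>0. \<forall>x. continuous_on {0..t} (\<lambda>s. Y t s x))"

definition exponentially_stable :: "(real \<Rightarrow> real \<Rightarrow> 'a::banach \<Rightarrow>\<^sub>L 'a) \<Rightarrow> bool" where
  "exponentially_stable Y \<longleftrightarrow>
     (\<exists>M\<ge>0. \<exists>\<beta>>0. \<forall>s\<ge>0. \<forall>t\<ge>s. norm (Y t s) \<le> M * exp (- \<beta> * (t - s)))"

text \<open>\<open>Y\<close> is the evolution operator obtained from \<open>X\<close> by adding the perturbation \<open>D(t)\<close> to its generator.\<close>

definition perturbed_evolution ::
  "(real \<Rightarrow> real \<Rightarrow> 'a::banach \<Rightarrow>\<^sub>L 'a) \<Rightarrow> (real \<Rightarrow> 'a \<Rightarrow> 'a) \<Rightarrow> (real \<Rightarrow> real \<Rightarrow> 'a \<Rightarrow>\<^sub>L 'a) \<Rightarrow> bool" where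
  "perturbed_evolution X D Y \<longleftrightarrow>
     evolution_operator Y \<and>
     (\<forall>s\<ge>0. \<forall>t\<ge>s. \<forall>w.
        (\<lambda>r. X t r (D r (Y r s w))) integrable_on {s..t} \<and>
        Y t s w = X t s w + integral {s..t} (\<lambda>r. X t r (D r (Y r s w))))"

text \<open>In the next two notions \<open>U\<close> is the evolution operator generated by \<open>A\<^sub>d(t)\<close>.\<close>

definition uniformly_detectable ::
  "(real \<Rightarrow> real \<Rightarrow> 'a::banach \<Rightarrow>\<^sub>L 'a) \<Rightarrow> ('a \<Rightarrow>\<^sub>L 'b::banach) \<Rightarrow> bool" where
  "uniformly_detectable U C \<longleftrightarrow>
     (\<exists>\<Lambda> :: real \<Rightarrow> 'b \<Rightarrow>\<^sub>L 'a. bounded (\<Lambda> ` {0..}) \<and> continuous_on {0..} \<Lambda> \<and>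
        (\<exists>Y. perturbed_evolution U (\<lambda>r v. blinfun_apply (\<Lambda> r) (blinfun_apply C v)) Y \<and> exponentially_stable Y))"

definition uniformly_stabilizable ::
  "(real \<Rightarrow> real \<Rightarrow> 'a::banach \<Rightarrow>\<^sub>L 'a) \<Rightarrow> (real \<Rightarrow> 'a \<Rightarrow>\<^sub>L 'a) \<Rightarrow> bool" where
  "uniformly_stabilizable U S \<longleftrightarrow>
     (\<exists>K :: real \<Rightarrow> 'a \<Rightarrow>\<^sub>L 'a. bounded (K ` {0..}) \<and> continuous_on {0..} K \<and>
        (\<exists>Y. perturbed_evolution U (\<lambda>r v. blinfun_apply (S r) (blinfun_apply (K r) v)) Y \<and> exponentially_stable Y))"

text \<open>The gain \<open>L(t) = P(t) C\<^sup>* R\<^sup>-\<^sup>1(t)\<close>; the coercive operator \<open>R(t)\<close> is a bijection.\<close>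

definition observer_gain ::
  "(real \<Rightarrow> 'a::real_inner \<Rightarrow>\<^sub>L 'a) \<Rightarrow> ('a \<Rightarrow>\<^sub>L 'b::real_inner) \<Rightarrow> (real \<Rightarrow> 'b \<Rightarrow>\<^sub>L 'b) \<Rightarrow> real \<Rightarrow> 'b \<Rightarrow> 'a" where
  "observer_gain P C R t v = P t (adjoint C (inv (R t) v))"

text \<open>
  The coupled integral Riccati equations along a trajectory \<open>x\<close>, where \<open>Ta\<close> is the semigroup
  generated by \<open>A + \<alpha>I\<close>. The solution \<open>P\<close> is taken in the class of strongly continuous
  operator functions.
\<close>

definition riccati_solution ::
  "(real \<Rightarrow> 'a::{real_inner,banach} \<Rightarrow>\<^sub>L 'a) \<Rightarrow> ('a \<Rightarrow> real \<Rightarrow> 'a \<Rightarrow>\<^sub>L 'a) \<Rightarrow> ('a \<Rightarrow>\<^sub>L 'b::real_inner) \<Rightarrow>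
   (real \<Rightarrow> 'b \<Rightarrow>\<^sub>L 'b) \<Rightarrow> (real \<Rightarrow> 'a \<Rightarrow>\<^sub>L 'a) \<Rightarrow> ('a \<Rightarrow>\<^sub>L 'a) \<Rightarrow> (real \<Rightarrow> 'a) \<Rightarrow>
   (real \<Rightarrow> real \<Rightarrow> 'a \<Rightarrow>\<^sub>L 'a) \<Rightarrow> (real \<Rightarrow> real \<Rightarrow> 'a \<Rightarrow>\<^sub>L 'a) \<Rightarrow> (real \<Rightarrow> 'a \<Rightarrow>\<^sub>L 'a) \<Rightarrow> bool" where
  "riccati_solution Ta DF C R W P0 x U UP P \<longleftrightarrow>
     perturbed_evolution (\<lambda>t s. Ta (t - s)) (\<lambda>r. DF (x r) r) U \<and>
     perturbed_evolution U (\<lambda>r v. - observer_gain P C R r (C v)) UP \<and>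
     (\<forall>w. continuous_on {0..} (\<lambda>t. P t w)) \<and>
     (\<forall>t\<ge>0. \<forall>w.
        (\<lambda>s. UP t s ((\<lambda>v. W s v + observer_gain P C R s (C (P s v))) (adjoint (UP t s) w)))
          integrable_on {0..t} \<and>
        P t w = UP t 0 (P0 (adjoint (UP t 0) w)) +
          integral {0..t}
            (\<lambda>s. UP t s ((\<lambda>v. W s v + observer_gain P C R s (C (P s v))) (adjoint (UP t s) w))))"

definition linearization_error ::
  "('a \<Rightarrow> real \<Rightarrow> 'a) \<Rightarrow> ('a \<Rightarrow> real \<Rightarrow> 'a \<Rightarrow>\<^sub>L 'a) \<Rightarrow> 'a \<Rightarrow> 'a::real_normed_vector \<Rightarrow> real \<Rightarrow> 'a" where
  "linearization_error F DF z e t = F z t - F (z - e) t - DF (z - e) t e"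

end

theory Submission
  imports Defs
begin

text \<open>
  Write \<open>e = z - zhat\<close> for the error. It is driven by the closed loop: \<open>exp (\<alpha> t) *\<^sub>R e(t)\<close> solves the linear equation
  whose evolution operator is \<open>UP\<close>, up to the linearization error \<open>\<phi>(e,t)\<close>. Since the Frechet derivative is
  locally Lipschitz uniformly in time, \<open>\<phi>\<close> is at most quadratic in \<open>e\<close> at all times. If
  \<open>norm (UP t s) \<le> Q\<close>, Gronwall's inequality shows that an error that stays below a small radius decays like
  \<open>exp (- \<alpha> t / 2)\<close>, and a continuity argument shows that an error that starts small stays small.
  Thus the shift by \<open>\<alpha>\<close> provides the decay once \<open>UP\<close> is bounded.

  The bound \<open>Q\<close> comes from the linear-quadratic control problem behind the Riccati equation. For fixed
  \<open>t\<close> and \<open>w\<close> the curve \<open>s \<mapsto> (UP t s)\<^sup>* w\<close> is the optimal backward trajectory from \<open>w\<close>, and \<open>w \<bullet> P t w\<close> is its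
  cost. Detectability supplies an exponentially decaying competitor, which bounds \<open>P\<close>
  (\<open>one_step_inequality\<close>, \<open>riccati_uniform_bound\<close>). The finite cost bounds the integrals of
  \<open>(norm (W\<^sup>1\<^sup>/\<^sup>2 (UP t s)\<^sup>* w))\<^sup>2\<close> and of the output term; comparing \<open>UP\<close> with the stable evolution given by
  stabilizability then bounds \<open>UP\<close> itself (\<open>closed_loop_bound\<close>).

  The constants must not depend on the initial state of the observer, whereas detectability and
  stabilizability are given for each initial state separately. The bounds come from the instance at \<open>z0\<close>,
  where the observer coincides with the system. For another initial state the linearizations differ by at
  most \<open>\<iota> r\<close> as long as \<open>norm e \<le> r\<close>; this difference enters the two bounds multiplied by the very quantity that is
  being estimated, and for small \<open>r\<close> it can be absorbed (\<open>absorb_half\<close>). So all bounds are proved on a finite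
  horizon \<open>[0,\<tau>]\<close> on which the error is small, with constants that do not depend on \<open>\<tau>\<close>.

  Evolution operators that solve different integral equations are compared by telescoping: both agree
  with the semigroup to first order over short time steps, errors that are quadratic in the step
  vanish in the limit, and what remains is an integral inequality (\<open>telescope_le\<close>, \<open>duhamel_upper\<close>). This replaces
  exchanging the order of integration and differentiating merely weakly continuous curves.
\<close>

section \<open>Operators on Banach and Hilbert spaces\<close>

lemma norm_blinfun_le:
  assumes "norm A \<le> a" "norm v \<le> b"
  shows "norm (blinfun_apply A v) \<le> a * b"
  using assms norm_blinfun[of A v] mult_mono[OF assms] by (smt (verit) norm_ge_zero)

text \<open>
  The sublevel sets of the pointwise suprema are closed and cover the space, so by Baire's theorem one of them contains a ball.
\<close>

lemma banach_steinhaus: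
  fixes \<F> :: "('a::banach \<Rightarrow>\<^sub>L 'b::real_normed_vector) set"
  assumes pw: "\<And>x. \<exists>c. \<forall>f\<in>\<F>. norm (f x) \<le> c"
  shows "\<exists>c\<ge>0. \<forall>f\<in>\<F>. norm f \<le> c"
proof -
  define E where "E n = {x. \<forall>f\<in>\<F>. norm (f x) \<le> real n}" for n
  have cl: "closed (E n)" for n
  proof -
    have "E n = (\<Inter>f\<in>\<F>. {x. norm (blinfun_apply f x) \<le> real n})" by (auto simp: E_def)
    moreover have "closed {x. norm (blinfun_apply f x) \<le> real n}" for f :: "'a \<Rightarrow>\<^sub>L 'b"
      by (intro closed_Collect_le continuous_intros)
    ultimately show ?thesis by auto
  qed
  have cover: "(\<Union>n. E n) = UNIV"
  proof -
    have "\<exists>n. x \<in> E n" for x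
    proof -
      obtain c where c: "\<forall>f\<in>\<F>. norm (f x) \<le> c" using pw by blast
      obtain n where "c \<le> real n" using real_arch_simple by blast
      with c have "x \<in> E n" unfolding E_def by fastforce
      then show ?thesis ..
    qed
    then show ?thesis by blast
  qed
  have "\<exists>n. interior (E n) \<noteq> {}"
  proof (rule ccontr)
    assume "\<nexists>n. interior (E n) \<noteq> {}"
    then have "Met_TC.mtopology interior_of \<Union>(range E) = {}"
      by (intro Met_TC.metric_Baire_category_alt)
         (auto simp: cl complete_UNIV)
    with cover show False by simp
  qed
  then obtain n x0 where "x0 \<in> interior (E n)" by blast
  then obtain r where r: "r > 0" "cball x0 r \<subseteq> E n"
    by (meson interior_subset mem_interior_cball)
  have "norm f \<le> 2 * real n / r" if f: "f \<in> \<F>" for f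
  proof (rule norm_blinfun_bound)
    show "0 \<le> 2 * real n / r" using r by simp
    fix x
    show "norm (f x) \<le> 2 * real n / r * norm x"
    proof (cases "x = 0")
      case False
      define y where "y = (r / norm x) *\<^sub>R x"
      have "norm y = r" using False r by (simp add: y_def)
      then have "x0 + y \<in> E n" "x0 \<in> E n" using r by (auto simp: dist_norm subset_iff)
      then have "norm (f (x0 + y)) \<le> n" "norm (f x0) \<le> n" using f by (auto simp: E_def)
      then have "norm (f y) \<le> 2 * n"
        using norm_triangle_ineq4[of "f (x0 + y)" "f x0"] by (simp add: blinfun.add_right)
      moreover have "norm (f y) = r / norm x * norm (f x)"
        using False r by (simp add: y_def blinfun.scaleR_right)
      ultimately show ?thesis using False r by (simp add: field_simps)
    qed simp
  qed
  moreover have "0 \<le> 2 * real n / r" using r by simp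
  ultimately show ?thesis by blast
qed

lemma strongly_continuous_bounded:
  fixes X :: "real \<Rightarrow> 'a::banach \<Rightarrow>\<^sub>L 'b::real_normed_vector"
  assumes "\<And>v. continuous_on {a..b} (\<lambda>t. X t v)"
  shows "\<exists>c\<ge>0. \<forall>t\<in>{a..b}. norm (X t) \<le> c"
proof -
  have "\<exists>c. \<forall>f\<in>X ` {a..b}. norm (f v) \<le> c" for v
  proof -
    have "compact ((\<lambda>t. X t v) ` {a..b})"
      by (intro compact_continuous_image assms) simp
    then have "bounded ((\<lambda>t. X t v) ` {a..b})" by (rule compact_imp_bounded)
    then show ?thesis by (simp add: bounded_iff)
  qed
  from banach_steinhaus[of "X ` {a..b}", OF this] show ?thesis by blast
qed

text \<open>
  The minimizer of \<open>x \<bullet> x - 2 * f x\<close> represents \<open>f\<close>; a minimizing sequence is Cauchy by the parallelogram law.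
\<close>

lemma riesz_representation:
  fixes f :: "'a::{real_inner,banach} \<Rightarrow>\<^sub>L real"
  shows "\<exists>u. \<forall>x. f x = x \<bullet> u"
proof -
  define J where "J x = x \<bullet> x - 2 * f x" for x
  have bd: "bdd_below (range J)"
  proof (rule bdd_belowI2)
    fix x
    have "f x \<le> norm f * norm x" using norm_blinfun[of f x] by simp
    moreover have "(norm x - norm f)\<^sup>2 \<ge> 0" by simp
    ultimately show "- (norm f)\<^sup>2 \<le> J x"
      by (simp add: J_def power2_eq_square algebra_simps flip: power2_norm_eq_inner)
  qed
  define m where "m = (INF x. J x)"
  have mle: "m \<le> J x" for x unfolding m_def by (intro cINF_lower bd) simp
  have "\<exists>x. J x < m + inverse (real (Suc n))" for n
    using cINF_less_iff[OF _ bd, of "m + inverse (real (Suc n))"] by (auto simp: m_def)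
  then obtain x where x: "\<And>n. J (x n) < m + inverse (real (Suc n))" by metis
  have par: "(norm (a - b))\<^sup>2 = 2 * J a + 2 * J b - 4 * J ((1/2) *\<^sub>R (a + b))" for a b
    unfolding power2_norm_eq_inner J_def
    by (simp add: inner_simps blinfun.add_right blinfun.scaleR_right blinfun.diff_right inner_commute[of b a]) (simp add: field_simps)
  have cau: "(norm (x i - x j))\<^sup>2 \<le> 4 * inverse (real (Suc N))" if "i \<ge> N" "j \<ge> N" for i j N
  proof -
    have "inverse (real (Suc i)) \<le> inverse (real (Suc N))" "inverse (real (Suc j)) \<le> inverse (real (Suc N))"
      using that by (auto intro!: le_imp_inverse_le)
    then show ?thesis using par[of "x i" "x j"] x[of i] x[of j] mle[of "(1/2) *\<^sub>R (x i + x j)"] by linarith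
  qed
  have "Cauchy x"
  proof (rule metric_CauchyI)
    fix e :: real assume e: "e > 0"
    obtain N where N: "inverse (real (Suc N)) < e\<^sup>2 / 4" using reals_Archimedean[of "e\<^sup>2/4"] e by auto
    have "dist (x i) (x j) < e" if "i \<ge> N" "j \<ge> N" for i j
    proof -
      have "(norm (x i - x j))\<^sup>2 < e\<^sup>2" using cau[OF that] N by linarith
      then show ?thesis using e by (simp add: dist_norm power2_less_imp_less)
    qed
    then show "\<exists>M. \<forall>i\<ge>M. \<forall>j\<ge>M. dist (x i) (x j) < e" by blast
  qed
  then have "convergent x" by (simp add: Cauchy_convergent_iff)
  then obtain u where u: "x \<longlonglongrightarrow> u" unfolding convergent_def by (rule exE)
  have "(\<lambda>n. J (x n)) \<longlonglongrightarrow> J u" unfolding J_def by (intro tendsto_intros u)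
  moreover have "(\<lambda>n. m + inverse (real (Suc n))) \<longlonglongrightarrow> m + 0"
    by (intro tendsto_intros LIMSEQ_inverse_real_of_nat)
  ultimately have "J u \<le> m" using x by (intro LIMSEQ_le[of "\<lambda>n. J (x n)" _ "\<lambda>n. m + inverse (real (Suc n))"]) (auto intro: less_imp_le)
  then have min: "J u \<le> J w" for w using mle order_trans by blast
  have "f v = v \<bullet> u" for v
  proof -
    define d where "d = v \<bullet> u - f v"
    have ineq: "0 \<le> 2 * s * d + s\<^sup>2 * (v \<bullet> v)" for s
      using min[of "u + s *\<^sub>R v"]
      by (simp add: J_def d_def inner_simps blinfun.add_right blinfun.scaleR_right inner_commute power2_eq_square algebra_simps)
    have "d = 0"
    proof (rule ccontr)
      assume "d \<noteq> 0"
      define k where "k = 1 + v \<bullet> v"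
      have k: "k > 0" "v \<bullet> v < k" by (auto simp: k_def add_pos_nonneg)
      have "0 \<le> 2 * (- d / k) * d + (- d / k)\<^sup>2 * (v \<bullet> v)" by (rule ineq)
      also have "\<dots> \<le> 2 * (- d / k) * d + (- d / k)\<^sup>2 * k"
        using k by (intro add_left_mono mult_left_mono) auto
      also have "\<dots> = - (d\<^sup>2 / k)" using k by (simp add: power2_eq_square field_simps)
      also have "\<dots> < 0" using k \<open>d \<noteq> 0\<close> by simp
      finally show False by simp
    qed
    then show ?thesis by (simp add: d_def)
  qed
  then show ?thesis by blast
qed

text \<open>
  The constant \<open>adjoint\<close> is defined by choice, so its characteristic property needs the existence of an adjoint, which is
  the Riesz representation of \<open>x \<mapsto> A x \<bullet> y\<close>.
\<close>

lemma adjoint_blinfun: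
  fixes A :: "'a::{real_inner,banach} \<Rightarrow>\<^sub>L 'b::real_inner"
  shows inner_adjoint: "x \<bullet> adjoint A y = A x \<bullet> y" and adjoint_inner: "adjoint A y \<bullet> x = y \<bullet> A x"
proof -
  have "\<exists>u. \<forall>x. A x \<bullet> y = x \<bullet> u" for y
    using riesz_representation[of "blinfun_inner_left y o\<^sub>L A"] by (simp add: inner_commute)
  then have "\<exists>f'. \<forall>x y. A x \<bullet> y = x \<bullet> f' y" by metis
  from someI_ex[OF this] show "x \<bullet> adjoint A y = A x \<bullet> y" unfolding adjoint_def by metis
  then show "adjoint A y \<bullet> x = y \<bullet> A x" by (simp add: inner_commute)
qed

lemma linear_adjoint_blinfun:
  fixes A :: "'a::{real_inner,banach} \<Rightarrow>\<^sub>L 'b::real_inner"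
  shows "linear (adjoint A)"
proof (rule linearI)
  fix x y and r :: real
  have "adjoint A (x + y) \<bullet> v = (adjoint A x + adjoint A y) \<bullet> v" for v
    by (simp add: adjoint_inner inner_add_left)
  then show "adjoint A (x + y) = adjoint A x + adjoint A y" by (meson vector_eq_rdot)
  have "adjoint A (r *\<^sub>R x) \<bullet> v = (r *\<^sub>R adjoint A x) \<bullet> v" for v
    by (simp add: adjoint_inner)
  then show "adjoint A (r *\<^sub>R x) = r *\<^sub>R adjoint A x" by (meson vector_eq_rdot)
qed

lemma norm_adjoint_le:
  fixes A :: "'a::{real_inner,banach} \<Rightarrow>\<^sub>L 'b::real_inner"
  shows "norm (adjoint A y) \<le> norm A * norm y"
proof (cases "adjoint A y = 0")
  case False
  have "norm (adjoint A y) * norm (adjoint A y) = A (adjoint A y) \<bullet> y"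
    by (metis inner_adjoint power2_norm_eq_inner power2_eq_square)
  also have "\<dots> \<le> norm (A (adjoint A y)) * norm y" by (rule norm_cauchy_schwarz)
  also have "\<dots> \<le> norm A * norm (adjoint A y) * norm y"
    by (intro mult_right_mono norm_blinfun) simp
  finally show ?thesis using False by (simp add: mult.assoc mult.left_commute)
qed simp

lemma adjoint_compose:
  fixes A :: "'b::{real_inner,banach} \<Rightarrow>\<^sub>L 'c::real_inner" and B :: "'a::{real_inner,banach} \<Rightarrow>\<^sub>L 'b"
  shows "adjoint (A o\<^sub>L B) w = adjoint B (adjoint A w)"
proof -
  have "adjoint (A o\<^sub>L B) w \<bullet> v = adjoint B (adjoint A w) \<bullet> v" for v
    by (simp add: adjoint_inner)
  then show ?thesis by (meson vector_eq_rdot)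
qed

lemma coercive_inverse:
  fixes R :: "'b::euclidean_space \<Rightarrow>\<^sub>L 'b"
  assumes sa: "selfadjoint R" and \<rho>: "\<rho> > 0" and co: "\<And>v. \<rho> * (norm v)\<^sup>2 \<le> v \<bullet> R v"
  shows "R (inv R v) = v"
    and "linear (inv R)"
    and "\<rho> * (norm (inv R v))\<^sup>2 \<le> v \<bullet> inv R v"
    and "norm (inv R v) \<le> norm v / \<rho>"
    and "inv R v \<bullet> w = v \<bullet> inv R w"
proof -
  have lin: "linear R" by (rule bounded_linear.linear[OF blinfun.bounded_linear_right])
  have inj: "inj R"
  proof (rule linear_injective_0[THEN iffD2, OF lin], intro allI impI)
    fix v assume "R v = 0"
    with co[of v] \<rho> show "v = 0" by (simp add: mult_le_0_iff)
  qed
  then have surj: "surj R" using linear_injective_imp_surjective lin by blast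
  show r: "R (inv R v) = v" for v using surj by (simp add: surj_f_inv_f)
  show "linear (inv R)"
    by (intro linearI; rule injD[OF inj]) (simp_all add: r blinfun.add_right blinfun.scaleR_right)
  show c: "\<rho> * (norm (inv R v))\<^sup>2 \<le> v \<bullet> inv R v"
    using co[of "inv R v"] by (simp add: r inner_commute)
  show "norm (inv R v) \<le> norm v / \<rho>"
  proof (cases "inv R v = 0")
    case False
    have "\<rho> * (norm (inv R v))\<^sup>2 \<le> norm v * norm (inv R v)"
      using c norm_cauchy_schwarz order_trans by blast
    then show ?thesis using False \<rho> by (simp add: power2_eq_square field_simps)
  qed (use \<rho> in simp)
  show "inv R v \<bullet> w = v \<bullet> inv R w"
    using sa r unfolding selfadjoint_def by metis
qed

lemma adjoint_ident [simp]: "adjoint (\<lambda>x::'a::real_inner. x) = (\<lambda>x. x)"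
  by (rule adjoint_unique) simp

lemma norm_blinfun_le_inner:
  fixes A :: "'a::real_normed_vector \<Rightarrow>\<^sub>L 'b::real_inner"
  assumes c: "0 \<le> c" and le: "\<And>w v. A w \<bullet> v \<le> c * norm w * norm v"
  shows "norm A \<le> c"
proof (rule norm_blinfun_bound[OF c])
  fix w
  show "norm (A w) \<le> c * norm w"
  proof (cases "A w = 0")
    case False
    have "norm (A w) * norm (A w) \<le> c * norm w * norm (A w)"
      using le[of w "A w"] by (simp add: power2_norm_eq_inner[symmetric] power2_eq_square)
    then show ?thesis using False by simp
  qed (use c in simp)
qed

lemma norm_blinfun_le_unit:
  fixes A :: "'a::real_normed_vector \<Rightarrow>\<^sub>L 'b::real_inner"
  assumes c: "0 \<le> c" and le: "\<And>w v. norm w = 1 \<Longrightarrow> norm v = 1 \<Longrightarrow> A w \<bullet> v \<le> c"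
  shows "norm A \<le> c"
proof (rule norm_blinfun_le_inner[OF c])
  fix w v
  show "A w \<bullet> v \<le> c * norm w * norm v"
  proof (cases "w = 0 \<or> v = 0")
    case False
    define a b where "a = w /\<^sub>R norm w" and "b = v /\<^sub>R norm v"
    have "A a \<bullet> b \<le> c" using False by (intro le) (auto simp: a_def b_def)
    moreover have "A a \<bullet> b = (A w \<bullet> v) / (norm w * norm v)"
      by (simp add: a_def b_def blinfun.scaleR_right divide_inverse)
    ultimately show ?thesis using False by (simp add: pos_divide_le_eq mult.assoc)
  qed auto
qed

text \<open>
  Polarization: the form at \<open>a - b\<close> is nonnegative and can be dropped.
\<close>

lemma norm_le_quadratic_form:
  fixes Q :: "'a::real_inner \<Rightarrow>\<^sub>L 'a"
  assumes sym: "\<And>v w. Q v \<bullet> w = v \<bullet> Q w" and pos: "\<And>v. 0 \<le> v \<bullet> Q v"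
    and c: "0 \<le> c" and le: "\<And>v. v \<bullet> Q v \<le> c * (norm v)\<^sup>2"
  shows "norm Q \<le> c"
proof (rule norm_blinfun_le_unit[OF c])
  fix a b :: 'a assume ab: "norm a = 1" "norm b = 1"
  have "4 * (Q a \<bullet> b) = (a + b) \<bullet> Q (a + b) - (a - b) \<bullet> Q (a - b)"
    using sym[of a b] sym[of b a]
    by (simp add: blinfun.add_right blinfun.diff_right inner_simps inner_commute)
  also have "\<dots> \<le> c * (norm (a + b))\<^sup>2" using le[of "a + b"] pos[of "a - b"] by linarith
  also have "\<dots> \<le> c * 2\<^sup>2"
    using norm_triangle_ineq[of a b] ab c by (intro mult_left_mono power_mono) auto
  finally show "Q a \<bullet> b \<le> c" by simp
qed

lemma norm_sqrt_le:
  fixes S W :: "'a::real_inner \<Rightarrow>\<^sub>L 'a"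
  assumes S: "is_sqrt_of S W" and w: "norm W \<le> w"
  shows "norm S \<le> sqrt w"
proof (rule norm_blinfun_bound)
  show "0 \<le> sqrt w" using order_trans[OF norm_ge_zero w] by simp
  fix v
  have "(norm (S v))\<^sup>2 = v \<bullet> W v"
    using S unfolding is_sqrt_of_def selfadjoint_def
    by (metis blinfun_apply_blinfun_compose power2_norm_eq_inner)
  also have "\<dots> \<le> norm v * (w * norm v)"
    by (rule order_trans[OF norm_cauchy_schwarz mult_left_mono[OF norm_blinfun_le[OF w order_refl]]]) simp
  also have "\<dots> = (sqrt w * norm v)\<^sup>2"
    using order_trans[OF norm_ge_zero w] by (simp add: power2_eq_square)
  finally show "norm (S v) \<le> sqrt w * norm v"
    by (rule power2_le_imp_le) (use order_trans[OF norm_ge_zero w] in simp)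
qed

text \<open>
  Strong continuity suffices because it entails a uniform bound on compact intervals.
\<close>

lemma continuous_on_strong_apply:
  fixes X :: "real \<Rightarrow> 'a::banach \<Rightarrow>\<^sub>L 'b::real_normed_vector"
  assumes X: "\<And>v. continuous_on {a..b} (\<lambda>t. X t v)" and y: "continuous_on {a..b} y"
  shows "continuous_on {a..b} (\<lambda>t. X t (y t))"
proof -
  obtain B where B: "B \<ge> 0" "\<forall>t\<in>{a..b}. norm (X t) \<le> B" using strongly_continuous_bounded[OF X] by blast
  show ?thesis unfolding continuous_on
  proof
    fix t assume t: "t \<in> {a..b}"
    have "((\<lambda>r. X r (y t) + X r (y r - y t)) \<longlongrightarrow> X t (y t) + 0) (at t within {a..b})"
    proof (intro tendsto_add)
      show "((\<lambda>r. X r (y t)) \<longlongrightarrow> X t (y t)) (at t within {a..b})"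
        using X t by (auto simp: continuous_on)
      have "((\<lambda>r. B * norm (y r - y t)) \<longlongrightarrow> B * norm (y t - y t)) (at t within {a..b})"
        using y t by (intro tendsto_intros) (auto simp: continuous_on)
      moreover have "\<forall>\<^sub>F r in at t within {a..b}. norm (X r (y r - y t)) \<le> B * norm (y r - y t)"
        unfolding eventually_at_filter using B
        by (intro always_eventually) (auto intro: norm_blinfun_le)
      ultimately show "((\<lambda>r. X r (y r - y t)) \<longlongrightarrow> 0) (at t within {a..b})"
        using Lim_null_comparison[of "\<lambda>r. X r (y r - y t)" "\<lambda>r. B * norm (y r - y t)" "at t within {a..b}"] by simp
    qed
    then show "((\<lambda>r. X r (y r)) \<longlongrightarrow> X t (y t)) (at t within {a..b})"
      by (simp add: blinfun.diff_right)
  qed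
qed

section \<open>Integral and continuity estimates\<close>

lemma has_integral_norm_le:
  fixes f :: "real \<Rightarrow> 'a::banach"
  assumes "(f has_integral i) {a..b}" "(g has_integral j) {a..b}"
    and "\<And>x. x \<in> {a..b} \<Longrightarrow> norm (f x) \<le> g x"
  shows "norm i \<le> j"
  using integral_norm_bound_integral[of f "{a..b}" g] assms
  by (auto simp: has_integral_iff)

lemma has_integral_norm_le_const:
  fixes f :: "real \<Rightarrow> 'a::banach"
  assumes "(f has_integral i) {a..b}" "a \<le> b" "\<And>x. x \<in> {a..b} \<Longrightarrow> norm (f x) \<le> B"
  shows "norm i \<le> B * (b - a)"
  using has_integral_norm_le[OF assms(1) has_integral_const_real assms(3)] assms(2)
  by (simp add: mult.commute)

text \<open>
  An increment bounded by the square of the step contributes only \<open>O(1/n)\<close> over \<open>n\<close> equal steps.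
\<close>

lemma telescope_le:
  fixes f :: "real \<Rightarrow> real"
  assumes "a \<le> b"
    and step: "\<And>s t. a \<le> s \<Longrightarrow> s \<le> t \<Longrightarrow> t \<le> b \<Longrightarrow> t - s \<le> 1 \<Longrightarrow> f t - f s \<le> K * (t - s)\<^sup>2"
  shows "f b \<le> f a"
proof -
  have bound: "f b - f a \<le> K * (b - a)\<^sup>2 / n" if n: "real n \<ge> max 1 (b - a)" for n :: nat
  proof -
    define d where "d = (b - a) / n"
    have n0: "real n > 0" using n by linarith
    have d: "0 \<le> d" "d \<le> 1" using n n0 \<open>a \<le> b\<close> by (auto simp: d_def)
    have "f (a + i * d) - f a \<le> i * (K * d\<^sup>2)" if "i \<le> n" for i
      using that
    proof (induction i)
      case (Suc i)
      have "real (Suc i) * d \<le> n * d" using Suc.prems d by (intro mult_right_mono) auto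
      also have "\<dots> = b - a" using n0 by (simp add: d_def)
      finally have le: "a + real (Suc i) * d \<le> b" by simp
      have "f (a + real (Suc i) * d) - f (a + real i * d) \<le> K * (a + real (Suc i) * d - (a + real i * d))\<^sup>2"
        using d le by (intro step) (auto simp: algebra_simps)
      then show ?case using Suc by (simp add: algebra_simps)
    qed simp
    from this[of n] show ?thesis using n0 by (simp add: d_def power2_eq_square)
  qed
  have "(\<lambda>n. K * (b - a)\<^sup>2 / real n) \<longlonglongrightarrow> 0"
    by (rule lim_const_over_n)
  moreover have "\<forall>\<^sub>F n in sequentially. f b - f a \<le> K * (b - a)\<^sup>2 / real n"
  proof -
    obtain N :: nat where "max 1 (b - a) \<le> real N" using real_arch_simple by blast
    then have "\<forall>n\<ge>N. f b - f a \<le> K * (b - a)\<^sup>2 / real n"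
      by (intro allI impI bound) linarith
    then show ?thesis using eventually_sequentially by blast
  qed
  ultimately have "f b - f a \<le> 0" using tendsto_lowerbound[of _ 0 sequentially "f b - f a"] by simp
  then show ?thesis by simp
qed

text \<open>
  A form of Gronwall's inequality that asks nothing of the measurability of \<open>b\<close>, so that it applies to
  operator norms of strongly continuous families: the least \<open>c\<close> with \<open>b s \<le> c * exp (2 * K * s)\<close> satisfies
  \<open>c \<le> a + c / 2\<close>, because integrating \<open>K * exp (2 * K * s)\<close> gains the factor \<open>1/2\<close>.
\<close>

lemma gronwall:
  fixes b :: "real \<Rightarrow> real"
  assumes bdd: "\<exists>c. \<forall>t\<in>{0..\<tau>}. b t \<le> c" and K: "0 \<le> K" and a: "0 \<le> a"
    and step: "\<And>t c. t \<in> {0..\<tau>} \<Longrightarrow> 0 \<le> c \<Longrightarrow> (\<And>s. s \<in> {0..t} \<Longrightarrow> b s \<le> c * exp (2 * K * s)) \<Longrightarrow>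
             b t \<le> a + c / 2 * exp (2 * K * t)"
    and t: "t \<in> {0..\<tau>}"
  shows "b t \<le> 2 * a * exp (2 * K * t)"
proof -
  define B where "B s = b s * exp (- (2 * K * s))" for s
  have bB: "b s = B s * exp (2 * K * s)" for s by (simp add: B_def flip: exp_minus exp_add)
  obtain c0 where c0: "\<forall>t\<in>{0..\<tau>}. b t \<le> c0" using bdd by blast
  have "B s \<le> max 0 c0" if "s \<in> {0..\<tau>}" for s
  proof -
    have "exp (- (2 * K * s)) \<le> 1" using K that by simp
    moreover have "b s \<le> max 0 c0" using c0 that by fastforce
    ultimately have "b s * exp (- (2 * K * s)) \<le> max 0 c0 * 1"
      by (meson mult_mono exp_ge_zero max.cobounded1)
    then show ?thesis by (simp add: B_def)
  qed
  then have bd: "bdd_above (B ` {0..\<tau>})" by (auto intro!: bdd_aboveI2[where M="max 0 c0"])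
  have ne: "B ` {0..\<tau>} \<noteq> {}" using t by auto
  define c where "c = max 0 (SUP s\<in>{0..\<tau>}. B s)"
  have Bc: "B s \<le> c" if "s \<in> {0..\<tau>}" for s
    using cSUP_upper[OF that bd] by (simp add: c_def)
  have "B s \<le> a + c / 2" if s: "s \<in> {0..\<tau>}" for s
  proof -
    have "b s \<le> a + c / 2 * exp (2 * K * s)"
      using s Bc by (intro step) (auto simp: bB c_def intro!: mult_right_mono)
    also have "\<dots> \<le> a * exp (2 * K * s) + c / 2 * exp (2 * K * s)"
      using a K s by (simp add: mult_le_cancel_left1)
    finally have "B s * exp (2 * K * s) \<le> (a + c / 2) * exp (2 * K * s)"
      unfolding bB by (simp add: distrib_right)
    then show ?thesis by (rule mult_right_le_imp_le) simp
  qed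
  then have "(SUP s\<in>{0..\<tau>}. B s) \<le> a + c / 2" using ne by (intro cSUP_least) auto
  moreover have "0 \<le> a + c / 2" using a by (simp add: c_def)
  ultimately have "c \<le> a + c / 2" by (simp add: c_def)
  then have "B t \<le> 2 * a" using Bc[OF t] by simp
  then show ?thesis by (simp add: bB)
qed

lemma exp_has_integral:
  fixes K :: real
  assumes "K \<noteq> 0" "s \<le> t"
  shows "((\<lambda>r. exp (K * (r - c))) has_integral (exp (K * (t - c)) - exp (K * (s - c))) / K) {s..t}"
proof -
  have "((\<lambda>r. exp (K * (r - c))) has_integral (exp (K * (t - c)) / K - exp (K * (s - c)) / K)) {s..t}"
    using assms by (intro fundamental_theorem_of_calculus)
      (auto intro!: derivative_eq_intros simp flip: has_real_derivative_iff_has_vector_derivative)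
  then show ?thesis by (simp add: diff_divide_distrib)
qed

text \<open>
  Supplies the step hypothesis of \<open>gronwall\<close> from a pointwise bound of an integrand.
\<close>

lemma gronwall_integral_bound:
  fixes f :: "real \<Rightarrow> 'a::banach"
  assumes int: "(f has_integral J) {s..t}" and "s \<le> t" and K: "0 \<le> K" and c: "0 \<le> c"
    and le: "\<And>r. r \<in> {s..t} \<Longrightarrow> norm (f r) \<le> K * (c * exp (2 * K * (r - s)))"
  shows "norm J \<le> c / 2 * exp (2 * K * (t - s))"
proof (cases "K = 0")
  case True
  then have "norm J \<le> 0 * (t - s)"
    using le by (intro has_integral_norm_le_const[OF int \<open>s \<le> t\<close>]) auto
  then show ?thesis using c by simp
next
  case False
  have "((\<lambda>r. K * c * exp (2 * K * (r - s))) has_integral K * c * ((exp (2 * K * (t - s)) - exp (2 * K * (s - s))) / (2 * K))) {s..t}"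
    using False \<open>s \<le> t\<close> by (intro has_integral_mult_right exp_has_integral) auto
  from has_integral_norm_le[OF int this] le
  have "norm J \<le> K * c * ((exp (2 * K * (t - s)) - 1) / (2 * K))" by (simp add: mult.assoc)
  also have "\<dots> = c / 2 * (exp (2 * K * (t - s)) - 1)" using False by simp
  also have "\<dots> \<le> c / 2 * exp (2 * K * (t - s))" using c by (intro mult_left_mono) auto
  finally show ?thesis .
qed

text \<open>
  For a quantity known to be finite, an estimate that feeds back at most half of it is an a priori bound.
\<close>

lemma absorb_half:
  fixes f :: "'a \<Rightarrow> real"
  assumes bdd: "\<And>x. x \<in> X \<Longrightarrow> f x \<le> c0" and a: "0 \<le> a"
    and step: "\<And>x c. 0 \<le> c \<Longrightarrow> (\<And>y. y \<in> X \<Longrightarrow> f y \<le> c) \<Longrightarrow> x \<in> X \<Longrightarrow> f x \<le> a + c / 2"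
    and x: "x \<in> X"
  shows "f x \<le> 2 * a"
proof -
  define c where "c = max 0 (SUP x\<in>X. f x)"
  have bd: "bdd_above (f ` X)" using bdd by (auto intro!: bdd_aboveI2[where M=c0])
  have le: "f y \<le> c" if "y \<in> X" for y using cSUP_upper[OF that bd] by (simp add: c_def)
  have "(SUP x\<in>X. f x) \<le> a + c / 2"
    using x le by (intro cSUP_least step) (auto simp: c_def)
  then have "c \<le> a + c / 2" using a by (simp add: c_def)
  then show ?thesis using le[OF x] by linarith
qed

text \<open>
  A first time at which \<open>g\<close> equals \<open>r\<close> would contradict the strict inequality there.
\<close>

lemma continuity_bootstrap:
  fixes g :: "real \<Rightarrow> real"
  assumes cont: "continuous_on {0..} g" and start: "g 0 \<le> r"
    and step: "\<And>\<tau>. 0 \<le> \<tau> \<Longrightarrow> (\<And>t. t \<in> {0..\<tau>} \<Longrightarrow> g t \<le> r) \<Longrightarrow> g \<tau> < r"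
    and t: "0 \<le> t"
  shows "g t \<le> r"
proof (rule ccontr)
  assume "\<not> g t \<le> r"
  then have gt: "r \<le> g t" by simp
  have c: "continuous_on {0..u} g" for u by (rule continuous_on_subset[OF cont]) auto
  define X where "X = {u \<in> {0..t}. g u = r}"
  have ne: "X \<noteq> {}" using IVT'[OF start gt t c] by (auto simp: X_def)
  have "closed X" unfolding X_def by (rule continuous_closed_preimage_constant[OF c]) simp
  moreover have "bounded X" by (rule bounded_subset[of "{0..t}"]) (auto simp: X_def)
  ultimately have "compact X" by (simp add: compact_eq_bounded_closed)
  from compact_attains_inf[OF this ne] obtain u where u: "u \<in> X" "\<And>v. v \<in> X \<Longrightarrow> u \<le> v" by blast
  have "g v \<le> r" if v: "v \<in> {0..u}" for v
  proof (rule ccontr)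
    assume "\<not> g v \<le> r"
    then have "r \<le> g v" by simp
    then obtain w where w: "0 \<le> w" "w \<le> v" "g w = r" using IVT'[OF start _ _ c, of v] v by auto
    then have "u \<le> w" using u v by (intro u(2)) (auto simp: X_def)
    then have "v = w" using w v by auto
    then show False using w \<open>\<not> g v \<le> r\<close> by simp
  qed
  then have "g u < r" using u(1) by (intro step) (auto simp: X_def)
  then show False using u(1) by (simp add: X_def)
qed

text \<open>
  The mean value inequality on the segment from \<open>y\<close> to \<open>x\<close>, on which the derivative differs from the one at \<open>y\<close> by at most
  \<open>\<iota> * norm (x - y)\<close>.
\<close>

lemma linearization_quadratic:
  fixes F :: "'a::real_normed_vector \<Rightarrow> 'b::real_normed_vector" and DF :: "'a \<Rightarrow> 'a \<Rightarrow>\<^sub>L 'b"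
  assumes der: "\<And>x. (F has_derivative DF x) (at x)"
    and lip: "\<And>x y. norm (x - y) < 1 \<Longrightarrow> norm (DF x - DF y) \<le> \<iota> * norm (x - y)" and \<iota>: "0 \<le> \<iota>"
    and xy: "norm (x - y) < 1"
  shows "norm (F x - F y - DF y (x - y)) \<le> \<iota> * norm (x - y) * norm (x - y)"
proof -
  let ?S = "{y + t *\<^sub>R (x - y) | t. t \<in> {0..1}}"
  have "norm (F x - F y - DF y (x - y)) \<le> norm (x - y) * (\<iota> * norm (x - y))"
  proof (rule differentiable_bound_linearization[of y x ?S F DF])
    show "\<And>u. u \<in> ?S \<Longrightarrow> (F has_derivative DF u) (at u within ?S)"
      by (rule has_derivative_at_withinI[OF der])
    show "y \<in> ?S" by (auto intro!: exI[of _ 0])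
    fix u assume "u \<in> ?S"
    then obtain t where t: "0 \<le> t" "t \<le> 1" and u: "u = y + t *\<^sub>R (x - y)" by auto
    have "norm (u - y) \<le> 1 * norm (x - y)" unfolding u using t by (simp add: mult_left_le_one_le)
    then have "norm (DF u - DF y) \<le> \<iota> * norm (x - y)"
      using lip[of u y] xy mult_left_mono[OF _ \<iota>] by (smt (verit))
    then show "onorm (blinfun_apply (DF u) - blinfun_apply (DF y)) \<le> \<iota> * norm (x - y)"
      by (simp add: norm_blinfun.rep_eq minus_blinfun.rep_eq fun_diff_def)
  qed auto
  then show ?thesis by (simp add: mult_ac)
qed

lemma lipschitz_of_derivative_bound:
  fixes F :: "'a::real_normed_vector \<Rightarrow> 'b::real_normed_vector" and DF :: "'a \<Rightarrow> 'a \<Rightarrow>\<^sub>L 'b"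
  assumes der: "\<And>x. (F has_derivative DF x) (at x)" and bd: "\<And>x. norm (DF x) \<le> \<delta>"
  shows "norm (F x - F y) \<le> \<delta> * norm (x - y)"
proof (rule differentiable_bound[of UNIV F "\<lambda>x. blinfun_apply (DF x)"])
  show "onorm (blinfun_apply (DF u)) \<le> \<delta>" for u using bd by (simp add: norm_blinfun.rep_eq)
qed (use der in auto)

section \<open>A semigroup is determined by its generator\<close>

text \<open>
  For each \<open>\<epsilon>\<close> the first time after which \<open>norm (g s - g a) \<le> \<epsilon> * (s - a)\<close> fails cannot exist: continuity gives the
  inequality at that time and the right derivative carries it further.
\<close>

lemma constant_if_right_derivative_zero:
  fixes g :: "real \<Rightarrow> 'a::real_normed_vector"
  assumes "a \<le> b" and cont: "continuous_on {a..b} g"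
    and der: "\<And>s. a \<le> s \<Longrightarrow> s < b \<Longrightarrow> ((\<lambda>h. (g (s + h) - g s) /\<^sub>R h) \<longlongrightarrow> 0) (at_right 0)"
  shows "g b = g a"
proof -
  define f where "f s = norm (g s - g a)" for s
  have f: "continuous_on {a..b} f" unfolding f_def by (intro continuous_intros cont)
  have le: "f b \<le> \<epsilon> * (b - a)" if \<epsilon>: "\<epsilon> > 0" for \<epsilon>
  proof (rule ccontr)
    assume neg: "\<not> f b \<le> \<epsilon> * (b - a)"
    define N where "N = {s\<in>{a..b}. f s > \<epsilon> * (s - a)}"
    define c where "c = Inf N"
    have bN: "b \<in> N" using neg \<open>a \<le> b\<close> by (auto simp: N_def)
    have bdN: "bdd_below N" by (auto simp: N_def intro!: bdd_belowI[of _ a])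
    have ca: "a \<le> c" unfolding c_def using bN by (intro cInf_greatest) (auto simp: N_def)
    have cb: "c \<le> b" unfolding c_def using bN bdN by (rule cInf_lower)
    have below: "f s \<le> \<epsilon> * (s - a)" if "a \<le> s" "s < c" for s
      using that cb cInf_lower[OF _ bdN, of s] by (fastforce simp: N_def c_def)
    have cS: "f c \<le> \<epsilon> * (c - a)"
    proof (cases "c = a")
      case False
      have cont': "((\<lambda>s. f s - \<epsilon> * (s - a)) \<longlongrightarrow> f c - \<epsilon> * (c - a)) (at c within {a..<c})"
      proof -
        have "continuous_on {a..b} (\<lambda>s. f s - \<epsilon> * (s - a))" by (intro continuous_intros f)
        then have "((\<lambda>s. f s - \<epsilon> * (s - a)) \<longlongrightarrow> f c - \<epsilon> * (c - a)) (at c within {a..b})"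
          using ca cb by (auto simp: continuous_on)
        then show ?thesis by (rule tendsto_within_subset) (use cb in auto)
      qed
      have "f c - \<epsilon> * (c - a) \<le> 0"
      proof (rule tendsto_upperbound[OF cont'])
        show "\<forall>\<^sub>F s in at c within {a..<c}. f s - \<epsilon> * (s - a) \<le> 0"
          unfolding eventually_at_filter by (intro always_eventually) (auto simp: below)
        show "at c within {a..<c} \<noteq> bot"
          using False ca by (simp add: at_within_eq_bot_iff)
      qed
      then show ?thesis by simp
    qed (simp add: f_def)
    have cltb: "c < b" using cS neg cb by (cases "c = b") auto
    have "\<forall>\<^sub>F h in at_right 0. norm ((g (c + h) - g c) /\<^sub>R h) < \<epsilon>"
      using tendstoD[OF der[OF ca cltb] \<epsilon>] by (simp add: dist_norm)
    then obtain \<delta> where \<delta>: "\<delta> > 0" "\<And>h. 0 < h \<Longrightarrow> h < \<delta> \<Longrightarrow> norm ((g (c + h) - g c) /\<^sub>R h) < \<epsilon>"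
      by (auto simp: eventually_at_right_field)
    have good: "f s \<le> \<epsilon> * (s - a)" if "c < s" "s < c + \<delta>" for s
    proof -
      define h where "h = s - c"
      have h: "0 < h" "h < \<delta>" "s = c + h" using that by (auto simp: h_def)
      have "norm (g (c + h) - g c) \<le> \<epsilon> * h" 
      proof -
        have "norm (g (c + h) - g c) / h < \<epsilon>"
          using \<delta>(2)[OF h(1,2)] h(1) by (simp only: norm_scaleR) (simp add: divide_inverse mult.commute)
        then show ?thesis using h(1) by (simp only: pos_divide_less_eq)
      qed
      moreover have "f s \<le> f c + norm (g (c + h) - g c)"
        unfolding f_def h(3) using norm_triangle_ineq[of "g c - g a" "g (c + h) - g c"] by (simp add: algebra_simps)
      ultimately show ?thesis using cS h by (simp add: algebra_simps)
    qed
    have "c + \<delta> \<le> s" if "s \<in> N" for s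
    proof (rule ccontr)
      assume "\<not> c + \<delta> \<le> s"
      moreover have "c \<le> s" unfolding c_def using that bdN by (rule cInf_lower)
      ultimately have "f s \<le> \<epsilon> * (s - a)" using good[of s] cS by (cases "s = c") auto
      then show False using that by (simp add: N_def)
    qed
    then have "c + \<delta> \<le> c" unfolding c_def using bN by (intro cInf_greatest) (auto simp: c_def)
    then show False using \<delta>(1) by simp
  qed
  have "f b \<le> 0"
  proof (rule field_le_epsilon)
    fix e :: real assume e: "e > 0"
    have "f b \<le> e / (b - a + 1) * (b - a)" using e \<open>a \<le> b\<close> by (intro le) simp
    also have "\<dots> \<le> e" using e \<open>a \<le> b\<close> by (simp add: field_simps)
    finally show "f b \<le> 0 + e" by simp
  qed
  then show ?thesis by (simp add: f_def)
qed

lemma rescaled_difference_quotient: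
  fixes T :: "real \<Rightarrow> 'a::banach \<Rightarrow>\<^sub>L 'a"
  assumes "((\<lambda>h. (T h x - x) /\<^sub>R h) \<longlongrightarrow> y) (at_right 0)"
  shows "((\<lambda>h. ((exp (\<alpha> * h) *\<^sub>R T h) x - x) /\<^sub>R h) \<longlongrightarrow> y + \<alpha> *\<^sub>R x) (at_right 0)"
proof -
  have "((\<lambda>h. exp (\<alpha> * h)) has_field_derivative \<alpha>) (at 0)"
    by (auto intro!: derivative_eq_intros)
  then have "((\<lambda>h. (exp (\<alpha> * h) - 1) / h) \<longlongrightarrow> \<alpha>) (at 0)"
    by (simp add: has_field_derivative_iff)
  then have q: "((\<lambda>h. (exp (\<alpha> * h) - 1) / h) \<longlongrightarrow> \<alpha>) (at_right 0)"
    by (simp add: filterlim_at_split)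
  have e: "((\<lambda>h. exp (\<alpha> * h)) \<longlongrightarrow> exp (\<alpha> * 0)) (at_right (0::real))"
    by (intro tendsto_intros)
  have "((\<lambda>h. exp (\<alpha> * h) *\<^sub>R ((T h x - x) /\<^sub>R h) + ((exp (\<alpha> * h) - 1) / h) *\<^sub>R x)
      \<longlongrightarrow> exp (\<alpha> * 0) *\<^sub>R y + \<alpha> *\<^sub>R x) (at_right 0)"
    by (intro tendsto_add tendsto_scaleR e q assms tendsto_const)
  moreover have "exp (\<alpha> * h) *\<^sub>R ((T h x - x) /\<^sub>R h) + ((exp (\<alpha> * h) - 1) / h) *\<^sub>R x
      = ((exp (\<alpha> * h) *\<^sub>R T h) x - x) /\<^sub>R h" for h
    by (simp add: blinfun.scaleR_left algebra_simps divide_inverse)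
  ultimately show ?thesis by simp
qed

lemma rescaled_semigroup_generates:
  fixes T :: "real \<Rightarrow> 'a::banach \<Rightarrow>\<^sub>L 'a"
  assumes "generates D A T"
  shows "generates D (\<lambda>x. A x + \<alpha> *\<^sub>R x) (\<lambda>t. exp (\<alpha> * t) *\<^sub>R T t)"
proof -
  have C0: "C0_semigroup T" and D: "D = {x. \<exists>y. ((\<lambda>h. (T h x - x) /\<^sub>R h) \<longlongrightarrow> y) (at_right 0)}"
    and A: "\<And>x. x \<in> D \<Longrightarrow> ((\<lambda>h. (T h x - x) /\<^sub>R h) \<longlongrightarrow> A x) (at_right 0)"
    using assms unfolding generates_def by auto
  have "exp (\<alpha> * (s + t)) *\<^sub>R T (s + t) = (exp (\<alpha> * s) *\<^sub>R T s) o\<^sub>L (exp (\<alpha> * t) *\<^sub>R T t)"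
    if "0 \<le> s" "0 \<le> t" for s t
    using C0 that unfolding C0_semigroup_def
    by (intro blinfun_eqI) (simp add: blinfun.scaleR_left distrib_left exp_add blinfun.scaleR_right)
  moreover have "continuous_on {0..} (\<lambda>t. (exp (\<alpha> * t) *\<^sub>R T t) x)" for x
  proof -
    have "continuous_on {0..} (\<lambda>t. T t x)" using C0 unfolding C0_semigroup_def by blast
    then have "continuous_on {0..} (\<lambda>t. exp (\<alpha> * t) *\<^sub>R T t x)" by (auto intro!: continuous_intros)
    then show ?thesis by (simp add: blinfun.scaleR_left)
  qed
  ultimately have "C0_semigroup (\<lambda>t. exp (\<alpha> * t) *\<^sub>R T t)"
    using C0 unfolding C0_semigroup_def by simp
  moreover have "D = {x. \<exists>y. ((\<lambda>h. ((exp (\<alpha> * h) *\<^sub>R T h) x - x) /\<^sub>R h) \<longlongrightarrow> y) (at_right 0)}"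
  proof (intro set_eqI iffI)
    fix x assume "x \<in> D"
    from rescaled_difference_quotient[OF A[OF this]]
    show "x \<in> {x. \<exists>y. ((\<lambda>h. ((exp (\<alpha> * h) *\<^sub>R T h) x - x) /\<^sub>R h) \<longlongrightarrow> y) (at_right 0)}" by blast
  next
    fix x assume "x \<in> {x. \<exists>y. ((\<lambda>h. ((exp (\<alpha> * h) *\<^sub>R T h) x - x) /\<^sub>R h) \<longlongrightarrow> y) (at_right 0)}"
    then obtain y where "((\<lambda>h. ((exp (\<alpha> * h) *\<^sub>R T h) x - x) /\<^sub>R h) \<longlongrightarrow> y) (at_right 0)" by blast
    from rescaled_difference_quotient[OF this, of "- \<alpha>"]
    have "((\<lambda>h. (T h x - x) /\<^sub>R h) \<longlongrightarrow> y + (- \<alpha>) *\<^sub>R x) (at_right 0)"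
      by (simp add: blinfun.scaleR_left flip: exp_add)
    then show "x \<in> D" unfolding D by blast
  qed
  ultimately show ?thesis
    using rescaled_difference_quotient[OF A] unfolding generates_def by auto
qed

text \<open>
  The curve \<open>s \<mapsto> S (t - s) (T s x)\<close> has right derivative \<open>S (t - s) (A y - A y) = 0\<close> with \<open>y = T s x\<close>, and it joins \<open>S t x\<close> to \<open>T t x\<close>.
\<close>

lemma generator_unique_on_domain:
  fixes S T :: "real \<Rightarrow> 'a::banach \<Rightarrow>\<^sub>L 'a"
  assumes S: "generates D A S" and T: "generates D A T" and t: "0 \<le> t" and x: "x \<in> D"
  shows "S t x = T t x"
proof -
  have S0: "S 0 = id_blinfun" and T0: "T 0 = id_blinfun"
    and Sadd: "\<And>s r. 0 \<le> s \<Longrightarrow> 0 \<le> r \<Longrightarrow> S (s + r) = S s o\<^sub>L S r"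
    and Tadd: "\<And>s r. 0 \<le> s \<Longrightarrow> 0 \<le> r \<Longrightarrow> T (s + r) = T s o\<^sub>L T r"
    and Sc: "\<And>v. continuous_on {0..} (\<lambda>t. S t v)" and Tc: "\<And>v. continuous_on {0..} (\<lambda>t. T t v)"
    using S T unfolding generates_def C0_semigroup_def by simp_all
  have D: "D = {x. \<exists>y. ((\<lambda>h. (T h x - x) /\<^sub>R h) \<longlongrightarrow> y) (at_right 0)}"
    using T unfolding generates_def by (elim conjE)
  have "\<forall>x\<in>D. ((\<lambda>h. (S h x - x) /\<^sub>R h) \<longlongrightarrow> A x) (at_right 0)"
    and "\<forall>x\<in>D. ((\<lambda>h. (T h x - x) /\<^sub>R h) \<longlongrightarrow> A x) (at_right 0)"
    using S T unfolding generates_def by blast+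
  then have SA: "\<And>x. x \<in> D \<Longrightarrow> ((\<lambda>h. (S h x - x) /\<^sub>R h) \<longlongrightarrow> A x) (at_right 0)"
    and TA: "\<And>x. x \<in> D \<Longrightarrow> ((\<lambda>h. (T h x - x) /\<^sub>R h) \<longlongrightarrow> A x) (at_right 0)"
    by blast+
  have Sct: "continuous_on {0..t} (\<lambda>r. S (t - r) v)" for v
    by (rule continuous_on_compose2[OF Sc]) (auto intro!: continuous_intros)
  obtain B where B: "B \<ge> 0" "\<forall>r\<in>{0..t}. norm (S (t - r)) \<le> B"
    using strongly_continuous_bounded[of 0 t "\<lambda>r. S (t - r)", OF Sct] by auto
  have cont: "continuous_on {0..t} (\<lambda>r. S (t - r) (T r x))"
    by (rule continuous_on_strong_apply[OF Sct continuous_on_subset[OF Tc]]) auto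
  have inv: "T s x \<in> D" if "0 \<le> s" for s
  proof -
    have "((\<lambda>h. T s ((T h x - x) /\<^sub>R h)) \<longlongrightarrow> T s (A x)) (at_right 0)"
      by (intro tendsto_intros TA x)
    moreover have "\<forall>\<^sub>F h in at_right 0. T s ((T h x - x) /\<^sub>R h) = (T h (T s x) - T s x) /\<^sub>R h"
      using eventually_at_right_less[of 0]
    proof eventually_elim
      case (elim h)
      then have "T h (T s x) = T s (T h x)"
        using Tadd[of h s] Tadd[of s h] that by (metis add.commute blinfun_apply_blinfun_compose less_imp_le)
      then show ?case by (simp add: blinfun.scaleR_right blinfun.diff_right)
    qed
    ultimately have "((\<lambda>h. (T h (T s x) - T s x) /\<^sub>R h) \<longlongrightarrow> T s (A x)) (at_right 0)"
      by (rule Lim_transform_eventually)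
    then show ?thesis unfolding D by blast
  qed
  have "S (t - t) (T t x) = S (t - 0) (T 0 x)"
  proof (rule constant_if_right_derivative_zero[OF t cont])
    fix s assume s: "0 \<le> s" "s < t"
    define y where "y = T s x"
    have y: "y \<in> D" using inv s by (simp add: y_def)
    define q where "q h = (T h y - y) /\<^sub>R h - (S h y - y) /\<^sub>R h" for h
    have "(q \<longlongrightarrow> A y - A y) (at_right 0)" unfolding q_def by (intro tendsto_diff TA SA y)
    then have "((\<lambda>h. B * norm (q h)) \<longlongrightarrow> B * norm (A y - A y)) (at_right 0)" by (intro tendsto_intros)
    then have lim: "((\<lambda>h. B * norm (q h)) \<longlongrightarrow> 0) (at_right 0)" by simp
    have "\<forall>\<^sub>F h in at_right 0. h < t - s \<and> 0 < h"
      using eventually_at_right_less[of 0] eventually_at_rightI[of 0 "t - s" "\<lambda>h. h < t - s"] s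
      by (auto simp: eventually_conj_iff)
    then have "\<forall>\<^sub>F h in at_right 0. norm ((S (t - (s + h)) (T (s + h) x) - S (t - s) (T s x)) /\<^sub>R h) \<le> B * norm (q h)"
    proof eventually_elim
      case (elim h)
      have 1: "T (s + h) x = T h y" using Tadd[of h s] elim s by (simp add: y_def add.commute)
      have "S (t - s) = S (t - (s + h) + h)" by simp
      also have "\<dots> = S (t - (s + h)) o\<^sub>L S h" using elim s by (intro Sadd) auto
      finally have 2: "S (t - s) (T s x) = S (t - (s + h)) (S h y)" by (simp add: y_def)
      have "(S (t - (s + h)) (T (s + h) x) - S (t - s) (T s x)) /\<^sub>R h = S (t - (s + h)) (q h)"
        unfolding 1 2 q_def by (simp add: blinfun.diff_right blinfun.scaleR_right scaleR_diff_right)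
      also have "norm \<dots> \<le> B * norm (q h)" using B elim s by (intro norm_blinfun_le) auto
      finally show ?case .
    qed
    then show "((\<lambda>h. (S (t - (s + h)) (T (s + h) x) - S (t - s) (T s x)) /\<^sub>R h) \<longlongrightarrow> 0) (at_right 0)"
      by (rule Lim_null_comparison[OF _ lim])
  qed
  then show ?thesis by (simp add: S0 T0)
qed

lemma average_tendsto:
  fixes f :: "real \<Rightarrow> 'a::banach"
  assumes "continuous_on {a..} f"
  shows "((\<lambda>h. (1 / h) *\<^sub>R integral {a..a + h} f) \<longlongrightarrow> f a) (at_right 0)"
proof -
  have "((\<lambda>u. integral {a..u} f) has_vector_derivative f a) (at a within {a..a + 1})"
    by (rule integral_has_vector_derivative) (auto intro: continuous_on_subset[OF assms])
  then have "\<forall>e>0. \<forall>\<^sub>F u in at_right a. norm (integral {a..u} f - (u - a) *\<^sub>R f a) \<le> e * norm (u - a)"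
    by (simp add: has_vector_derivative_def has_derivative_within_alt2 at_within_Icc_at_right)
  then have D: "\<forall>e>0. \<forall>\<^sub>F h in at_right 0. norm (integral {a..a + h} f - h *\<^sub>R f a) \<le> e * norm h"
    by (simp add: eventually_at_right_to_0[of _ a] add.commute)
  show ?thesis
  proof (rule tendstoI)
    fix e :: real assume "e > 0"
    then have "\<forall>\<^sub>F h in at_right 0. norm (integral {a..a + h} f - h *\<^sub>R f a) \<le> e / 2 * norm h"
      by (intro D[rule_format]) simp
    with eventually_at_right_less[of 0]
    show "\<forall>\<^sub>F h in at_right 0. dist ((1 / h) *\<^sub>R integral {a..a + h} f) (f a) < e"
    proof eventually_elim
      case (elim h)
      then have "(1 / h) *\<^sub>R integral {a..a + h} f - f a = (1 / h) *\<^sub>R (integral {a..a + h} f - h *\<^sub>R f a)"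
        by (simp add: scaleR_diff_right)
      then have "dist ((1 / h) *\<^sub>R integral {a..a + h} f) (f a) = norm (integral {a..a + h} f - h *\<^sub>R f a) / h"
        using elim by (simp add: dist_norm)
      also have "\<dots> \<le> e / 2 * norm h / h" using elim by (intro divide_right_mono) auto
      also have "\<dots> < e" using elim \<open>e > 0\<close> by simp
      finally show ?case .
    qed
  qed
qed

text \<open>
  The difference quotient of the integral is a difference of two averages of the orbit, over \<open>[a, a + h]\<close> and over \<open>[0, h]\<close>.
\<close>

lemma average_in_domain:
  fixes T :: "real \<Rightarrow> 'a::banach \<Rightarrow>\<^sub>L 'a"
  assumes T: "generates D A T" and a: "0 < a"
  shows "integral {0..a} (\<lambda>s. T s x) \<in> D"
proof -
  have T0: "T 0 = id_blinfun"
    and Tadd: "\<And>s r. 0 \<le> s \<Longrightarrow> 0 \<le> r \<Longrightarrow> T (s + r) = T s o\<^sub>L T r"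
    and Tc: "\<And>v. continuous_on {0..} (\<lambda>t. T t v)"
    and D: "D = {x. \<exists>y. ((\<lambda>h. (T h x - x) /\<^sub>R h) \<longlongrightarrow> y) (at_right 0)}"
    using assms unfolding generates_def C0_semigroup_def by auto
  define I where "I s t = integral {s..t} (\<lambda>s. T s x)" for s t
  have ii: "(\<lambda>s. T s x) integrable_on {s..t}" if "0 \<le> s" for s t
    using that by (intro integrable_continuous_real continuous_on_subset[OF Tc]) auto
  have shift: "T h (I 0 a) = I h (a + h)" if "0 < h" for h
  proof -
    have "((\<lambda>s. T s x) has_integral I h (a + h)) {h..a + h}"
      unfolding I_def using that by (intro integrable_integral ii) simp
    then have "((\<lambda>s. T (s + h) x) has_integral I h (a + h)) {0..a}"
      using has_integral_shift_real_ivl[of "\<lambda>s. T s x" "I h (a + h)" h "a + h" h] by simp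
    then have "((\<lambda>s. T h (T s x)) has_integral I h (a + h)) {0..a}"
      by (rule has_integral_eq[rotated]) (use that Tadd[of h] in \<open>simp add: add.commute\<close>)
    moreover have "((\<lambda>s. T h (T s x)) has_integral T h (I 0 a)) {0..a}"
      unfolding I_def using has_integral_linear[OF integrable_integral[OF ii] blinfun.bounded_linear_right, of 0 "T h" a] by (simp add: o_def)
    ultimately show ?thesis by (rule has_integral_unique[symmetric])
  qed
  have q: "(T h (I 0 a) - I 0 a) /\<^sub>R h = (1 / h) *\<^sub>R I a (a + h) - (1 / h) *\<^sub>R I 0 (0 + h)" if h: "0 < h" for h
  proof -
    have "I 0 h + I h (a + h) = I 0 (a + h)" "I 0 a + I a (a + h) = I 0 (a + h)"
      unfolding I_def using h a Henstock_Kurzweil_Integration.integral_combine[OF _ _ ii] by simp_all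
    then show ?thesis unfolding shift[OF h] by (simp add: divide_inverse flip: scaleR_diff_right) (metis add_diff_cancel_left' add_diff_eq diff_add_eq diff_diff_eq2)
  qed
  have "((\<lambda>h. (1 / h) *\<^sub>R I a (a + h) - (1 / h) *\<^sub>R I 0 (0 + h)) \<longlongrightarrow> T a x - T 0 x) (at_right 0)"
    unfolding I_def using a by (intro tendsto_diff average_tendsto continuous_on_subset[OF Tc]) auto
  moreover have "\<forall>\<^sub>F h in at_right 0. (1 / h) *\<^sub>R I a (a + h) - (1 / h) *\<^sub>R I 0 (0 + h) = (T h (I 0 a) - I 0 a) /\<^sub>R h"
    using eventually_at_right_less[of 0] by eventually_elim (simp only: q)
  ultimately have "((\<lambda>h. (T h (I 0 a) - I 0 a) /\<^sub>R h) \<longlongrightarrow> T a x - T 0 x) (at_right 0)"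
    by (rule Lim_transform_eventually)
  then show ?thesis unfolding D I_def by blast
qed

text \<open>
  Averages over \<open>[0, h]\<close> lie in the domain and approximate every vector. Applied to \<open>exp (\<alpha> t) *\<^sub>R T t\<close>, this identifies the semigroup
  generated by \<open>A + \<alpha> I\<close>.
\<close>

lemma generator_unique:
  fixes S T :: "real \<Rightarrow> 'a::banach \<Rightarrow>\<^sub>L 'a"
  assumes S: "generates D A S" and T: "generates D A T" and t: "0 \<le> t"
  shows "S t = T t"
proof (rule blinfun_eqI)
  fix x
  have T0: "T 0 = id_blinfun" and Tc: "continuous_on {0..} (\<lambda>t. T t x)"
    using T unfolding generates_def C0_semigroup_def by auto
  define y where "y h = (1 / h) *\<^sub>R integral {0..0 + h} (\<lambda>s. T s x)" for h
  have lim: "(y \<longlongrightarrow> x) (at_right 0)"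
    unfolding y_def using average_tendsto[OF Tc] by (simp add: T0)
  have ev: "\<forall>\<^sub>F h in at_right 0. S t (y h) = T t (y h)"
    using eventually_at_right_less[of 0]
    by eventually_elim (simp add: y_def blinfun.scaleR_right
        generator_unique_on_domain[OF S T t average_in_domain[OF T]])
  have "((\<lambda>h. S t (y h)) \<longlongrightarrow> S t x) (at_right 0)"
    by (rule blinfun.tendsto[OF tendsto_const lim])
  then have "((\<lambda>h. T t (y h)) \<longlongrightarrow> S t x) (at_right 0)"
    by (rule Lim_transform_eventually[OF _ ev])
  moreover have "((\<lambda>h. T t (y h)) \<longlongrightarrow> T t x) (at_right 0)"
    by (rule blinfun.tendsto[OF tendsto_const lim])
  ultimately show "S t x = T t x" by (rule tendsto_unique[rotated]) simp
qed

section \<open>First-order descriptions of evolution operators\<close>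

definition linear_family :: "real \<Rightarrow> real \<Rightarrow> (real \<Rightarrow> 'a::real_normed_vector \<Rightarrow> 'a) \<Rightarrow> bool" where
  "linear_family \<tau> d D \<longleftrightarrow> (\<forall>r\<in>{0..\<tau>}. linear (D r) \<and> (\<forall>v. norm (D r v) \<le> d * norm v))"

definition triangle_bounded :: "real \<Rightarrow> real \<Rightarrow> (real \<Rightarrow> real \<Rightarrow> 'a::real_normed_vector \<Rightarrow>\<^sub>L 'a) \<Rightarrow> bool" where
  "triangle_bounded \<tau> B X \<longleftrightarrow> (\<forall>s t. 0 \<le> s \<longrightarrow> s \<le> t \<longrightarrow> t \<le> \<tau> \<longrightarrow> norm (X t s) \<le> B)"

text \<open>
  An increment form of the mild equation \<open>y' = A y + f\<close>, where \<open>A\<close> generates \<open>S\<close>. The integrand \<open>i\<close> need only agree with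
  \<open>S (b - r) (f r)\<close> up to the length of the interval, so that the same notion covers solutions given
  by other variation-of-constants formulas; the discrepancy is quadratic after integration.
\<close>

definition approx_mild :: "(real \<Rightarrow> 'a::banach \<Rightarrow>\<^sub>L 'a) \<Rightarrow> real \<Rightarrow> real \<Rightarrow> (real \<Rightarrow> 'a) \<Rightarrow> (real \<Rightarrow> 'a) \<Rightarrow> bool" where
  "approx_mild S s t f y \<longleftrightarrow> (\<exists>K\<ge>0. \<forall>a b. s \<le> a \<longrightarrow> a \<le> b \<longrightarrow> b \<le> t \<longrightarrow>
     (\<exists>i. (i has_integral (y b - S (b - a) (y a))) {a..b} \<and>
          (\<forall>r\<in>{a..b}. norm (i r - S (b - r) (f r)) \<le> K * (b - a))))"

text \<open>
  The evolution operator \<open>X\<close> is generated by \<open>A + D\<close>, expressed by its expansion to first order around the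
  semigroup \<open>S\<close> of \<open>A\<close>. In this form the perturbations of successive integral equations simply add up
  (\<open>first_order_perturbed\<close>).
\<close>

definition first_order ::
  "(real \<Rightarrow> 'a::banach \<Rightarrow>\<^sub>L 'a) \<Rightarrow> real \<Rightarrow> (real \<Rightarrow> 'a \<Rightarrow> 'a) \<Rightarrow> (real \<Rightarrow> real \<Rightarrow> 'a \<Rightarrow>\<^sub>L 'a) \<Rightarrow> bool" where
  "first_order S \<tau> D X \<longleftrightarrow> (\<exists>K\<ge>0. \<forall>s t v. 0 \<le> s \<longrightarrow> s \<le> t \<longrightarrow> t \<le> \<tau> \<longrightarrow>
     (\<exists>i. (i has_integral (X t s v - S (t - s) v)) {s..t} \<and>
          (\<forall>r\<in>{s..t}. norm (i r - S (t - r) (D r (S (r - s) v))) \<le> K * (t - s) * norm v)))"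

lemma linear_family_norm: "linear_family \<tau> d D \<Longrightarrow> r \<in> {0..\<tau>} \<Longrightarrow> norm (D r v) \<le> d * norm v"
  by (auto simp: linear_family_def)

lemma linear_family_diff: "linear_family \<tau> d D \<Longrightarrow> r \<in> {0..\<tau>} \<Longrightarrow> D r (u - v) = D r u - D r v"
  by (auto simp: linear_family_def linear_diff)

lemma linear_family_zero: "linear_family \<tau> d (\<lambda>r v. 0)" if "0 \<le> d"
  using that by (auto simp: linear_family_def linear_zero)

lemma linear_family_add:
  assumes "linear_family \<tau> d D" "linear_family \<tau> e E"
  shows "linear_family \<tau> (d + e) (\<lambda>r v. D r v + E r v)"
  using assms by (auto simp: linear_family_def linear_compose_add distrib_right intro!: order_trans[OF norm_triangle_ineq] add_mono)

lemma linear_family_minus: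
  assumes "linear_family \<tau> d D"
  shows "linear_family \<tau> d (\<lambda>r v. - D r v)"
  using assms by (auto simp: linear_family_def linear_compose_neg)

lemma linear_family_compose:
  fixes X :: "real \<Rightarrow> 'b::real_normed_vector \<Rightarrow>\<^sub>L 'a::real_normed_vector" and Y :: "real \<Rightarrow> 'a \<Rightarrow>\<^sub>L 'b"
  assumes X: "\<And>r. r \<in> {0..\<tau>} \<Longrightarrow> norm (X r) \<le> a" and Y: "\<And>r. r \<in> {0..\<tau>} \<Longrightarrow> norm (Y r) \<le> b"
  shows "linear_family \<tau> (a * b) (\<lambda>r v. X r (Y r v))"
  unfolding linear_family_def
proof (intro ballI conjI allI)
  fix r v assume r: "r \<in> {0..\<tau>}"
  show "linear (\<lambda>v. X r (Y r v))"
    using bounded_linear.linear[OF blinfun.bounded_linear_right[of "X r o\<^sub>L Y r"]] by simp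
  show "norm (X r (Y r v)) \<le> a * b * norm v"
    using norm_blinfun_le[OF X[OF r] norm_blinfun_le[OF Y[OF r] order_refl]] by (simp add: mult.assoc)
qed

lemma perturb_product:
  fixes A A0 :: "'a::real_normed_vector \<Rightarrow>\<^sub>L 'b::real_normed_vector"
  assumes D: "linear_family \<tau> d D" and r: "r \<in> {0..\<tau>}" and d: "0 \<le> d"
    and A: "norm (A - A0) \<le> a" "norm A \<le> B" and x: "norm (x - x0) \<le> e" "norm x0 \<le> N"
  shows "norm (A (D r x) - A0 (D r x0)) \<le> B * (d * e) + a * (d * N)"
proof -
  have "A (D r x) - A0 (D r x0) = A (D r (x - x0)) + (A - A0) (D r x0)"
    using D r by (simp add: linear_family_diff blinfun.diff_left blinfun.diff_right)
  also have "norm \<dots> \<le> B * (d * e) + a * (d * N)"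
    using d A x
    by (intro order_trans[OF norm_triangle_ineq] add_mono norm_blinfun_le
          order_trans[OF linear_family_norm[OF D r]] mult_left_mono)
  finally show ?thesis .
qed

text \<open>
  Hence any two evolution operators with a first-order description may be exchanged at the cost of an error
  proportional to the step.
\<close>

lemma first_order_deviation:
  assumes fo: "first_order S \<tau> D X" and D: "linear_family \<tau> d D" "0 \<le> d"
    and S: "\<And>h. h \<in> {0..\<tau>} \<Longrightarrow> norm (S h) \<le> B"
  shows "\<exists>c\<ge>0. \<forall>s t. 0 \<le> s \<longrightarrow> s \<le> t \<longrightarrow> t \<le> \<tau> \<longrightarrow> norm (X t s - S (t - s)) \<le> c * (t - s)"
proof (cases "0 \<le> \<tau>")
  case True
  then have B: "0 \<le> B" using order_trans[OF norm_ge_zero S[of 0]] by auto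
  obtain K where K: "K \<ge> 0" and i: "\<And>s t v. 0 \<le> s \<Longrightarrow> s \<le> t \<Longrightarrow> t \<le> \<tau> \<Longrightarrow>
     (\<exists>i. (i has_integral (X t s v - S (t - s) v)) {s..t} \<and>
          (\<forall>r\<in>{s..t}. norm (i r - S (t - r) (D r (S (r - s) v))) \<le> K * (t - s) * norm v))"
    using fo unfolding first_order_def by meson
  have "norm (X t s - S (t - s)) \<le> (K * \<tau> + B * (d * B)) * (t - s)" if st: "0 \<le> s" "s \<le> t" "t \<le> \<tau>" for s t
  proof (rule norm_blinfun_bound)
    show "0 \<le> (K * \<tau> + B * (d * B)) * (t - s)" using K B D True st by simp
    fix v
    obtain i where i: "(i has_integral (X t s v - S (t - s) v)) {s..t}"
      and i': "\<And>r. r \<in> {s..t} \<Longrightarrow> norm (i r - S (t - r) (D r (S (r - s) v))) \<le> K * (t - s) * norm v"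
      using i[OF st, of v] by auto
    have "norm (i r) \<le> (K * \<tau> + B * (d * B)) * norm v" if r: "r \<in> {s..t}" for r
    proof -
      have "norm (S (t - r) (D r (S (r - s) v))) \<le> B * (d * (B * norm v))"
        using r st D by (intro norm_blinfun_le S order_trans[OF linear_family_norm[OF D(1)]] mult_left_mono) auto
      moreover have "K * (t - s) * norm v \<le> K * \<tau> * norm v"
        using st K by (intro mult_right_mono mult_left_mono) auto
      ultimately show ?thesis
        using i'[OF r] norm_triangle_sub[of "i r" "S (t - r) (D r (S (r - s) v))"] by (simp add: algebra_simps)
    qed
    from has_integral_norm_le_const[OF i \<open>s \<le> t\<close> this]
    show "norm ((X t s - S (t - s)) v) \<le> (K * \<tau> + B * (d * B)) * (t - s) * norm v"
      by (simp add: blinfun.diff_left mult_ac)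
  qed
  moreover have "0 \<le> K * \<tau> + B * (d * B)" using K B D True by simp
  ultimately show ?thesis by blast
next
  case False
  then show ?thesis by (intro exI[of _ 0]) auto
qed

lemma first_order_self: "first_order S \<tau> (\<lambda>r v. 0) (\<lambda>t s. S (t - s))"
  unfolding first_order_def by (intro exI[of _ 0] conjI allI impI exI[of _ "\<lambda>r. 0"]) auto

lemma first_order_perturbed:
  assumes fo: "first_order S \<tau> D X" and D: "linear_family \<tau> d D" "0 \<le> d"
    and S: "\<And>h. h \<in> {0..\<tau>} \<Longrightarrow> norm (S h) \<le> B"
    and X: "triangle_bounded \<tau> B X" and Y: "triangle_bounded \<tau> B Y"
    and E: "linear_family \<tau> e E" "0 \<le> e" and pe: "perturbed_evolution X E Y"
  shows "first_order S \<tau> (\<lambda>r v. D r v + E r v) Y"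
proof (cases "0 \<le> \<tau>")
  case True
  then have B: "0 \<le> B" using order_trans[OF norm_ge_zero S[of 0]] by auto
  obtain K where K: "K \<ge> 0" and i: "\<And>s t v. 0 \<le> s \<Longrightarrow> s \<le> t \<Longrightarrow> t \<le> \<tau> \<Longrightarrow>
     (\<exists>i. (i has_integral (X t s v - S (t - s) v)) {s..t} \<and>
          (\<forall>r\<in>{s..t}. norm (i r - S (t - r) (D r (S (r - s) v))) \<le> K * (t - s) * norm v))"
    using fo unfolding first_order_def by meson
  obtain c where c: "c \<ge> 0" "\<And>s t. 0 \<le> s \<Longrightarrow> s \<le> t \<Longrightarrow> t \<le> \<tau> \<Longrightarrow> norm (X t s - S (t - s)) \<le> c * (t - s)"
    using first_order_deviation[OF fo D S] by blast
  have int: "((\<lambda>r. X t r (E r (Y r s v))) has_integral (Y t s v - X t s v)) {s..t}"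
    if "0 \<le> s" "s \<le> t" for s t v
    using pe that unfolding perturbed_evolution_def by (auto simp: has_integral_iff)
  have nY: "norm (Y t s v) \<le> B * norm v" "norm (X t s) \<le> B" if "0 \<le> s" "s \<le> t" "t \<le> \<tau>" for s t v
    using X Y that by (auto simp: triangle_bounded_def intro!: norm_blinfun_le)
  define c' where "c' = c + B * (e * B)"
  have c': "norm (Y t s v - S (t - s) v) \<le> c' * (t - s) * norm v" if st: "0 \<le> s" "s \<le> t" "t \<le> \<tau>" for s t v
  proof -
    have "norm (Y t s v - X t s v) \<le> B * (e * (B * norm v)) * (t - s)"
      using st E
      by (intro has_integral_norm_le_const[OF int] norm_blinfun_le nY order_trans[OF linear_family_norm[OF E(1)]] mult_left_mono) auto
    moreover have "norm (X t s v - S (t - s) v) \<le> c * (t - s) * norm v"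
      using c(2)[OF st] norm_blinfun_le[of "X t s - S (t - s)" _ v] by (simp add: blinfun.diff_left)
    ultimately show ?thesis unfolding c'_def
      using norm_triangle_ineq[of "Y t s v - X t s v" "X t s v - S (t - s) v"] by (simp add: algebra_simps)
  qed
  define L where "L = K + (B * (e * c') + c * (e * B))"
  have "\<exists>i. (i has_integral (Y t s v - S (t - s) v)) {s..t} \<and>
          (\<forall>r\<in>{s..t}. norm (i r - S (t - r) (D r (S (r - s) v) + E r (S (r - s) v))) \<le> L * (t - s) * norm v)"
    if st: "0 \<le> s" "s \<le> t" "t \<le> \<tau>" for s t v
  proof -
    obtain i where i: "(i has_integral (X t s v - S (t - s) v)) {s..t}"
      and i': "\<And>r. r \<in> {s..t} \<Longrightarrow> norm (i r - S (t - r) (D r (S (r - s) v))) \<le> K * (t - s) * norm v"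
      using i[OF st, of v] by auto
    have "((\<lambda>r. i r + X t r (E r (Y r s v))) has_integral (Y t s v - S (t - s) v)) {s..t}"
      using has_integral_add[OF i int[OF st(1,2), where v = v]] by simp
    moreover have "norm (i r + X t r (E r (Y r s v)) - S (t - r) (D r (S (r - s) v) + E r (S (r - s) v))) \<le> L * (t - s) * norm v"
      if r: "r \<in> {s..t}" for r
    proof -
      have "norm (X t r (E r (Y r s v)) - S (t - r) (E r (S (r - s) v)))
          \<le> B * (e * (c' * (t - s) * norm v)) + c * (t - s) * (e * (B * norm v))"
      proof (rule perturb_product[OF E(1) _ E(2)])
        show "norm (X t r - S (t - r)) \<le> c * (t - s)"
          using c(2)[of r t] r st c(1) by (intro order_trans[OF c(2)] mult_left_mono) auto
        have "c' * (r - s) * norm v \<le> c' * (t - s) * norm v"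
          using r c B E by (intro mult_right_mono mult_left_mono) (auto simp: c'_def)
        then show "norm (Y r s v - S (r - s) v) \<le> c' * (t - s) * norm v"
          using c'[of s r v] r st by auto
        show "norm (S (r - s) v) \<le> B * norm v" using r st by (intro norm_blinfun_le S) auto
      qed (use r st nY in auto)
      moreover have "i r + X t r (E r (Y r s v)) - S (t - r) (D r (S (r - s) v) + E r (S (r - s) v))
         = (i r - S (t - r) (D r (S (r - s) v))) + (X t r (E r (Y r s v)) - S (t - r) (E r (S (r - s) v)))"
        by (simp add: blinfun.add_right)
      ultimately have "norm (i r + X t r (E r (Y r s v)) - S (t - r) (D r (S (r - s) v) + E r (S (r - s) v)))
         \<le> K * (t - s) * norm v + (B * (e * (c' * (t - s) * norm v)) + c * (t - s) * (e * (B * norm v)))"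
        using i'[OF r] by (metis (no_types) add_mono norm_triangle_le)
      also have "\<dots> = L * (t - s) * norm v" by (simp add: L_def algebra_simps)
      finally show ?thesis .
    qed
    ultimately show ?thesis by blast
  qed
  moreover have "0 \<le> L" using K c B E by (auto simp: L_def c'_def)
  ultimately show ?thesis unfolding first_order_def by blast
next
  case False
  then show ?thesis unfolding first_order_def by (intro exI[of _ 0]) auto
qed

text \<open>
  Gronwall's inequality along \<open>h \<mapsto> norm (Y (s + h) s v)\<close>, with constants independent of \<open>s\<close>; strong continuity in each variable
  alone would not give a bound on the whole triangle.
\<close>

lemma perturbed_evolution_bounded:
  assumes X: "triangle_bounded \<tau> B X" and B: "0 \<le> B"
    and D: "\<And>r v. r \<in> {0..\<tau>} \<Longrightarrow> norm (D r v) \<le> d * norm v" "0 \<le> d"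
    and pe: "perturbed_evolution X D Y"
  shows "triangle_bounded \<tau> (2 * B * exp (2 * (B * d) * \<tau>)) Y"
  unfolding triangle_bounded_def
proof (intro allI impI)
  fix s t assume st: "0 \<le> s" "s \<le> t" "t \<le> \<tau>"
  show "norm (Y t s) \<le> 2 * B * exp (2 * (B * d) * \<tau>)"
  proof (rule norm_blinfun_bound)
    show "0 \<le> 2 * B * exp (2 * (B * d) * \<tau>)" using B by simp
    fix v
    have cont: "continuous_on {s..} (\<lambda>t. Y t s v)"
      using pe st unfolding perturbed_evolution_def evolution_operator_def by blast
    have int: "((\<lambda>r. X t r (D r (Y r s v))) has_integral (Y t s v - X t s v)) {s..t}"
      if "s \<le> t" for t
      using pe that st unfolding perturbed_evolution_def by (auto simp: has_integral_iff)
    have "norm (Y (s + (t - s)) s v) \<le> 2 * (B * norm v) * exp (2 * (B * d) * (t - s))"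
    proof (rule gronwall[where b = "\<lambda>h. norm (Y (s + h) s v)" and \<tau> = "\<tau> - s"])
      have "continuous_on {0..\<tau> - s} (\<lambda>h. norm (Y (s + h) s v))"
        by (intro continuous_on_norm continuous_on_compose2[OF cont] continuous_intros) auto
      from compact_continuous_image[OF this]
      have "bounded ((\<lambda>h. norm (Y (s + h) s v)) ` {0..\<tau> - s})" by (intro compact_imp_bounded) auto
      then show "\<exists>c. \<forall>h\<in>{0..\<tau> - s}. norm (Y (s + h) s v) \<le> c" by (auto simp: bounded_iff)
      fix h c
      assume h: "h \<in> {0..\<tau> - s}" and c: "0 \<le> c"
        and le: "\<And>r. r \<in> {0..h} \<Longrightarrow> norm (Y (s + r) s v) \<le> c * exp (2 * (B * d) * r)"
      have "norm (Y (s + h) s v - X (s + h) s v) \<le> c / 2 * exp (2 * (B * d) * (s + h - s))"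
      proof (rule gronwall_integral_bound[OF int])
        fix r assume r: "r \<in> {s..s + h}"
        have "norm (X (s + h) r (D r (Y r s v))) \<le> B * (d * (c * exp (2 * (B * d) * (r - s))))"
        proof (rule norm_blinfun_le)
          have "norm (Y r s v) \<le> c * exp (2 * (B * d) * (r - s))" using le[of "r - s"] r by simp
          then show "norm (D r (Y r s v)) \<le> d * (c * exp (2 * (B * d) * (r - s)))"
            using r h st D(2) by (intro order_trans[OF D(1)] mult_left_mono) auto
        qed (use X r h st in \<open>auto simp: triangle_bounded_def\<close>)
        then show "norm (X (s + h) r (D r (Y r s v))) \<le> B * d * (c * exp (2 * (B * d) * (r - s)))"
          by (simp add: mult_ac)
      qed (use h B D c in auto)
      moreover have "norm (X (s + h) s v) \<le> B * norm v"
        using X h st by (intro norm_blinfun_le) (auto simp: triangle_bounded_def)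
      ultimately show "norm (Y (s + h) s v) \<le> B * norm v + c / 2 * exp (2 * (B * d) * h)"
        using norm_triangle_sub[of "Y (s + h) s v" "X (s + h) s v"] by simp
    qed (use st B D in auto)
    also have "\<dots> \<le> 2 * (B * norm v) * exp (2 * (B * d) * \<tau>)"
      using st B D(2) by (intro mult_left_mono) (auto intro!: mult_left_mono)
    finally show "norm (Y t s v) \<le> 2 * B * exp (2 * (B * d) * \<tau>) * norm v" by (simp add: mult_ac)
  qed
qed

lemma approx_mild_evolution:
  assumes fo: "first_order S \<tau> D Y" and D: "linear_family \<tau> d D" "0 \<le> d"
    and S: "\<And>h. h \<in> {0..\<tau>} \<Longrightarrow> norm (S h) \<le> B"
    and Y: "triangle_bounded \<tau> B Y" "evolution_operator Y"
    and st: "0 \<le> s" "s \<le> t" "t \<le> \<tau>"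
  shows "approx_mild S s t (\<lambda>r. D r (Y r s v)) (\<lambda>r. Y r s v)"
proof -
  have B: "0 \<le> B" using order_trans[OF norm_ge_zero S[of 0]] st by auto
  obtain K where K: "K \<ge> 0" and i: "\<And>s t v. 0 \<le> s \<Longrightarrow> s \<le> t \<Longrightarrow> t \<le> \<tau> \<Longrightarrow>
     (\<exists>i. (i has_integral (Y t s v - S (t - s) v)) {s..t} \<and>
          (\<forall>r\<in>{s..t}. norm (i r - S (t - r) (D r (S (r - s) v))) \<le> K * (t - s) * norm v))"
    using fo unfolding first_order_def by meson
  obtain c where c: "c \<ge> 0" "\<And>s t. 0 \<le> s \<Longrightarrow> s \<le> t \<Longrightarrow> t \<le> \<tau> \<Longrightarrow> norm (Y t s - S (t - s)) \<le> c * (t - s)"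
    using first_order_deviation[OF fo D S] by blast
  have comp: "Y b a (Y a s v) = Y b s v" if "s \<le> a" "a \<le> b" for a b
  proof -
    have "Y b a o\<^sub>L Y a s = Y b s" using Y(2) that st unfolding evolution_operator_def by blast
    then show ?thesis by (metis blinfun_apply_blinfun_compose)
  qed
  define L where "L = (K + B * (d * c)) * (B * norm v)"
  have "\<exists>i. (i has_integral (Y b s v - S (b - a) (Y a s v))) {a..b} \<and>
          (\<forall>r\<in>{a..b}. norm (i r - S (b - r) (D r (Y r s v))) \<le> L * (b - a))"
    if ab: "s \<le> a" "a \<le> b" "b \<le> t" for a b
  proof -
    have na: "norm (Y a s v) \<le> B * norm v" using Y(1) ab st by (intro norm_blinfun_le) (auto simp: triangle_bounded_def)
    obtain i where i: "(i has_integral (Y b a (Y a s v) - S (b - a) (Y a s v))) {a..b}"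
      and i': "\<And>r. r \<in> {a..b} \<Longrightarrow> norm (i r - S (b - r) (D r (S (r - a) (Y a s v)))) \<le> K * (b - a) * norm (Y a s v)"
      using i[of a b "Y a s v"] ab st by auto
    have "norm (i r - S (b - r) (D r (Y r s v))) \<le> L * (b - a)" if r: "r \<in> {a..b}" for r
    proof -
      have "norm (S (b - r) (D r (S (r - a) (Y a s v))) - S (b - r) (D r (Y r s v)))
         = norm (S (b - r) (D r (S (r - a) (Y a s v) - Y r a (Y a s v))))"
        using r ab st comp[of a r] by (simp add: linear_family_diff[OF D(1)] blinfun.diff_right)
      also have "\<dots> \<le> B * (d * (c * (b - a) * (B * norm v)))"
      proof (intro norm_blinfun_le S order_trans[OF linear_family_norm[OF D(1)]] mult_left_mono D)
        have "norm (S (r - a) (Y a s v) - Y r a (Y a s v)) = norm ((Y r a - S (r - a)) (Y a s v))"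
          by (simp add: blinfun.diff_left norm_minus_commute)
        also have "\<dots> \<le> c * (b - a) * (B * norm v)"
          by (rule norm_blinfun_le[OF _ na]) (use r ab st c(1) in \<open>auto intro!: order_trans[OF c(2)] mult_left_mono\<close>)
        finally show "norm (S (r - a) (Y a s v) - Y r a (Y a s v)) \<le> c * (b - a) * (B * norm v)" .
      qed (use r ab st in auto)
      finally have 1: "norm (S (b - r) (D r (S (r - a) (Y a s v))) - S (b - r) (D r (Y r s v))) \<le> B * (d * (c * (b - a) * (B * norm v)))" .
      have "K * (b - a) * norm (Y a s v) \<le> K * (b - a) * (B * norm v)"
        using na K ab by (intro mult_left_mono) auto
      then have 2: "norm (i r - S (b - r) (D r (S (r - a) (Y a s v)))) \<le> K * (b - a) * (B * norm v)"
        using i'[OF r] by linarith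
      show ?thesis using norm_triangle_mono[OF 2 1] by (simp add: L_def algebra_simps)
    qed
    then show ?thesis using i comp ab by auto
  qed
  moreover have "0 \<le> L" using K B D c by (simp add: L_def)
  ultimately show ?thesis unfolding approx_mild_def by blast
qed

text \<open>
  The variation-of-constants formula \<open>y t - X t s (y s) = \<integral> X t r (f r - D r (y r)) dr\<close> as an inequality, tested against \<open>w\<close>. The
  function \<open>r \<mapsto> w \<bullet> X t r (y r)\<close> is followed over short steps; to first order its increment is
  \<open>w \<bullet> X t r (f r - D r (y r))\<close> times the step. A majorant \<open>q\<close> is used because this integrand is not known to be
  integrable.
\<close>

lemma duhamel_upper:
  fixes y f :: "real \<Rightarrow> 'a::{real_inner,banach}"
  assumes fo: "first_order S \<tau> D X" and D: "linear_family \<tau> d D" "0 \<le> d"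
    and S: "\<And>h. h \<in> {0..\<tau>} \<Longrightarrow> norm (S h) \<le> B"
    and X: "triangle_bounded \<tau> B X" "evolution_operator X"
    and st: "0 \<le> s" "s \<le> t" "t \<le> \<tau>"
    and y: "approx_mild S s t f y"
    and N: "\<And>r. r \<in> {s..t} \<Longrightarrow> norm (y r) \<le> N" "\<And>r. r \<in> {s..t} \<Longrightarrow> norm (f r) \<le> N"
    and q: "q integrable_on {s..t}" "\<And>r. r \<in> {s..t} \<Longrightarrow> w \<bullet> X t r (f r - D r (y r)) \<le> q r"
  shows "w \<bullet> (y t - X t s (y s)) \<le> integral {s..t} q"
proof -
  have B: "0 \<le> B" using order_trans[OF norm_ge_zero S[of 0]] st by auto
  have N0: "0 \<le> N" using order_trans[OF norm_ge_zero N(1)[of s]] st by auto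
  obtain K where K: "K \<ge> 0" and iX: "\<And>s t v. 0 \<le> s \<Longrightarrow> s \<le> t \<Longrightarrow> t \<le> \<tau> \<Longrightarrow>
     (\<exists>i. (i has_integral (X t s v - S (t - s) v)) {s..t} \<and>
          (\<forall>r\<in>{s..t}. norm (i r - S (t - r) (D r (S (r - s) v))) \<le> K * (t - s) * norm v))"
    using fo unfolding first_order_def by meson
  obtain L where L: "L \<ge> 0" and iy: "\<And>a b. s \<le> a \<Longrightarrow> a \<le> b \<Longrightarrow> b \<le> t \<Longrightarrow>
     (\<exists>i. (i has_integral (y b - S (b - a) (y a))) {a..b} \<and>
          (\<forall>r\<in>{a..b}. norm (i r - S (b - r) (f r)) \<le> L * (b - a)))"
    using y unfolding approx_mild_def by meson
  obtain c where c: "c \<ge> 0" "\<And>s t. 0 \<le> s \<Longrightarrow> s \<le> t \<Longrightarrow> t \<le> \<tau> \<Longrightarrow> norm (X t s - S (t - s)) \<le> c * (t - s)"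
    using first_order_deviation[OF fo D S] by blast
  have nX: "norm (X b a) \<le> B" if "0 \<le> a" "a \<le> b" "b \<le> \<tau>" for a b
    using X(1) that by (auto simp: triangle_bounded_def)
  have comp: "X t b (X b a v) = X t a v" if "0 \<le> a" "a \<le> b" "b \<le> t" for a b v
  proof -
    have "X t b o\<^sub>L X b a = X t a" using X(2) that unfolding evolution_operator_def by blast
    then show ?thesis by (metis blinfun_apply_blinfun_compose)
  qed
  have nD: "norm (D r v) \<le> d * M" if "r \<in> {s..t}" "norm v \<le> M" for r v M
    using that st D by (intro order_trans[OF linear_family_norm[OF D(1)]] mult_left_mono) auto
  define c' where "c' = L * \<tau> + B * N"
  have c': "norm (y b - S (b - a) (y a)) \<le> c' * (b - a)" if ab: "s \<le> a" "a \<le> b" "b \<le> t" for a b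
  proof -
    obtain i where i: "(i has_integral (y b - S (b - a) (y a))) {a..b}"
      and i': "\<And>r. r \<in> {a..b} \<Longrightarrow> norm (i r - S (b - r) (f r)) \<le> L * (b - a)"
      using iy[OF ab] by auto
    have "norm (i r) \<le> c'" if r: "r \<in> {a..b}" for r
    proof -
      have "norm (S (b - r) (f r)) \<le> B * N" using r ab st by (intro norm_blinfun_le S N) auto
      moreover have "L * (b - a) \<le> L * \<tau>" using L ab st by (intro mult_left_mono) auto
      ultimately show ?thesis
        using i'[OF r] norm_triangle_sub[of "i r" "S (b - r) (f r)"] unfolding c'_def by linarith
    qed
    from has_integral_norm_le_const[OF i \<open>a \<le> b\<close> this] show ?thesis by simp
  qed
  have c'0: "0 \<le> c'" using L B N0 st by (simp add: c'_def)
  define C where "C = norm w * (B * (L + K * N + B * (d * c') + c * (N + d * N)))"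
  define g where "g r = w \<bullet> X t r (y r) - integral {s..r} q" for r
  have "g t \<le> g s"
  proof (rule telescope_le[OF \<open>s \<le> t\<close>])
    fix a b assume ab: "s \<le> a" "a \<le> b" "b \<le> t"
    obtain i where i: "(i has_integral (y b - S (b - a) (y a))) {a..b}"
      and i': "\<And>r. r \<in> {a..b} \<Longrightarrow> norm (i r - S (b - r) (f r)) \<le> L * (b - a)"
      using iy[OF ab] by auto
    obtain j where j: "(j has_integral (X b a (y a) - S (b - a) (y a))) {a..b}"
      and j': "\<And>r. r \<in> {a..b} \<Longrightarrow> norm (j r - S (b - r) (D r (S (r - a) (y a)))) \<le> K * (b - a) * norm (y a)"
      using iX[of a b "y a"] ab st by auto
    have "((\<lambda>r. i r - j r) has_integral (y b - X b a (y a))) {a..b}"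
      using has_integral_diff[OF i j] by simp
    from has_integral_linear[OF this, of "\<lambda>v. w \<bullet> X t b v"]
    have int: "((\<lambda>r. w \<bullet> X t b (i r - j r)) has_integral (w \<bullet> X t b (y b - X b a (y a)))) {a..b}"
      by (simp add: o_def bounded_linear_inner_right_comp blinfun.bounded_linear_right)
    have qab: "q integrable_on {a..b}" by (rule integrable_on_subinterval[OF q(1)]) (use ab in auto)
    have "w \<bullet> X t b (i r - j r) \<le> q r + C * (b - a)" if r: "r \<in> {a..b}" for r
    proof -
      \<comment> \<open>\<open>e1\<close> and \<open>e2\<close> are the discrepancies of the two expansions; \<open>e3\<close> and \<open>e4\<close> arise from exchanging \<open>S\<close> with \<open>y\<close> and \<open>X\<close>.\<close>
      define e1 where "e1 = i r - S (b - r) (f r)"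
      define e2 where "e2 = j r - S (b - r) (D r (S (r - a) (y a)))"
      define e3 where "e3 = S (b - r) (D r (y r - S (r - a) (y a)))"
      define e4 where "e4 = (S (b - r) - X b r) (f r - D r (y r))"
      have "X t b (i r - j r) = X t r (f r - D r (y r)) + X t b (e1 - e2 + e3 + e4)"
        using comp[of r b] r ab st unfolding e1_def e2_def e3_def e4_def
        by (simp add: linear_family_diff[OF D(1)] blinfun.diff_right blinfun.diff_left blinfun.add_right)
      moreover have "w \<bullet> X t b (e1 - e2 + e3 + e4) \<le> C * (b - a)"
      proof -
        have n1: "norm e1 \<le> L * (b - a)" using i'[OF r] by (simp add: e1_def)
        have "K * (b - a) * norm (y a) \<le> K * (b - a) * N" using N K ab by (intro mult_left_mono) auto
        then have n2: "norm e2 \<le> K * (b - a) * N" using j'[OF r] by (simp add: e2_def)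
        have n3: "norm e3 \<le> B * (d * (c' * (b - a)))" unfolding e3_def
          using r ab st c'0 by (intro norm_blinfun_le S nD order_trans[OF c'] mult_left_mono) auto
        have "norm (f r - D r (y r)) \<le> N + d * N"
          using r ab by (intro order_trans[OF norm_triangle_ineq4] add_mono N nD) auto
        moreover have "norm (S (b - r) - X b r) \<le> c * (b - a)"
          using r ab st c(1) by (subst norm_minus_commute) (intro order_trans[OF c(2)] mult_left_mono; auto)
        ultimately have n4: "norm e4 \<le> c * (b - a) * (N + d * N)" unfolding e4_def by (intro norm_blinfun_le)
        have "norm (e1 - e2 + e3 + e4) \<le> L * (b - a) + K * (b - a) * N + B * (d * (c' * (b - a))) + c * (b - a) * (N + d * N)"
          by (intro order_trans[OF norm_triangle_ineq] order_trans[OF norm_triangle_ineq4] add_mono n1 n2 n3 n4)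
        then have "norm (X t b (e1 - e2 + e3 + e4)) \<le> B * (L * (b - a) + K * (b - a) * N + B * (d * (c' * (b - a))) + c * (b - a) * (N + d * N))"
          using ab st by (intro norm_blinfun_le nX) auto
        then have "norm w * norm (X t b (e1 - e2 + e3 + e4)) \<le> C * (b - a)"
          using mult_left_mono[OF _ norm_ge_zero[of w]] by (fastforce simp: C_def algebra_simps)
        then show ?thesis using norm_cauchy_schwarz order_trans by blast
      qed
      ultimately show ?thesis using q(2)[of r] r ab by (simp add: inner_add_right)
    qed
    moreover have "((\<lambda>r. q r + C * (b - a)) has_integral (integral {a..b} q + C * (b - a) * (b - a))) {a..b}"
      using has_integral_add[OF integrable_integral[OF qab] has_integral_const_real[of "C * (b - a)" a b]] ab
      by (simp add: mult_ac)
    ultimately have "w \<bullet> X t b (y b - X b a (y a)) \<le> integral {a..b} q + C * (b - a) * (b - a)"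
      using has_integral_le[OF int] by blast
    moreover have "w \<bullet> X t b (y b - X b a (y a)) = w \<bullet> X t b (y b) - w \<bullet> X t a (y a)"
      using comp[of a b] ab st by (simp add: blinfun.diff_right inner_diff_right)
    moreover have "integral {s..a} q + integral {a..b} q = integral {s..b} q"
      by (rule Henstock_Kurzweil_Integration.integral_combine)
        (use ab in \<open>auto intro: integrable_on_subinterval[OF q(1)]\<close>)
    ultimately show "g b - g a \<le> C * (b - a)\<^sup>2"
      unfolding g_def power2_eq_square by (simp add: mult.assoc)
  qed
  moreover have "X t t (y t) = y t" using X(2) st unfolding evolution_operator_def by simp
  ultimately show ?thesis by (simp add: g_def inner_diff_right)
qed

lemma duhamel_estimate:
  fixes y f :: "real \<Rightarrow> 'a::{real_inner,banach}"
  assumes fo: "first_order S \<tau> D X" and D: "linear_family \<tau> d D" "0 \<le> d"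
    and S: "\<And>h. h \<in> {0..\<tau>} \<Longrightarrow> norm (S h) \<le> B"
    and X: "triangle_bounded \<tau> B X" "evolution_operator X"
    and st: "0 \<le> s" "s \<le> t" "t \<le> \<tau>"
    and y: "approx_mild S s t f y"
    and N: "\<And>r. r \<in> {s..t} \<Longrightarrow> norm (y r) \<le> N" "\<And>r. r \<in> {s..t} \<Longrightarrow> norm (f r) \<le> N"
    and q: "q integrable_on {s..t}" "\<And>r. r \<in> {s..t} \<Longrightarrow> \<bar>w \<bullet> X t r (f r - D r (y r))\<bar> \<le> q r"
  shows "\<bar>w \<bullet> (y t - X t s (y s))\<bar> \<le> integral {s..t} q"
  using duhamel_upper[OF fo D S X st y N q(1), of w] duhamel_upper[OF fo D S X st y N q(1), of "- w"] q(2)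
  by (fastforce simp: abs_le_iff)

lemma triangle_bounded_mono: "triangle_bounded \<tau> B X \<Longrightarrow> B \<le> B' \<Longrightarrow> triangle_bounded \<tau> B' X"
  by (fastforce simp: triangle_bounded_def)

text \<open>
  The closed loop and the two reference evolutions all arise by first perturbing the semigroup by the
  linearization and then the result by a second family.
\<close>

lemma first_order_two_step:
  fixes S :: "real \<Rightarrow> 'a::banach \<Rightarrow>\<^sub>L 'a"
  assumes S: "\<And>v. continuous_on {0..} (\<lambda>t. S t v)"
    and pe1: "perturbed_evolution (\<lambda>t s. S (t - s)) A U" and A: "linear_family \<tau> a A" "0 \<le> a"
    and pe2: "perturbed_evolution U E Y" and E: "linear_family \<tau> e E" "0 \<le> e"
  shows "first_order S \<tau> (\<lambda>r v. A r v + E r v) Y" and "\<exists>B\<ge>0. triangle_bounded \<tau> B Y"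
proof -
  obtain B0 where B0: "B0 \<ge> 0" "\<forall>t\<in>{0..\<tau>}. norm (S t) \<le> B0"
    using strongly_continuous_bounded[of 0 \<tau> S] continuous_on_subset[OF S] by auto
  have S0: "triangle_bounded \<tau> B0 (\<lambda>t s. S (t - s))" using B0 by (auto simp: triangle_bounded_def)
  define B1 where "B1 = 2 * B0 * exp (2 * (B0 * a) * \<tau>)"
  have B1: "0 \<le> B1" "triangle_bounded \<tau> B1 U"
    unfolding B1_def using perturbed_evolution_bounded[OF S0 B0(1) linear_family_norm[OF A(1)] A(2) pe1] B0 by auto
  define B2 where "B2 = 2 * B1 * exp (2 * (B1 * e) * \<tau>)"
  have B2: "0 \<le> B2" "triangle_bounded \<tau> B2 Y"
    unfolding B2_def using perturbed_evolution_bounded[OF B1(2,1) linear_family_norm[OF E(1)] E(2) pe2] B1 by auto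
  define B where "B = max B0 (max B1 B2)"
  have SB: "norm (S h) \<le> B" if "h \<in> {0..\<tau>}" for h using B0 that by (fastforce simp: B_def)
  have bd: "triangle_bounded \<tau> B (\<lambda>t s. S (t - s))" "triangle_bounded \<tau> B U" "triangle_bounded \<tau> B Y"
    using S0 B1 B2 by (auto simp: B_def intro: triangle_bounded_mono)
  have "first_order S \<tau> (\<lambda>r v. 0 + A r v) U"
    by (rule first_order_perturbed[OF first_order_self linear_family_zero[of 0] _ SB bd(1,2) A pe1]) auto
  then have "first_order S \<tau> A U" by simp
  from first_order_perturbed[OF this A SB bd(2,3) E pe2]
  show "first_order S \<tau> (\<lambda>r v. A r v + E r v) Y" .
  show "\<exists>B\<ge>0. triangle_bounded \<tau> B Y" using B2 by blast
qed

lemma first_order_difference: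
  assumes Z: "first_order S \<tau> D Z" and X: "first_order S \<tau> E X"
  shows "\<exists>K\<ge>0. \<forall>s t v. 0 \<le> s \<longrightarrow> s \<le> t \<longrightarrow> t \<le> \<tau> \<longrightarrow>
     (\<exists>i. (i has_integral (Z t s v - X t s v)) {s..t} \<and>
          (\<forall>r\<in>{s..t}. norm (i r - S (t - r) (D r (S (r - s) v) - E r (S (r - s) v))) \<le> K * (t - s) * norm v))"
proof -
  obtain K where K: "K \<ge> 0" and iZ: "\<And>s t v. 0 \<le> s \<Longrightarrow> s \<le> t \<Longrightarrow> t \<le> \<tau> \<Longrightarrow>
     (\<exists>i. (i has_integral (Z t s v - S (t - s) v)) {s..t} \<and>
          (\<forall>r\<in>{s..t}. norm (i r - S (t - r) (D r (S (r - s) v))) \<le> K * (t - s) * norm v))"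
    using Z unfolding first_order_def by meson
  obtain L where L: "L \<ge> 0" and iX: "\<And>s t v. 0 \<le> s \<Longrightarrow> s \<le> t \<Longrightarrow> t \<le> \<tau> \<Longrightarrow>
     (\<exists>i. (i has_integral (X t s v - S (t - s) v)) {s..t} \<and>
          (\<forall>r\<in>{s..t}. norm (i r - S (t - r) (E r (S (r - s) v))) \<le> L * (t - s) * norm v))"
    using X unfolding first_order_def by meson
  have "\<exists>i. (i has_integral (Z t s v - X t s v)) {s..t} \<and>
          (\<forall>r\<in>{s..t}. norm (i r - S (t - r) (D r (S (r - s) v) - E r (S (r - s) v))) \<le> (K + L) * (t - s) * norm v)"
    if st: "0 \<le> s" "s \<le> t" "t \<le> \<tau>" for s t v
  proof -
    obtain i where i: "(i has_integral (Z t s v - S (t - s) v)) {s..t}"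
      and i': "\<And>r. r \<in> {s..t} \<Longrightarrow> norm (i r - S (t - r) (D r (S (r - s) v))) \<le> K * (t - s) * norm v"
      using iZ[OF st, of v] by auto
    obtain j where j: "(j has_integral (X t s v - S (t - s) v)) {s..t}"
      and j': "\<And>r. r \<in> {s..t} \<Longrightarrow> norm (j r - S (t - r) (E r (S (r - s) v))) \<le> L * (t - s) * norm v"
      using iX[OF st, of v] by auto
    have "((\<lambda>r. i r - j r) has_integral (Z t s v - X t s v)) {s..t}"
      using has_integral_diff[OF i j] by simp
    moreover have "norm (i r - j r - S (t - r) (D r (S (r - s) v) - E r (S (r - s) v))) \<le> (K + L) * (t - s) * norm v"
      if r: "r \<in> {s..t}" for r
    proof -
      have eq: "i r - j r - S (t - r) (D r (S (r - s) v) - E r (S (r - s) v))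
        = (i r - S (t - r) (D r (S (r - s) v))) - (j r - S (t - r) (E r (S (r - s) v)))"
        by (simp add: blinfun.diff_right)
      show ?thesis unfolding eq distrib_right
        by (rule order_trans[OF norm_triangle_ineq4 add_mono[OF i'[OF r] j'[OF r]]])
    qed
    ultimately show ?thesis by blast
  qed
  then show ?thesis using K L by (intro exI[of _ "K + L"]) auto
qed

section \<open>The Riccati equation on a finite horizon\<close>

text \<open>
  The bound \<open>B\<close> is tied to one horizon and may depend on it; no final estimate contains it.
\<close>

locale gain_data =
  fixes C :: "'h::{real_inner,banach} \<Rightarrow>\<^sub>L 'b::euclidean_space" and R :: "real \<Rightarrow> 'b \<Rightarrow>\<^sub>L 'b"
    and P :: "real \<Rightarrow> 'h \<Rightarrow>\<^sub>L 'h" and \<tau> B \<rho> :: real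
  assumes B: "0 \<le> B"
    and P: "\<And>t. t \<in> {0..\<tau>} \<Longrightarrow> norm (P t) \<le> B"
    and R: "\<And>t. t \<in> {0..\<tau>} \<Longrightarrow> selfadjoint (R t)" "0 < \<rho>"
           "\<And>t v. t \<in> {0..\<tau>} \<Longrightarrow> \<rho> * (norm v)\<^sup>2 \<le> v \<bullet> R t v"
begin

definition gain_kernel :: "real \<Rightarrow> 'h \<Rightarrow> 'h" where
  "gain_kernel t v = adjoint C (inv (R t) (C v))"

lemma gain_eq: "observer_gain P C R t (C v) = P t (gain_kernel t v)"
  by (simp add: observer_gain_def gain_kernel_def)

lemma kernel_inner: "gain_kernel t v \<bullet> u = inv (R t) (C v) \<bullet> C u"
  by (simp add: gain_kernel_def adjoint_inner)

lemma kernel_sym: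
  assumes "t \<in> {0..\<tau>}"
  shows "gain_kernel t v \<bullet> u = v \<bullet> gain_kernel t u"
  using coercive_inverse(5)[OF R(1)[OF assms] R(2) R(3)[OF assms], of "C v" "C u"]
  by (metis inner_commute kernel_inner)

definition "dK = norm C * (norm C / \<rho>)"

lemma dK: "0 \<le> dK" using R(2) by (simp add: dK_def)

lemma kernel_family: "linear_family \<tau> dK gain_kernel"
  unfolding linear_family_def
proof (intro ballI conjI allI)
  fix r v assume r: "r \<in> {0..\<tau>}"
  note ci = coercive_inverse[OF R(1)[OF r] R(2) R(3)[OF r]]
  show "linear (gain_kernel r)"
    unfolding gain_kernel_def
    by (intro linear_compose[OF _ linear_adjoint_blinfun, unfolded o_def] linear_compose[OF _ ci(2), unfolded o_def]
        bounded_linear.linear blinfun.bounded_linear_right)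
  have "norm (inv (R r) (C v)) \<le> norm (C v) / \<rho>" by (rule ci)
  also have "\<dots> \<le> norm C * norm v / \<rho>" using R(2) by (intro divide_right_mono norm_blinfun) auto
  finally have "norm C * norm (inv (R r) (C v)) \<le> norm C * (norm C * norm v / \<rho>)" by (intro mult_left_mono) auto
  then show "norm (gain_kernel r v) \<le> dK * norm v"
    using norm_adjoint_le[of C "inv (R r) (C v)"] by (simp add: gain_kernel_def dK_def)
qed

lemma gain_family: "linear_family \<tau> (B * dK) (\<lambda>r v. observer_gain P C R r (C v))"
  unfolding linear_family_def gain_eq
proof (intro ballI conjI allI)
  fix r v assume r: "r \<in> {0..\<tau>}"
  have "linear (gain_kernel r)" using kernel_family r by (simp add: linear_family_def)
  from linear_compose[OF this bounded_linear.linear[OF blinfun.bounded_linear_right]]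
  show "linear (\<lambda>v. P r (gain_kernel r v))" by (simp add: o_def)
  show "norm (P r (gain_kernel r v)) \<le> B * dK * norm v"
    using norm_blinfun_le[OF P[OF r] linear_family_norm[OF kernel_family r]] by (simp add: mult.assoc)
qed

end

locale riccati_horizon = gain_data C R P \<tau> B \<rho>
  for C :: "'h::{real_inner,banach} \<Rightarrow>\<^sub>L 'b::euclidean_space" and R :: "real \<Rightarrow> 'b \<Rightarrow>\<^sub>L 'b"
    and P :: "real \<Rightarrow> 'h \<Rightarrow>\<^sub>L 'h" and \<tau> B \<rho> :: real +
  fixes S :: "real \<Rightarrow> 'h \<Rightarrow>\<^sub>L 'h" and A1 :: "real \<Rightarrow> 'h \<Rightarrow> 'h"
    and UP :: "real \<Rightarrow> real \<Rightarrow> 'h \<Rightarrow>\<^sub>L 'h" and W :: "real \<Rightarrow> 'h \<Rightarrow>\<^sub>L 'h" and P0 :: "'h \<Rightarrow>\<^sub>L 'h"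
    and dA w\<^sub>W :: real
  assumes \<tau>: "0 \<le> \<tau>" and dA: "0 \<le> dA"
    and S: "\<And>h. h \<in> {0..\<tau>} \<Longrightarrow> norm (S h) \<le> B"
    and UP: "triangle_bounded \<tau> B UP" "evolution_operator UP"
    and A1: "linear_family \<tau> dA A1"
    and fo_UP: "first_order S \<tau> (\<lambda>r v. A1 r v - observer_gain P C R r (C v)) UP"
    and P0: "selfadjoint P0" "\<And>v. 0 \<le> v \<bullet> P0 v"
    and W: "\<And>t. t \<in> {0..\<tau>} \<Longrightarrow> selfadjoint (W t)" "\<And>t. t \<in> {0..\<tau>} \<Longrightarrow> nonneg_definite (W t)"
           "\<And>t. t \<in> {0..\<tau>} \<Longrightarrow> norm (W t) \<le> w\<^sub>W" "0 \<le> w\<^sub>W"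
    and riccati: "\<And>t w. t \<in> {0..\<tau>} \<Longrightarrow>
        ((\<lambda>s. UP t s (W s (adjoint (UP t s) w) + observer_gain P C R s (C (P s (adjoint (UP t s) w)))))
          has_integral (P t w - UP t 0 (P0 (adjoint (UP t 0) w)))) {0..t}"
begin

lemma closed_loop_family: "linear_family \<tau> (dA + B * dK) (\<lambda>r v. A1 r v - observer_gain P C R r (C v))"
  using linear_family_add[OF A1 linear_family_minus[OF gain_family]] by simp

abbreviation xi :: "real \<Rightarrow> real \<Rightarrow> 'h \<Rightarrow> 'h" where
  "xi t s w \<equiv> adjoint (UP t s) w"

lemma norm_UP: "0 \<le> s \<Longrightarrow> s \<le> t \<Longrightarrow> t \<le> \<tau> \<Longrightarrow> norm (UP t s) \<le> B"
  using UP(1) by (auto simp: triangle_bounded_def)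

lemma norm_xi: "0 \<le> s \<Longrightarrow> s \<le> t \<Longrightarrow> t \<le> \<tau> \<Longrightarrow> norm (xi t s w) \<le> B * norm w"
  by (intro order_trans[OF norm_adjoint_le] mult_right_mono norm_UP) auto

lemma UP_comp: "0 \<le> s \<Longrightarrow> s \<le> r \<Longrightarrow> r \<le> t \<Longrightarrow> UP t r o\<^sub>L UP r s = UP t s"
  using UP(2) by (auto simp: evolution_operator_def)

lemma UP_comp_apply: "0 \<le> s \<Longrightarrow> s \<le> r \<Longrightarrow> r \<le> t \<Longrightarrow> UP t r (UP r s v) = UP t s v"
  using UP_comp by (metis blinfun_apply_blinfun_compose)

lemma xi_comp: "0 \<le> s \<Longrightarrow> s \<le> r \<Longrightarrow> r \<le> t \<Longrightarrow> xi r s (xi t r w) = xi t s w"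
  using adjoint_compose[of "UP t r" "UP r s" w] UP_comp by simp

definition forcing :: "real \<Rightarrow> 'h \<Rightarrow> 'h" where
  "forcing r v = W r v + P r (gain_kernel r (P r v))"

lemma norm_forcing:
  assumes "r \<in> {0..\<tau>}" "norm v \<le> N"
  shows "norm (forcing r v) \<le> (w\<^sub>W + B * (dK * B)) * N"
proof -
  have N: "0 \<le> N" using order_trans[OF norm_ge_zero assms(2)] .
  have "norm (W r v) \<le> w\<^sub>W * N" using W assms by (intro norm_blinfun_le) auto
  moreover have "norm (P r v) \<le> B * N" using P assms by (intro norm_blinfun_le) auto
  then have "norm (gain_kernel r (P r v)) \<le> dK * (B * N)"
    using dK by (intro order_trans[OF linear_family_norm[OF kernel_family assms(1)]] mult_left_mono) auto
  then have "norm (P r (gain_kernel r (P r v))) \<le> B * (dK * (B * N))"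
    by (rule norm_blinfun_le[OF P[OF assms(1)]])
  ultimately show ?thesis unfolding forcing_def
    using norm_triangle_ineq[of "W r v" "P r (gain_kernel r (P r v))"] by (simp add: algebra_simps)
qed

lemma riccati':
  assumes "t \<in> {0..\<tau>}"
  shows "((\<lambda>s. UP t s (forcing s (xi t s w))) has_integral (P t w - UP t 0 (P0 (xi t 0 w)))) {0..t}"
  using riccati[OF assms] by (simp add: gain_eq forcing_def)

text \<open>
  The quadratic term is \<open>P C\<^sup>* R\<^sup>-\<^sup>1 C P\<close> and not \<open>P C\<^sup>* R\<^sup>-\<^sup>1 C P\<^sup>*\<close>, so symmetry is not visible in the equation. The
  difference \<open>P - P\<^sup>*\<close> satisfies a homogeneous linear integral inequality and vanishes by Gronwall.
\<close>

lemma P_selfadjoint: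
  assumes t: "t \<in> {0..\<tau>}"
  shows "P t w \<bullet> v = w \<bullet> P t v"
proof -
  \<comment> \<open>\<open>Pa\<close> is the adjoint of \<open>P\<close> as a bounded operator, so that the defect has an operator norm.\<close>
  define Pa where "Pa t = Blinfun (adjoint (P t))" for t
  have Pa: "Pa t v = adjoint (P t) v" for t v
    unfolding Pa_def
    by (subst bounded_linear_Blinfun_apply)
       (auto intro!: bounded_linear_intro[where K = "norm (P t)"] simp: linear_add[OF linear_adjoint_blinfun]
          linear_cmul[OF linear_adjoint_blinfun] order_trans[OF norm_adjoint_le] mult.commute)
  define b where "b t = norm (P t - Pa t)" for t
  have b: "\<bar>P t x \<bullet> y - x \<bullet> P t y\<bar> \<le> b t * norm x * norm y" for t x y
  proof -
    have "P t x \<bullet> y - x \<bullet> P t y = (P t - Pa t) x \<bullet> y"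
      by (simp add: Pa blinfun.diff_left inner_diff_left adjoint_inner)
    also have "\<bar>\<dots>\<bar> \<le> norm ((P t - Pa t) x) * norm y" by (rule Cauchy_Schwarz_ineq2)
    also have "\<dots> \<le> b t * norm x * norm y" unfolding b_def by (intro mult_right_mono norm_blinfun) auto
    finally show ?thesis .
  qed
  define K where "K = 2 * (dK * B) * B * B"
  have K: "0 \<le> K" using dK B by (simp add: K_def)
  have "b t \<le> 2 * 0 * exp (2 * K * t)"
  proof (rule gronwall[OF _ K _ _ t])
    have "b t \<le> B + B" if "t \<in> {0..\<tau>}" for t
    proof -
      have "norm (Pa t v) \<le> B * norm v" for v
        unfolding Pa by (intro order_trans[OF norm_adjoint_le] mult_right_mono P that) auto
      then have "norm (Pa t) \<le> B" using B by (intro norm_blinfun_bound) auto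
      then show ?thesis unfolding b_def using P[OF that] norm_triangle_ineq4[of "P t" "Pa t"] by linarith
    qed
    then show "\<exists>c. \<forall>t\<in>{0..\<tau>}. b t \<le> c" by blast
    fix t c assume t: "t \<in> {0..\<tau>}" and c: "0 \<le> c"
      and le: "\<And>s. s \<in> {0..t} \<Longrightarrow> b s \<le> c * exp (2 * K * s)"
    have "norm (P t - Pa t) \<le> c / 2 * exp (2 * K * t)"
    proof (rule norm_blinfun_le_inner)
      fix w v
      have "((\<lambda>s. UP t s (forcing s (xi t s w)) \<bullet> v - w \<bullet> UP t s (forcing s (xi t s v))) has_integral
          ((P t w - UP t 0 (P0 (xi t 0 w))) \<bullet> v - w \<bullet> (P t v - UP t 0 (P0 (xi t 0 v))))) {0..t}"
        using has_integral_diff[OF has_integral_linear[OF riccati'[OF t, of w] bounded_linear_inner_left[of v]]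
            has_integral_linear[OF riccati'[OF t, of v] bounded_linear_inner_right[of w]]]
        by (simp add: o_def)
      moreover have "UP t 0 (P0 (xi t 0 w)) \<bullet> v = w \<bullet> UP t 0 (P0 (xi t 0 v))"
        using P0(1) unfolding selfadjoint_def by (metis inner_adjoint adjoint_inner)
      ultimately have "((\<lambda>s. UP t s (forcing s (xi t s w)) \<bullet> v - w \<bullet> UP t s (forcing s (xi t s v))) has_integral
          (P t w \<bullet> v - w \<bullet> P t v)) {0..t}"
        by (simp add: inner_diff_left inner_diff_right)
      then have "norm (P t w \<bullet> v - w \<bullet> P t v) \<le> (c * norm w * norm v) / 2 * exp (2 * K * (t - 0))"
      proof (rule gronwall_integral_bound[OF _ _ K])
        fix s assume s: "s \<in> {0..t}"
        then have s': "s \<in> {0..\<tau>}" using t by auto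
        let ?x = "xi t s w" and ?y = "xi t s v" and ?k = "gain_kernel s"
        let ?a = "P s ?x" and ?b = "P s ?y"
        have nx: "norm ?x \<le> B * norm w" "norm ?y \<le> B * norm v" using norm_xi s t by auto
        have nk: "norm (?k (P s z)) \<le> dK * B * M" if "norm z \<le> M" for z M
        proof -
          have "norm (?k (P s z)) \<le> dK * norm (P s z)" by (rule linear_family_norm[OF kernel_family s'])
          also have "\<dots> \<le> dK * (B * M)" by (intro mult_left_mono dK norm_blinfun_le P s' that)
          finally show ?thesis by (simp only: mult.assoc)
        qed
        have bs: "b s \<ge> 0" by (simp add: b_def)
        have "UP t s (forcing s ?x) \<bullet> v - w \<bullet> UP t s (forcing s ?y) = forcing s ?x \<bullet> ?y - ?x \<bullet> forcing s ?y"
          by (simp add: inner_adjoint adjoint_inner)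
        moreover have "\<dots> = (P s (?k ?a) \<bullet> ?y - ?k ?a \<bullet> P s ?y) + (P s ?x \<bullet> ?k ?b - ?x \<bullet> P s (?k ?b))"
          using W(1)[OF s'] kernel_sym[OF s', of ?a ?b]
          by (simp add: forcing_def inner_add_left inner_add_right selfadjoint_def)
        ultimately have "norm (UP t s (forcing s ?x) \<bullet> v - w \<bullet> UP t s (forcing s ?y))
            \<le> b s * norm (?k ?a) * norm ?y + b s * norm ?x * norm (?k ?b)"
          by (simp only: real_norm_def) (rule order_trans[OF abs_triangle_ineq add_mono[OF b b]])
        also have "\<dots> \<le> b s * (dK * B * (B * norm w)) * (B * norm v) + b s * (B * norm w) * (dK * B * (B * norm v))"
          by (intro add_mono mult_mono mult_nonneg_nonneg order_refl nx nk bs B dK norm_ge_zero)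
        also have "\<dots> = K * (norm w * norm v) * b s" by (simp add: K_def algebra_simps)
        also have "\<dots> \<le> K * (norm w * norm v) * (c * exp (2 * K * s))"
          using le[OF s] K by (intro mult_left_mono) auto
        also have "\<dots> = K * (c * norm w * norm v * exp (2 * K * (s - 0)))" by (simp add: mult_ac)
        finally show "norm (UP t s (forcing s ?x) \<bullet> v - w \<bullet> UP t s (forcing s ?y)) \<le> \<dots>" .
      qed (use t c in auto)
      moreover have "(P t - Pa t) w \<bullet> v = P t w \<bullet> v - w \<bullet> P t v"
        by (simp add: Pa blinfun.diff_left inner_diff_left adjoint_inner)
      ultimately show "(P t - Pa t) w \<bullet> v \<le> c / 2 * exp (2 * K * t) * norm w * norm v"
        using abs_ge_self[of "P t w \<bullet> v - w \<bullet> P t v"] by (simp add: mult_ac)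
    qed (use c in auto)
    then show "b t \<le> 0 + c / 2 * exp (2 * K * t)" by (simp add: b_def)
  qed auto
  then have "b t \<le> 0" by simp
  then have "b t = 0" unfolding b_def using norm_ge_zero[of "P t - Pa t"] by linarith
  then show ?thesis using b[of t w v] by simp
qed

text \<open>
  The running cost along the backward trajectory \<open>xi t s w\<close> with the optimal control \<open>- R\<^sup>-\<^sup>1 C P (xi t s w)\<close>.
\<close>

definition cost :: "real \<Rightarrow> 'h \<Rightarrow> real \<Rightarrow> real" where
  "cost t w s = xi t s w \<bullet> W s (xi t s w) + C (P s (xi t s w)) \<bullet> inv (R s) (C (P s (xi t s w)))"

lemma forcing_inner:
  assumes "r \<in> {0..\<tau>}"
  shows "v \<bullet> forcing r v = v \<bullet> W r v + C (P r v) \<bullet> inv (R r) (C (P r v))"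
  using P_selfadjoint[OF assms, of v "gain_kernel r (P r v)"]
  by (simp add: forcing_def inner_add_right kernel_inner inner_commute[of "P r v"])
     (simp add: inner_commute)

lemma output_energy:
  assumes "r \<in> {0..\<tau>}"
  shows "\<rho> * (norm (inv (R r) (C v)))\<^sup>2 \<le> C v \<bullet> inv (R r) (C v)"
  using coercive_inverse(3)[OF R(1)[OF assms] R(2) R(3)[OF assms]] .

lemma output_energy_nonneg:
  assumes "r \<in> {0..\<tau>}"
  shows "0 \<le> C v \<bullet> inv (R r) (C v)"
  using output_energy[OF assms, of v] R(2) by (smt (verit) mult_nonneg_nonneg zero_le_power2)

lemma cost_nonneg:
  assumes "r \<in> {0..\<tau>}"
  shows "0 \<le> cost t w r"
  using W(2)[OF assms] output_energy_nonneg[OF assms] by (auto simp: cost_def nonneg_definite_def)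

text \<open>
  The Riccati equation tested against \<open>w\<close> states that \<open>w \<bullet> P t w\<close> is the total cost, including the terminal cost weighted by \<open>P0\<close>.
\<close>

lemma cost_integral:
  assumes t: "t \<in> {0..\<tau>}"
  shows "(cost t w has_integral (w \<bullet> P t w - xi t 0 w \<bullet> P0 (xi t 0 w))) {0..t}"
proof -
  have "((\<lambda>s. w \<bullet> UP t s (forcing s (xi t s w))) has_integral (w \<bullet> (P t w - UP t 0 (P0 (xi t 0 w))))) {0..t}"
    using has_integral_linear[OF riccati'[OF t] bounded_linear_inner_right] by (simp add: o_def)
  then have "((\<lambda>s. w \<bullet> UP t s (forcing s (xi t s w))) has_integral (w \<bullet> P t w - xi t 0 w \<bullet> P0 (xi t 0 w))) {0..t}"
    by (simp add: inner_diff_right adjoint_inner)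
  then show ?thesis
    by (rule has_integral_eq[rotated])
       (use t in \<open>auto simp: cost_def forcing_inner adjoint_inner[symmetric]\<close>)
qed

lemma P_nonneg:
  assumes t: "t \<in> {0..\<tau>}"
  shows "0 \<le> w \<bullet> P t w"
proof -
  have "0 \<le> w \<bullet> P t w - xi t 0 w \<bullet> P0 (xi t 0 w)"
    by (rule has_integral_nonneg[OF cost_integral[OF t]]) (use t cost_nonneg in auto)
  then show ?thesis using P0(2)[of "xi t 0 w"] by linarith
qed

text \<open>
  Splitting the integral at \<open>s\<close> and using the evolution property turns the equation from time \<open>0\<close> into one from time \<open>s\<close>.
\<close>

lemma riccati_two_times:
  assumes st: "0 \<le> s" "s \<le> t" "t \<le> \<tau>"
  shows "((\<lambda>r. UP t r (forcing r (xi t r w))) has_integral (P t w - UP t s (P s (xi t s w)))) {s..t}"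
proof -
  have t: "t \<in> {0..\<tau>}" and s: "s \<in> {0..\<tau>}" using st by auto
  let ?f = "\<lambda>r. UP t r (forcing r (xi t r w))"
  have "((\<lambda>r. UP t s (UP s r (forcing r (xi s r (xi t s w))))) has_integral
      (UP t s (P s (xi t s w) - UP s 0 (P0 (xi s 0 (xi t s w)))))) {0..s}"
    using has_integral_linear[OF riccati'[OF s] blinfun.bounded_linear_right] by (simp add: o_def)
  then have "((\<lambda>r. UP t s (UP s r (forcing r (xi s r (xi t s w))))) has_integral
      (UP t s (P s (xi t s w)) - UP t 0 (P0 (xi t 0 w)))) {0..s}"
    using st by (simp add: blinfun.diff_right UP_comp_apply xi_comp)
  then have 1: "(?f has_integral (UP t s (P s (xi t s w)) - UP t 0 (P0 (xi t 0 w)))) {0..s}"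
    by (rule has_integral_eq[rotated]) (use st in \<open>auto simp: UP_comp_apply xi_comp\<close>)
  have 2: "(?f has_integral (P t w - UP t 0 (P0 (xi t 0 w)))) {0..t}" by (rule riccati'[OF t])
  have 3: "?f integrable_on {s..t}"
    by (rule integrable_on_subinterval[of _ "{0..t}"]) (use 2 st in auto)
  have "integral {0..s} ?f + integral {s..t} ?f = integral {0..t} ?f"
    by (rule Henstock_Kurzweil_Integration.integral_combine) (use 2 st in auto)
  then have "integral {s..t} ?f = P t w - UP t s (P s (xi t s w))"
    using integral_unique[OF 1] integral_unique[OF 2] by (simp add: algebra_simps)
  then show ?thesis using 3 by (simp add: has_integral_iff)
qed

section \<open>Detectability bounds the Riccati solution\<close>

text \<open>
  The control cost of the competitor: expand \<open>0 \<le> (u + R\<^sup>-\<^sup>1 y) \<bullet> R (u + R\<^sup>-\<^sup>1 y)\<close> for \<open>u = L\<^sup>* x\<close>.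
\<close>

lemma complete_square:
  assumes r: "r \<in> {0..\<tau>}" and L: "norm (L :: 'b \<Rightarrow>\<^sub>L 'h) \<le> l" and rr: "norm (R r) \<le> rr"
  shows "- 2 * (x \<bullet> L y) - y \<bullet> inv (R r) y \<le> rr * l\<^sup>2 * (norm x)\<^sup>2"
proof -
  note ci = coercive_inverse[OF R(1)[OF r] R(2) R(3)[OF r]]
  define u where "u = adjoint L x"
  have u: "x \<bullet> L y = u \<bullet> y" by (simp add: u_def adjoint_inner)
  have "0 \<le> (u + inv (R r) y) \<bullet> R r (u + inv (R r) y)"
    using R(3)[OF r, of "u + inv (R r) y"] R(2) by (smt (verit) mult_nonneg_nonneg zero_le_power2)
  also have "\<dots> = u \<bullet> R r u + 2 * (u \<bullet> y) + y \<bullet> inv (R r) y"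
    using R(1)[OF r] unfolding selfadjoint_def
    by (simp add: blinfun.add_right inner_add_left inner_add_right ci(1))
       (metis ci(1) inner_commute)
  finally have "- 2 * (x \<bullet> L y) - y \<bullet> inv (R r) y \<le> u \<bullet> R r u" by (simp add: u)
  also have "\<dots> \<le> norm u * norm (R r u)" by (rule norm_cauchy_schwarz)
  also have "\<dots> \<le> norm u * (rr * norm u)" using rr by (intro mult_left_mono norm_blinfun_le) auto
  also have "\<dots> = rr * (norm u)\<^sup>2" by (simp add: power2_eq_square)
  also have "\<dots> \<le> rr * (l * norm x)\<^sup>2"
  proof (intro mult_left_mono power_mono)
    show "norm u \<le> l * norm x" unfolding u_def
      by (rule order_trans[OF norm_adjoint_le mult_right_mono[OF L]]) simp
  qed (use order_trans[OF norm_ge_zero rr] in auto)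
  finally show ?thesis by (simp add: power_mult_distrib mult.assoc)
qed

text \<open>
  Dynamic programming over one short step: following the competitor \<open>(Z t s)\<^sup>* x\<close> instead of the optimal trajectory costs, to
  leading order, at most \<open>k * M1\<^sup>2\<close> per unit of time. With \<open>\<eta> = (Z t s)\<^sup>* x - xi t s x\<close>, the quadratic form of \<open>P s\<close> at the competitor is at least
  \<open>xi \<bullet> \<pi> s + 2 * (\<eta> \<bullet> \<pi> s)\<close>, where \<open>\<pi> = P xi\<close> is the costate, and \<open>\<eta> \<bullet> \<pi> s = x \<bullet> (Z - UP) (\<pi> s)\<close> is expanded to first order.
  The costate propagates as \<open>\<pi> r = UP r s (\<pi> s) + O(h)\<close>, so only values at the same time are left and the
  square can be completed. Here \<open>\<kappa>\<close> measures how far the reference linearization \<open>A0\<close> of \<open>Z\<close> is from \<open>A1\<close>; its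
  contribution carries the factor \<open>p\<close>, a bound for \<open>P\<close> itself.
\<close>

lemma one_step_inequality:
  fixes \<Lambda> :: "real \<Rightarrow> 'b \<Rightarrow>\<^sub>L 'h"
  assumes Z: "first_order S \<tau> (\<lambda>r v. A0 r v + \<Lambda> r (C v)) Z"
    and A0: "linear_family \<tau> dA A0"
    and \<Lambda>: "\<And>r. r \<in> {0..\<tau>} \<Longrightarrow> norm (\<Lambda> r) \<le> l" "0 \<le> l"
    and \<kappa>: "\<And>r v. r \<in> {0..\<tau>} \<Longrightarrow> norm (A0 r v - A1 r v) \<le> \<kappa> * norm v" "0 \<le> \<kappa>"
    and p: "\<And>r. r \<in> {0..\<tau>} \<Longrightarrow> norm (P r) \<le> p" "0 \<le> p"
    and rr: "\<And>r. r \<in> {0..\<tau>} \<Longrightarrow> norm (R r) \<le> rr" "0 \<le> rr"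
    and M1: "\<And>h. 0 \<le> h \<Longrightarrow> h \<le> 1 \<Longrightarrow> norm (S h) \<le> M1" "0 \<le> M1"
    and k: "k = w\<^sub>W + 2 * \<kappa> * p + rr * l\<^sup>2"
  shows "\<exists>c\<ge>0. \<forall>s t x. 0 \<le> s \<longrightarrow> s \<le> t \<longrightarrow> t \<le> \<tau> \<longrightarrow> t - s \<le> 1 \<longrightarrow>
    x \<bullet> P t x - adjoint (Z t s) x \<bullet> P s (adjoint (Z t s) x) \<le> (k * M1\<^sup>2 * (t - s) + c * (t - s)\<^sup>2) * (norm x)\<^sup>2"
proof -
  let ?G = "\<lambda>r v. observer_gain P C R r (C v)"
  define \<Delta> where "\<Delta> r v = A0 r v + \<Lambda> r (C v) - (A1 r v - ?G r v)" for r v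
  define d where "d = (dA + l * norm C) + (dA + B * dK)"
  have d0: "0 \<le> d" using dA B dK \<Lambda>(2) by (simp add: d_def)
  have LC: "linear_family \<tau> (l * norm C) (\<lambda>r v. \<Lambda> r (C v))"
    using linear_family_compose[of \<tau> \<Lambda> l "\<lambda>_. C" "norm C"] \<Lambda> by simp
  note D1 = closed_loop_family
  have \<Delta>_fam: "linear_family \<tau> d \<Delta>"
    using linear_family_add[OF linear_family_add[OF A0 LC] linear_family_minus[OF D1]]
    unfolding d_def \<Delta>_def[abs_def] by (simp only: diff_conv_add_uminus)
  obtain K where K: "K \<ge> 0" and iE: "\<And>s t v. 0 \<le> s \<Longrightarrow> s \<le> t \<Longrightarrow> t \<le> \<tau> \<Longrightarrow>
     (\<exists>i. (i has_integral (Z t s v - UP t s v)) {s..t} \<and>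
          (\<forall>r\<in>{s..t}. norm (i r - S (t - r) (\<Delta> r (S (r - s) v))) \<le> K * (t - s) * norm v))"
    using first_order_difference[OF Z fo_UP] unfolding \<Delta>_def by meson
  obtain cU where cU: "cU \<ge> 0" "\<And>s t. 0 \<le> s \<Longrightarrow> s \<le> t \<Longrightarrow> t \<le> \<tau> \<Longrightarrow> norm (UP t s - S (t - s)) \<le> cU * (t - s)"
    using first_order_deviation[OF fo_UP D1 _ S] dA B dK by auto
  define F where "F = B * ((w\<^sub>W + B * (dK * B)) * B) + cU * (B * B)"
  define F3 where "F3 = K * (B * B) + (B * (d * F) + cU * (d * (B * (B * B))))"
  define c where "c = k * (2 * M1 * cU + cU\<^sup>2) + 2 * F3"
  have k0: "0 \<le> k" unfolding k using W(4) \<kappa>(2) p(2) rr(2) by simp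
  have F0: "0 \<le> F" using B W(4) dK cU by (simp add: F_def)
  have F30: "0 \<le> F3" using B K d0 F0 cU by (simp add: F3_def)
  have c0: "0 \<le> c" using k0 M1(2) cU(1) F30 by (simp add: c_def)
  have main: "x \<bullet> P t x - adjoint (Z t s) x \<bullet> P s (adjoint (Z t s) x) \<le> (k * M1\<^sup>2 * (t - s) + c * (t - s)\<^sup>2) * (norm x)\<^sup>2"
    if st: "0 \<le> s" "s \<le> t" "t \<le> \<tau>" "t - s \<le> 1" for s t x
  proof -
    define h where "h = t - s"
    have h: "0 \<le> h" "h \<le> 1" using st by (auto simp: h_def)
    define \<pi> where "\<pi> r = P r (xi t r x)" for r
    have n\<pi>: "norm (\<pi> r) \<le> B * (B * norm x)" if "r \<in> {s..t}" for r
      unfolding \<pi>_def using that st by (intro norm_blinfun_le P norm_xi) auto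
    \<comment> \<open>The optimal costate solves the uncontrolled equation up to \<open>O(h)\<close>.\<close>
    have dev: "norm (\<pi> r - S (r - s) (\<pi> s)) \<le> F * h * norm x" if r: "r \<in> {s..t}" for r
    proof -
      have rs: "0 \<le> s" "s \<le> r" "r \<le> \<tau>" "r \<le> t" using r st by auto
      have "norm (P r (xi t r x) - UP r s (P s (xi r s (xi t r x)))) \<le> B * ((w\<^sub>W + B * (dK * B)) * (B * norm x)) * (r - s)"
      proof (rule has_integral_norm_le_const[OF riccati_two_times[OF rs(1-3)] rs(2)])
        fix z assume z: "z \<in> {s..r}"
        then show "norm (UP r z (forcing z (xi r z (xi t r x)))) \<le> B * ((w\<^sub>W + B * (dK * B)) * (B * norm x))"
          using rs st by (intro norm_blinfun_le norm_UP norm_forcing) (auto simp: xi_comp intro!: norm_xi)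
      qed
      also have "\<dots> \<le> B * ((w\<^sub>W + B * (dK * B)) * (B * norm x)) * h"
        using r B W(4) dK by (intro mult_left_mono) (auto simp: h_def)
      finally have 1: "norm (\<pi> r - UP r s (\<pi> s)) \<le> B * ((w\<^sub>W + B * (dK * B)) * (B * norm x)) * h"
        using xi_comp[OF rs(1,2,4)] by (simp add: \<pi>_def)
      have "norm ((UP r s - S (r - s)) (\<pi> s)) \<le> cU * h * (B * (B * norm x))"
      proof (rule norm_blinfun_le[OF _ n\<pi>])
        show "norm (UP r s - S (r - s)) \<le> cU * h"
          using r rs cU(1) by (intro order_trans[OF cU(2)] mult_left_mono) (auto simp: h_def)
      qed (use st in auto)
      then have 2: "norm (UP r s (\<pi> s) - S (r - s) (\<pi> s)) \<le> cU * h * (B * (B * norm x))"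
        by (simp add: blinfun.diff_left)
      show ?thesis
        using norm_triangle_mono[OF 1 2] by (simp add: F_def algebra_simps)
    qed
    obtain i where i: "(i has_integral (Z t s (\<pi> s) - UP t s (\<pi> s))) {s..t}"
      and i': "\<And>r. r \<in> {s..t} \<Longrightarrow> norm (i r - S (t - r) (\<Delta> r (S (r - s) (\<pi> s)))) \<le> K * (t - s) * norm (\<pi> s)"
      using iE[OF st(1-3), of "\<pi> s"] by auto
    have i_dev: "norm (i r - UP t r (\<Delta> r (\<pi> r))) \<le> F3 * h * norm x" if r: "r \<in> {s..t}" for r
    proof -
      have "norm (UP t r (\<Delta> r (\<pi> r)) - S (t - r) (\<Delta> r (S (r - s) (\<pi> s))))
        \<le> B * (d * (F * h * norm x)) + cU * h * (d * (B * (B * (B * norm x))))"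
      proof (rule perturb_product[OF \<Delta>_fam _ d0 _ _ dev[OF r]])
        show "norm (UP t r - S (t - r)) \<le> cU * h"
          using r st cU(1) by (intro order_trans[OF cU(2)] mult_left_mono) (auto simp: h_def)
        show "norm (S (r - s) (\<pi> s)) \<le> B * (B * (B * norm x))"
          using r st by (intro norm_blinfun_le[OF S] n\<pi>) auto
      qed (use r st norm_UP in auto)
      moreover have "K * (t - s) * norm (\<pi> s) \<le> K * h * (B * (B * norm x))"
        using n\<pi>[of s] st K h by (intro mult_mono mult_nonneg_nonneg) (auto simp: h_def)
      then have "norm (i r - S (t - r) (\<Delta> r (S (r - s) (\<pi> s)))) \<le> K * h * (B * (B * norm x))"
        using i'[OF r] by linarith
      ultimately have "norm ((i r - S (t - r) (\<Delta> r (S (r - s) (\<pi> s)))) - (UP t r (\<Delta> r (\<pi> r)) - S (t - r) (\<Delta> r (S (r - s) (\<pi> s)))))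
         \<le> K * h * (B * (B * norm x)) + (B * (d * (F * h * norm x)) + cU * h * (d * (B * (B * (B * norm x)))))"
        by (rule order_trans[OF norm_triangle_ineq4 add_mono[rotated]])
      then show ?thesis by (simp add: F3_def algebra_simps)
    qed
    have n\<xi>: "(norm (xi t r x))\<^sup>2 \<le> (M1\<^sup>2 + (2 * M1 * cU + cU\<^sup>2) * h) * (norm x)\<^sup>2" if r: "r \<in> {s..t}" for r
    proof -
      have "norm (UP t r) \<le> norm (S (t - r)) + norm (UP t r - S (t - r))"
        using norm_triangle_sub[of "UP t r" "S (t - r)"] by simp
      also have "\<dots> \<le> M1 + cU * h"
        using r st cU(1) by (intro add_mono M1 order_trans[OF cU(2)] mult_left_mono) (auto simp: h_def)
      finally have "norm (xi t r x) \<le> (M1 + cU * h) * norm x"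
        by (intro order_trans[OF norm_adjoint_le] mult_right_mono) auto
      then have "(norm (xi t r x))\<^sup>2 \<le> ((M1 + cU * h) * norm x)\<^sup>2" by (intro power_mono) auto
      also have "\<dots> = (M1\<^sup>2 + 2 * M1 * cU * h + cU\<^sup>2 * (h * h)) * (norm x)\<^sup>2"
        by (simp add: power2_eq_square algebra_simps)
      also have "\<dots> \<le> (M1\<^sup>2 + 2 * M1 * cU * h + cU\<^sup>2 * (h * 1)) * (norm x)\<^sup>2"
        using h by (intro mult_right_mono add_left_mono mult_left_mono) auto
      finally show ?thesis by (simp add: algebra_simps)
    qed
    have int1: "((\<lambda>r. x \<bullet> UP t r (forcing r (xi t r x))) has_integral (x \<bullet> P t x - xi t s x \<bullet> \<pi> s)) {s..t}"
      using has_integral_linear[OF riccati_two_times[OF st(1-3)] bounded_linear_inner_right[of x]]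
      by (simp add: o_def inner_diff_right \<pi>_def adjoint_inner)
    have int2: "((\<lambda>r. x \<bullet> i r) has_integral (x \<bullet> (Z t s (\<pi> s) - UP t s (\<pi> s)))) {s..t}"
      using has_integral_linear[OF i bounded_linear_inner_right[of x]] by (simp add: o_def)
    have pointwise: "x \<bullet> UP t r (forcing r (xi t r x)) - 2 * (x \<bullet> i r) \<le> (k * M1\<^sup>2 + c * h) * (norm x)\<^sup>2"
      if r: "r \<in> {s..t}" for r
    proof -
      have r': "r \<in> {0..\<tau>}" using r st by auto
      let ?\<xi> = "xi t r x"
      have e: "x \<bullet> UP t r (\<Delta> r (\<pi> r)) - x \<bullet> i r \<le> F3 * h * (norm x)\<^sup>2"
      proof -
        have "x \<bullet> (UP t r (\<Delta> r (\<pi> r)) - i r) \<le> norm x * norm (UP t r (\<Delta> r (\<pi> r)) - i r)"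
          by (rule norm_cauchy_schwarz)
        also have "\<dots> \<le> norm x * (F3 * h * norm x)"
          using i_dev[OF r] by (intro mult_left_mono) (auto simp: norm_minus_commute)
        finally show ?thesis by (simp add: inner_diff_right power2_eq_square mult_ac)
      qed
      have f1: "x \<bullet> UP t r (forcing r ?\<xi>) = ?\<xi> \<bullet> W r ?\<xi> + C (\<pi> r) \<bullet> inv (R r) (C (\<pi> r))"
        using forcing_inner[OF r', of ?\<xi>] by (simp add: adjoint_inner[symmetric] \<pi>_def)
      have "?\<xi> \<bullet> P r (gain_kernel r (\<pi> r)) = C (\<pi> r) \<bullet> inv (R r) (C (\<pi> r))"
        using P_selfadjoint[OF r', of ?\<xi> "gain_kernel r (\<pi> r)"]
        by (simp add: \<pi>_def[symmetric]) (metis kernel_inner inner_commute)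
      then have f2: "x \<bullet> UP t r (\<Delta> r (\<pi> r)) = ?\<xi> \<bullet> (A0 r (\<pi> r) - A1 r (\<pi> r)) + ?\<xi> \<bullet> \<Lambda> r (C (\<pi> r)) + C (\<pi> r) \<bullet> inv (R r) (C (\<pi> r))"
        by (simp add: adjoint_inner[symmetric] \<Delta>_def gain_eq inner_diff_right inner_add_right)
      have f3: "?\<xi> \<bullet> W r ?\<xi> \<le> w\<^sub>W * (norm ?\<xi>)\<^sup>2"
      proof -
        have "?\<xi> \<bullet> W r ?\<xi> \<le> norm ?\<xi> * (w\<^sub>W * norm ?\<xi>)"
          by (rule order_trans[OF norm_cauchy_schwarz mult_left_mono]) (auto intro!: norm_blinfun_le W(3) r')
        then show ?thesis by (simp add: power2_eq_square mult_ac)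
      qed
      have f4: "- (?\<xi> \<bullet> (A0 r (\<pi> r) - A1 r (\<pi> r))) \<le> \<kappa> * p * (norm ?\<xi>)\<^sup>2"
      proof -
        have "norm (\<pi> r) \<le> p * norm ?\<xi>" unfolding \<pi>_def by (intro norm_blinfun_le p r') simp
        then have "norm (A0 r (\<pi> r) - A1 r (\<pi> r)) \<le> \<kappa> * (p * norm ?\<xi>)"
          using order_trans[OF \<kappa>(1)[OF r'] mult_left_mono] \<kappa>(2) by blast
        then have "norm ?\<xi> * norm (A0 r (\<pi> r) - A1 r (\<pi> r)) \<le> norm ?\<xi> * (\<kappa> * (p * norm ?\<xi>))"
          by (intro mult_left_mono) auto
        moreover have "- (?\<xi> \<bullet> (A0 r (\<pi> r) - A1 r (\<pi> r))) \<le> norm ?\<xi> * norm (A0 r (\<pi> r) - A1 r (\<pi> r))"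
          using Cauchy_Schwarz_ineq2[of ?\<xi> "A0 r (\<pi> r) - A1 r (\<pi> r)"] by linarith
        ultimately show ?thesis by (simp add: power2_eq_square mult_ac)
      qed
      have f5: "- 2 * (?\<xi> \<bullet> \<Lambda> r (C (\<pi> r))) - C (\<pi> r) \<bullet> inv (R r) (C (\<pi> r)) \<le> rr * l\<^sup>2 * (norm ?\<xi>)\<^sup>2"
        by (rule complete_square[OF r' \<Lambda>(1)[OF r'] rr(1)[OF r']])
      have "x \<bullet> UP t r (forcing r ?\<xi>) - 2 * (x \<bullet> i r) \<le> k * (norm ?\<xi>)\<^sup>2 + 2 * (F3 * h * (norm x)\<^sup>2)"
        using e f1 f2 f3 f4 f5 by (simp add: k algebra_simps)
      also have "k * (norm ?\<xi>)\<^sup>2 \<le> k * ((M1\<^sup>2 + (2 * M1 * cU + cU\<^sup>2) * h) * (norm x)\<^sup>2)"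
        by (intro mult_left_mono n\<xi> r k0)
      finally show ?thesis by (simp add: c_def algebra_simps)
    qed
    have "(x \<bullet> P t x - xi t s x \<bullet> \<pi> s) - 2 * (x \<bullet> (Z t s (\<pi> s) - UP t s (\<pi> s))) \<le> (t - s) * ((k * M1\<^sup>2 + c * h) * (norm x)\<^sup>2)"
      using has_integral_le[OF has_integral_diff[OF int1 has_integral_mult_right[OF int2, of 2]]
          has_integral_const_real[of "(k * M1\<^sup>2 + c * h) * (norm x)\<^sup>2" s t] pointwise] st by simp
    moreover have "adjoint (Z t s) x \<bullet> P s (adjoint (Z t s) x) \<ge> xi t s x \<bullet> \<pi> s + 2 * (x \<bullet> (Z t s (\<pi> s) - UP t s (\<pi> s)))"
    proof -
      define \<eta> where "\<eta> = adjoint (Z t s) x - xi t s x"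
      have s': "s \<in> {0..\<tau>}" using st by auto
      have z: "adjoint (Z t s) x = xi t s x + \<eta>" by (simp add: \<eta>_def)
      have "\<eta> \<bullet> \<pi> s = x \<bullet> (Z t s (\<pi> s) - UP t s (\<pi> s))"
        by (simp add: \<eta>_def inner_diff_left inner_diff_right adjoint_inner)
      moreover have "xi t s x \<bullet> P s \<eta> = \<eta> \<bullet> \<pi> s"
        using P_selfadjoint[OF s', of "xi t s x" \<eta>] by (simp add: \<pi>_def inner_commute)
      moreover have "0 \<le> \<eta> \<bullet> P s \<eta>" by (rule P_nonneg[OF s'])
      ultimately show ?thesis unfolding z
        by (simp add: blinfun.add_right inner_add_left inner_add_right \<pi>_def)
    qed
    ultimately show ?thesis by (simp add: h_def power2_eq_square algebra_simps)
  qed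
  then show ?thesis using c0 by blast
qed

text \<open>
  Sums the one-step inequality along the competitor from \<open>w\<close>, whose squared norm decays like \<open>exp (- 2 \<beta> (t - s))\<close>, so that the
  total is independent of \<open>t\<close>. The factor \<open>exp (2 * \<beta>)\<close> pays for evaluating the decay at the right end of a
  step of length at most one.
\<close>

lemma riccati_quadratic_bound:
  fixes \<Lambda> :: "real \<Rightarrow> 'b \<Rightarrow>\<^sub>L 'h"
  assumes Z: "first_order S \<tau> (\<lambda>r v. A0 r v + \<Lambda> r (C v)) Z"
    and Z_ev: "evolution_operator Z"
    and Z_exp: "\<And>s t. 0 \<le> s \<Longrightarrow> s \<le> t \<Longrightarrow> norm (Z t s) \<le> M * exp (- \<beta> * (t - s))" "0 \<le> M" "0 < \<beta>"
    and A0: "linear_family \<tau> dA A0"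
    and \<Lambda>: "\<And>r. r \<in> {0..\<tau>} \<Longrightarrow> norm (\<Lambda> r) \<le> l" "0 \<le> l"
    and \<kappa>: "\<And>r v. r \<in> {0..\<tau>} \<Longrightarrow> norm (A0 r v - A1 r v) \<le> \<kappa> * norm v" "0 \<le> \<kappa>"
    and p: "\<And>r. r \<in> {0..\<tau>} \<Longrightarrow> norm (P r) \<le> p" "0 \<le> p"
    and rr: "\<And>r. r \<in> {0..\<tau>} \<Longrightarrow> norm (R r) \<le> rr" "0 \<le> rr"
    and M1: "\<And>h. 0 \<le> h \<Longrightarrow> h \<le> 1 \<Longrightarrow> norm (S h) \<le> M1" "0 \<le> M1"
    and t: "t \<in> {0..\<tau>}"
  shows "norm (P t) \<le> norm P0 * M\<^sup>2 + (w\<^sub>W + 2 * \<kappa> * p + rr * l\<^sup>2) * (M1\<^sup>2 * M\<^sup>2 * exp (2 * \<beta>) / (2 * \<beta>))"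
proof -
  define k where "k = w\<^sub>W + 2 * \<kappa> * p + rr * l\<^sup>2"
  have k0: "0 \<le> k" unfolding k_def using W(4) \<kappa>(2) p(2) rr(2) by simp
  obtain c where c: "c \<ge> 0" and step: "\<And>s t x. 0 \<le> s \<Longrightarrow> s \<le> t \<Longrightarrow> t \<le> \<tau> \<Longrightarrow> t - s \<le> 1 \<Longrightarrow>
    x \<bullet> P t x - adjoint (Z t s) x \<bullet> P s (adjoint (Z t s) x) \<le> (k * M1\<^sup>2 * (t - s) + c * (t - s)\<^sup>2) * (norm x)\<^sup>2"
    using one_step_inequality[OF Z A0 \<Lambda> \<kappa> p rr M1 k_def] by blast
  define E where "E s = exp (- (2 * \<beta>) * (t - s))" for s
  define a where "a = k * (M1\<^sup>2 * M\<^sup>2 * exp (2 * \<beta>) / (2 * \<beta>))"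
  have a0: "0 \<le> a" using k0 Z_exp(3) by (simp add: a_def)
  have nZ: "(norm (adjoint (Z t s) w))\<^sup>2 \<le> M\<^sup>2 * E s * (norm w)\<^sup>2" if "0 \<le> s" "s \<le> t" for s w
  proof -
    have "norm (adjoint (Z t s) w) \<le> M * exp (- \<beta> * (t - s)) * norm w"
      by (intro order_trans[OF norm_adjoint_le] mult_right_mono Z_exp that) simp
    then have "(norm (adjoint (Z t s) w))\<^sup>2 \<le> (M * exp (- \<beta> * (t - s)) * norm w)\<^sup>2" by (intro power_mono) auto
    also have "\<dots> = M\<^sup>2 * (exp (- \<beta> * (t - s)))\<^sup>2 * (norm w)\<^sup>2" by (simp only: power_mult_distrib)
    also have "(exp (- \<beta> * (t - s)))\<^sup>2 = E s"
      unfolding E_def by (simp only: exp_double[symmetric]) (simp add: mult.assoc)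
    finally show ?thesis .
  qed
  have quad: "w \<bullet> P t w \<le> (norm P0 * M\<^sup>2 + a) * (norm w)\<^sup>2" for w
  proof -
    define f where "f s = adjoint (Z t s) w \<bullet> P s (adjoint (Z t s) w) - a * (norm w)\<^sup>2 * E s" for s
    have "f t \<le> f 0"
    proof (rule telescope_le[where f = f and a = 0 and b = t and K = "c * (M\<^sup>2 * (norm w)\<^sup>2)"])
      show "0 \<le> t" using t by simp
      fix r s assume rs: "0 \<le> r" "r \<le> s" "s \<le> t" "s - r \<le> 1"
      define x where "x = adjoint (Z t s) w"
      have "Z t s o\<^sub>L Z s r = Z t r" using Z_ev rs unfolding evolution_operator_def by blast
      then have comp: "adjoint (Z s r) x = adjoint (Z t r) w"
        using adjoint_compose[of "Z t s" "Z s r" w] by (simp add: x_def)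
      have nx: "(norm x)\<^sup>2 \<le> M\<^sup>2 * E s * (norm w)\<^sup>2" unfolding x_def using rs by (intro nZ) auto
      have Er: "E s = E r * exp (2 * \<beta> * (s - r))" by (simp add: E_def algebra_simps flip: exp_add)
      have "E s * (s - r) \<le> exp (2 * \<beta>) / (2 * \<beta>) * (E s - E r)"
      proof -
        have "2 * \<beta> * (s - r) \<le> exp (2 * \<beta> * (s - r)) - 1" using exp_ge_add_one_self[of "2 * \<beta> * (s - r)"] by linarith
        then have "E r * (2 * \<beta> * (s - r)) \<le> E r * (exp (2 * \<beta> * (s - r)) - 1)" by (intro mult_left_mono) (auto simp: E_def)
        also have "\<dots> = E s - E r" by (simp add: Er algebra_simps)
        finally have 1: "E r * (s - r) \<le> (E s - E r) / (2 * \<beta>)" using Z_exp(3) by (simp add: field_simps)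
        have "exp (2 * \<beta> * (s - r)) \<le> exp (2 * \<beta>)" using rs Z_exp(3) by (simp add: mult_left_le)
        then have "E s \<le> E r * exp (2 * \<beta>)" unfolding Er by (intro mult_left_mono) (auto simp: E_def)
        then have "E s * (s - r) \<le> E r * exp (2 * \<beta>) * (s - r)" using rs by (intro mult_right_mono) auto
        also have "\<dots> = exp (2 * \<beta>) * (E r * (s - r))" by simp
        also have "\<dots> \<le> exp (2 * \<beta>) * ((E s - E r) / (2 * \<beta>))" using 1 by (intro mult_left_mono) auto
        finally show ?thesis by simp
      qed
      then have "k * M1\<^sup>2 * M\<^sup>2 * (norm w)\<^sup>2 * (E s * (s - r)) \<le> k * M1\<^sup>2 * M\<^sup>2 * (norm w)\<^sup>2 * (exp (2 * \<beta>) / (2 * \<beta>) * (E s - E r))"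
        using k0 by (intro mult_left_mono) auto
      then have main: "k * M1\<^sup>2 * (s - r) * (M\<^sup>2 * E s * (norm w)\<^sup>2) \<le> a * (norm w)\<^sup>2 * (E s - E r)"
        by (simp add: a_def mult_ac)
      have "E s \<le> 1" using rs Z_exp(3) by (simp add: E_def)
      then have "M\<^sup>2 * E s * (norm w)\<^sup>2 \<le> M\<^sup>2 * 1 * (norm w)\<^sup>2" by (intro mult_right_mono mult_left_mono) auto
      then have rest: "c * (s - r)\<^sup>2 * (norm x)\<^sup>2 \<le> c * (s - r)\<^sup>2 * (M\<^sup>2 * (norm w)\<^sup>2)"
        using nx c by (intro mult_left_mono) auto
      have "x \<bullet> P s x - adjoint (Z s r) x \<bullet> P r (adjoint (Z s r) x) \<le> (k * M1\<^sup>2 * (s - r) + c * (s - r)\<^sup>2) * (norm x)\<^sup>2"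
        using rs t by (intro step) auto
      also have "\<dots> = k * M1\<^sup>2 * (s - r) * (norm x)\<^sup>2 + c * (s - r)\<^sup>2 * (norm x)\<^sup>2" by (rule distrib_right)
      also have "k * M1\<^sup>2 * (s - r) * (norm x)\<^sup>2 \<le> k * M1\<^sup>2 * (s - r) * (M\<^sup>2 * E s * (norm w)\<^sup>2)"
        using nx k0 rs by (intro mult_left_mono) auto
      finally have "x \<bullet> P s x - adjoint (Z s r) x \<bullet> P r (adjoint (Z s r) x) \<le> a * (norm w)\<^sup>2 * (E s - E r) + c * (s - r)\<^sup>2 * (M\<^sup>2 * (norm w)\<^sup>2)"
        using main rest by linarith
      then show "f s - f r \<le> (c * (M\<^sup>2 * (norm w)\<^sup>2)) * (s - r)\<^sup>2"
        unfolding f_def comp unfolding x_def by (simp add: algebra_simps)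
    qed
    moreover have "adjoint (Z t t) w = w"
    proof -
      have "Z t t = id_blinfun" using Z_ev t unfolding evolution_operator_def by auto
      then show ?thesis by simp
    qed
    moreover have "P 0 v = P0 v" for v
    proof -
      have "((\<lambda>s. UP 0 s (forcing s (xi 0 s v))) has_integral (P 0 v - UP 0 0 (P0 (xi 0 0 v)))) {0}"
        using riccati'[of 0 v] \<tau> by simp
      from has_integral_unique[OF this has_integral_refl(2)]
      have "P 0 v = UP 0 0 (P0 (xi 0 0 v))" by simp
      moreover have "UP 0 0 = id_blinfun" using UP(2) unfolding evolution_operator_def by auto
      ultimately show ?thesis by simp
    qed
    ultimately have "w \<bullet> P t w \<le> adjoint (Z t 0) w \<bullet> P0 (adjoint (Z t 0) w) + a * (norm w)\<^sup>2 * (E t - E 0)"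
      by (simp add: f_def algebra_simps)
    also have "\<dots> \<le> norm P0 * (M\<^sup>2 * (norm w)\<^sup>2) + a * (norm w)\<^sup>2"
    proof (rule add_mono)
      have "adjoint (Z t 0) w \<bullet> P0 (adjoint (Z t 0) w) \<le> norm (adjoint (Z t 0) w) * (norm P0 * norm (adjoint (Z t 0) w))"
        by (rule order_trans[OF norm_cauchy_schwarz mult_left_mono[OF norm_blinfun]]) simp
      also have "\<dots> = norm P0 * (norm (adjoint (Z t 0) w))\<^sup>2" by (simp add: power2_eq_square)
      also have "\<dots> \<le> norm P0 * (M\<^sup>2 * E 0 * (norm w)\<^sup>2)" using t by (intro mult_left_mono nZ) auto
      also have "\<dots> \<le> norm P0 * (M\<^sup>2 * 1 * (norm w)\<^sup>2)"
        using t Z_exp(3) by (intro mult_left_mono mult_right_mono) (auto simp: E_def)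
      finally show "adjoint (Z t 0) w \<bullet> P0 (adjoint (Z t 0) w) \<le> norm P0 * (M\<^sup>2 * (norm w)\<^sup>2)" by simp
      have "E t - E 0 \<le> 1" by (simp add: E_def)
      then have "a * (norm w)\<^sup>2 * (E t - E 0) \<le> a * (norm w)\<^sup>2 * 1" using a0 by (intro mult_left_mono) auto
      then show "a * (norm w)\<^sup>2 * (E t - E 0) \<le> a * (norm w)\<^sup>2" by simp
    qed
    finally show ?thesis by (simp add: algebra_simps)
  qed
  have "norm (P t) \<le> norm P0 * M\<^sup>2 + a"
    by (rule norm_le_quadratic_form) (use P_selfadjoint[OF t] P_nonneg[OF t] quad a0 in auto)
  then show ?thesis by (simp add: a_def k_def)
qed

text \<open>
  For small \<open>\<kappa>\<close> the term with \<open>p\<close> is absorbed, and the bound no longer refers to the horizon.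
\<close>

lemma riccati_uniform_bound:
  fixes \<Lambda> :: "real \<Rightarrow> 'b \<Rightarrow>\<^sub>L 'h"
  assumes Z: "first_order S \<tau> (\<lambda>r v. A0 r v + \<Lambda> r (C v)) Z"
    and Z_ev: "evolution_operator Z"
    and Z_exp: "\<And>s t. 0 \<le> s \<Longrightarrow> s \<le> t \<Longrightarrow> norm (Z t s) \<le> M * exp (- \<beta> * (t - s))" "0 \<le> M" "0 < \<beta>"
    and A0: "linear_family \<tau> dA A0"
    and \<Lambda>: "\<And>r. r \<in> {0..\<tau>} \<Longrightarrow> norm (\<Lambda> r) \<le> l" "0 \<le> l"
    and \<kappa>: "\<And>r v. r \<in> {0..\<tau>} \<Longrightarrow> norm (A0 r v - A1 r v) \<le> \<kappa> * norm v" "0 \<le> \<kappa>"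
    and rr: "\<And>r. r \<in> {0..\<tau>} \<Longrightarrow> norm (R r) \<le> rr" "0 \<le> rr"
    and M1: "\<And>h. 0 \<le> h \<Longrightarrow> h \<le> 1 \<Longrightarrow> norm (S h) \<le> M1" "0 \<le> M1"
    and g: "g = M1\<^sup>2 * M\<^sup>2 * exp (2 * \<beta>) / (2 * \<beta>)" and small: "4 * \<kappa> * g \<le> 1"
    and t: "t \<in> {0..\<tau>}"
  shows "norm (P t) \<le> 2 * (norm P0 * M\<^sup>2 + (w\<^sub>W + rr * l\<^sup>2) * g)"
proof (rule absorb_half[where X = "{0..\<tau>}" and f = "\<lambda>t. norm (P t)"])
  have g0: "0 \<le> g" using Z_exp by (simp add: g)
  show "0 \<le> norm P0 * M\<^sup>2 + (w\<^sub>W + rr * l\<^sup>2) * g" using g0 W(4) rr(2) by simp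
  fix t c assume c: "0 \<le> c" and le: "\<And>y. y \<in> {0..\<tau>} \<Longrightarrow> norm (P y) \<le> c" and t: "t \<in> {0..\<tau>}"
  have "4 * \<kappa> * g * c \<le> 1 * c" using small c by (intro mult_right_mono)
  then show "norm (P t) \<le> norm P0 * M\<^sup>2 + (w\<^sub>W + rr * l\<^sup>2) * g + c / 2"
    using riccati_quadratic_bound[OF Z Z_ev Z_exp A0 \<Lambda> \<kappa> le c rr M1 t, folded g]
    by (simp add: algebra_simps)
qed (use P t in auto)

section \<open>Stabilizability bounds the closed-loop evolution\<close>

text \<open>
  By Duhamel, \<open>UP\<close> differs from the stable evolution \<open>Y\<close> by the integral of
  \<open>w \<bullet> UP t r ((A0 - A1) + W\<^sup>1\<^sup>/\<^sup>2 K + P C\<^sup>* R\<^sup>-\<^sup>1 C) (Y r s v)\<close>. After moving \<open>UP t r\<close> to the left of the inner product, the last two terms are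
  products of a square root of the running cost of \<open>w\<close> with a decaying factor; the cost integrates to at
  most \<open>p\<close>. The first term is proportional to \<open>\<kappa>\<close> and to the supremum of \<open>norm (UP t s)\<close> and is absorbed.
\<close>

lemma closed_loop_bound:
  fixes Wh Kf :: "real \<Rightarrow> 'h \<Rightarrow>\<^sub>L 'h"
  assumes Y: "first_order S \<tau> (\<lambda>r v. A0 r v + Wh r (Kf r v)) Y"
    and Y_ev: "evolution_operator Y"
    and Y_exp: "\<And>s t. 0 \<le> s \<Longrightarrow> s \<le> t \<Longrightarrow> norm (Y t s) \<le> M * exp (- \<beta> * (t - s))" "0 \<le> M" "0 < \<beta>"
    and Y_bd: "triangle_bounded \<tau> B Y"
    and A0: "linear_family \<tau> dA A0"
    and WK: "linear_family \<tau> dW (\<lambda>r v. Wh r (Kf r v))" "0 \<le> dW"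
    and Wh: "\<And>r. r \<in> {0..\<tau>} \<Longrightarrow> is_sqrt_of (Wh r) (W r)"
    and Kf: "\<And>r. r \<in> {0..\<tau>} \<Longrightarrow> norm (Kf r) \<le> kf" "0 \<le> kf"
    and \<kappa>: "\<And>r v. r \<in> {0..\<tau>} \<Longrightarrow> norm (A0 r v - A1 r v) \<le> \<kappa> * norm v" "0 \<le> \<kappa>"
    and p: "\<And>r. r \<in> {0..\<tau>} \<Longrightarrow> norm (P r) \<le> p" "0 \<le> p"
    and small: "2 * \<kappa> * M \<le> \<beta>"
    and st: "0 \<le> s" "s \<le> t" "t \<le> \<tau>"
  shows "norm (UP t s) \<le> 2 * (M + p / 2 + (kf\<^sup>2 + (norm C)\<^sup>2 / \<rho>) * M\<^sup>2 / (4 * \<beta>))"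
proof -
  define G where "G = (kf\<^sup>2 + (norm C)\<^sup>2 / \<rho>) * M\<^sup>2"
  have G0: "0 \<le> G" using R(2) by (simp add: G_def)
  define a where "a = M + p / 2 + G / (4 * \<beta>)"
  define X where "X = {(t, s). 0 \<le> s \<and> s \<le> t \<and> t \<le> \<tau>}"
  let ?G = "\<lambda>r v. observer_gain P C R r (C v)"
  note D1 = closed_loop_family
  have D0: "linear_family \<tau> (dA + dW) (\<lambda>r v. A0 r v + Wh r (Kf r v))"
    by (rule linear_family_add[OF A0 WK(1)])
  have "(\<lambda>(t, s). norm (UP t s)) (t, s) \<le> 2 * a"
  proof (rule absorb_half[where X = X and f = "\<lambda>(t, s). norm (UP t s)"])
    show "0 \<le> a" using Y_exp p(2) G0 by (simp add: a_def)
    show "(t, s) \<in> X" using st by (simp add: X_def)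
    show "\<And>x. x \<in> X \<Longrightarrow> (\<lambda>(t, s). norm (UP t s)) x \<le> B" by (auto simp: X_def norm_UP)
    fix x q assume q: "0 \<le> q" and le: "\<And>y. y \<in> X \<Longrightarrow> (\<lambda>(t, s). norm (UP t s)) y \<le> q" and x: "x \<in> X"
    then obtain t s where x_def: "x = (t, s)" and st: "0 \<le> s" "s \<le> t" "t \<le> \<tau>" by (auto simp: X_def)
    have leq: "norm (UP t s) \<le> q" if "0 \<le> s" "s \<le> t" "t \<le> \<tau>" for s t
      using le[of "(t, s)"] that by (simp add: X_def)
    have t': "t \<in> {0..\<tau>}" using st by auto
    have "norm (UP t s) \<le> a + q / 2"
    proof (rule norm_blinfun_le_unit)
      show "0 \<le> a + q / 2" using Y_exp p(2) G0 q by (simp add: a_def)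
      fix v w :: 'h assume v: "norm v = 1" and w: "norm w = 1"
      define e where "e r = exp (- \<beta> * (r - s))" for r
      define e2 where "e2 r = exp (- (2 * \<beta>) * (r - s))" for r
      have ee: "e r * e r = e2 r" for r by (simp add: e_def e2_def flip: exp_add)
      have e0: "0 < e r" for r by (simp add: e_def)
      define Q where "Q r = q * \<kappa> * M * e r + cost t w r / 2 + G / 2 * e2 r" for r
      let ?E1 = "(exp (- \<beta> * (t - s)) - exp (- \<beta> * (s - s))) / - \<beta>"
      let ?E2 = "(exp (- (2 * \<beta>) * (t - s)) - exp (- (2 * \<beta>) * (s - s))) / - (2 * \<beta>)"
      define I where "I = q * \<kappa> * M * ?E1
         + integral {s..t} (cost t w) / 2 + G / 2 * ?E2"
      have costi: "cost t w integrable_on {s..t}"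
        by (rule integrable_on_subinterval[of _ "{0..t}"]) (use cost_integral[OF t'] st in auto)
      have "((\<lambda>r. q * \<kappa> * M * e r) has_integral q * \<kappa> * M * ?E1) {s..t}"
        unfolding e_def using Y_exp(3) st by (intro has_integral_mult_right exp_has_integral) auto
      moreover have "((\<lambda>r. cost t w r / 2) has_integral integral {s..t} (cost t w) / 2) {s..t}"
        by (intro has_integral_divide integrable_integral costi)
      moreover have "((\<lambda>r. G / 2 * e2 r) has_integral G / 2 * ?E2) {s..t}"
        unfolding e2_def using Y_exp(3) st by (intro has_integral_mult_right exp_has_integral) auto
      ultimately have QI: "(Q has_integral I) {s..t}"
        unfolding Q_def I_def by (intro has_integral_add)
      have "integral {s..t} (cost t w) \<le> p"
      proof -
        have "integral {s..t} (cost t w) \<le> integral {0..t} (cost t w)"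
          using st cost_integral[OF t'] cost_nonneg by (intro integral_subset_le costi) auto
        also have "\<dots> = w \<bullet> P t w - xi t 0 w \<bullet> P0 (xi t 0 w)" by (rule integral_unique[OF cost_integral[OF t']])
        also have "\<dots> \<le> w \<bullet> P t w" using P0(2)[of "xi t 0 w"] by linarith
        also have "\<dots> \<le> norm w * norm (P t w)" by (rule norm_cauchy_schwarz)
        also have "\<dots> \<le> p" using norm_blinfun_le[OF p(1)[OF t'], of w 1] w by simp
        finally show ?thesis .
      qed
      moreover have "q * \<kappa> * M * ?E1 \<le> q / 2"
      proof -
        have "?E1 \<le> 1 / \<beta>"
          using Y_exp(3) by (simp add: divide_simps)
        then have "q * \<kappa> * M * ?E1 \<le> q * \<kappa> * M * (1 / \<beta>)"
          using q \<kappa>(2) Y_exp(2) by (intro mult_left_mono) auto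
        also have "\<dots> \<le> q / 2"
          using mult_left_mono[OF small q] Y_exp(3) by (simp add: field_simps)
        finally show ?thesis .
      qed
      moreover have "G / 2 * ?E2 \<le> G / (4 * \<beta>)"
      proof -
        have "?E2 \<le> 1 / (2 * \<beta>)"
          using Y_exp(3) by (simp add: divide_simps)
        from mult_left_mono[OF this, of "G / 2"] show ?thesis using G0 by simp
      qed
      ultimately have Ile: "I \<le> q / 2 + p / 2 + G / (4 * \<beta>)" unfolding I_def by linarith
      have nY: "norm (Y r s v) \<le> M * e r" if "s \<le> r" for r
        using norm_blinfun_le[OF Y_exp(1)[OF st(1) that], of v 1] v by (simp add: e_def)
      have nY': "norm (Y r s v) \<le> B" if "r \<in> {s..t}" for r
        using norm_blinfun_le[of "Y r s" B v 1] Y_bd that v st by (auto simp: triangle_bounded_def)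
      have "\<bar>w \<bullet> (Y t s v - UP t s (Y s s v))\<bar> \<le> integral {s..t} Q"
      proof (rule duhamel_estimate[OF fo_UP D1 _ S UP st, where y = "\<lambda>r. Y r s v" and f = "\<lambda>r. A0 r (Y r s v) + Wh r (Kf r (Y r s v))"
            and N = "B + (dA + dW) * B"])
        show "approx_mild S s t (\<lambda>r. A0 r (Y r s v) + Wh r (Kf r (Y r s v))) (\<lambda>r. Y r s v)"
          by (rule approx_mild_evolution[OF Y D0 _ S Y_bd Y_ev st]) (use dA WK in auto)
        show "Q integrable_on {s..t}" using QI by blast
        fix r assume r: "r \<in> {s..t}"
        then have r': "r \<in> {0..\<tau>}" and r_in: "0 \<le> r" "r \<le> t" "t \<le> \<tau>" "s \<le> r" using st by auto
        show "norm (Y r s v) \<le> B + (dA + dW) * B" using nY'[OF r] dA WK(2) B by (simp add: add_increasing2)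
        have "norm (A0 r (Y r s v) + Wh r (Kf r (Y r s v))) \<le> (dA + dW) * B"
          using dA WK(2) by (intro order_trans[OF linear_family_norm[OF D0 r']] mult_left_mono nY' r) auto
        then show "norm (A0 r (Y r s v) + Wh r (Kf r (Y r s v))) \<le> B + (dA + dW) * B" using B by linarith
        let ?y = "Y r s v" and ?\<xi> = "xi t r w"
        define \<pi> where "\<pi> = P r ?\<xi>"
        have t1: "\<bar>w \<bullet> UP t r (A0 r ?y - A1 r ?y)\<bar> \<le> q * \<kappa> * M * e r"
        proof -
          have "norm (A0 r ?y - A1 r ?y) \<le> \<kappa> * (M * e r)"
            using nY[OF r_in(4)] \<kappa> by (intro order_trans[OF \<kappa>(1)[OF r']] mult_left_mono)
          then have "norm (UP t r (A0 r ?y - A1 r ?y)) \<le> q * (\<kappa> * (M * e r))"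
            using r_in by (intro norm_blinfun_le leq) auto
          then show ?thesis using Cauchy_Schwarz_ineq2[of w "UP t r (A0 r ?y - A1 r ?y)"] w by (simp add: mult.assoc)
        qed
        have t2: "\<bar>?\<xi> \<bullet> Wh r (Kf r ?y)\<bar> \<le> (?\<xi> \<bullet> W r ?\<xi> + kf\<^sup>2 * M\<^sup>2 * e2 r) / 2"
        proof -
          have sq: "\<And>v w. Wh r v \<bullet> w = v \<bullet> Wh r w" "Wh r o\<^sub>L Wh r = W r"
            using Wh[OF r'] unfolding is_sqrt_of_def selfadjoint_def by auto
          have a2: "(norm (Wh r ?\<xi>))\<^sup>2 = ?\<xi> \<bullet> W r ?\<xi>"
            unfolding power2_norm_eq_inner sq(2)[symmetric] by (simp add: sq(1))
          have "norm (Kf r ?y) \<le> kf * (M * e r)" by (rule norm_blinfun_le[OF Kf(1)[OF r'] nY[OF r_in(4)]])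
          then have b2: "(norm (Kf r ?y))\<^sup>2 \<le> kf\<^sup>2 * M\<^sup>2 * e2 r"
            using power_mono[of "norm (Kf r ?y)" "kf * (M * e r)" 2] by (simp add: power_mult_distrib ee[symmetric] power2_eq_square[of "e r"] mult.assoc)
          have "\<bar>?\<xi> \<bullet> Wh r (Kf r ?y)\<bar> = \<bar>Wh r ?\<xi> \<bullet> Kf r ?y\<bar>" by (simp add: sq(1))
          also have "\<dots> \<le> norm (Wh r ?\<xi>) * norm (Kf r ?y)" by (rule Cauchy_Schwarz_ineq2)
          also have "\<dots> \<le> ((norm (Wh r ?\<xi>))\<^sup>2 + (norm (Kf r ?y))\<^sup>2) / 2"
            using sum_squares_bound[of "norm (Wh r ?\<xi>)" "norm (Kf r ?y)"] by simp
          finally show ?thesis using a2 b2 by simp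
        qed
        have t3: "\<bar>?\<xi> \<bullet> ?G r ?y\<bar> \<le> (C \<pi> \<bullet> inv (R r) (C \<pi>) + (norm C)\<^sup>2 / \<rho> * M\<^sup>2 * e2 r) / 2"
        proof -
          define u where "u = norm (inv (R r) (C \<pi>))"
          define z where "z = norm (C ?y)"
          have "?\<xi> \<bullet> ?G r ?y = inv (R r) (C \<pi>) \<bullet> C ?y"
            unfolding gain_eq using P_selfadjoint[OF r', of ?\<xi> "gain_kernel r ?y"] kernel_sym[OF r', of \<pi> ?y]
            by (simp add: \<pi>_def kernel_inner)
          then have 1: "\<bar>?\<xi> \<bullet> ?G r ?y\<bar> \<le> u * z" unfolding u_def z_def by (simp add: Cauchy_Schwarz_ineq2)
          \<comment> \<open>Young inequality with the weight \<open>\<rho>\<close> of the coercivity of \<open>R\<close>.\<close>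
          have "0 \<le> (\<rho> * u - z)\<^sup>2 / \<rho>" using R(2) by simp
          also have "\<dots> = \<rho> * u\<^sup>2 - 2 * (u * z) + z\<^sup>2 / \<rho>" using R(2) by (simp add: power2_eq_square field_simps)
          finally have 2: "u * z \<le> (\<rho> * u\<^sup>2 + z\<^sup>2 / \<rho>) / 2" by simp
          have 3: "\<rho> * u\<^sup>2 \<le> C \<pi> \<bullet> inv (R r) (C \<pi>)" unfolding u_def by (rule output_energy[OF r'])
          have "z \<le> norm C * (M * e r)" unfolding z_def by (rule norm_blinfun_le[OF order_refl nY[OF r_in(4)]])
          then have "z\<^sup>2 \<le> (norm C * (M * e r))\<^sup>2" by (intro power_mono) (auto simp: z_def)
          also have "\<dots> = (norm C)\<^sup>2 * M\<^sup>2 * e2 r" by (simp add: power_mult_distrib ee[symmetric] power2_eq_square[of "e r"])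
          finally have "z\<^sup>2 / \<rho> \<le> (norm C)\<^sup>2 * M\<^sup>2 * e2 r / \<rho>" using R(2) by (intro divide_right_mono) auto
          then show ?thesis using 1 2 3 by (simp add: field_simps)
        qed
        have "w \<bullet> UP t r (A0 r ?y + Wh r (Kf r ?y) - (A1 r ?y - ?G r ?y))
           = w \<bullet> UP t r (A0 r ?y - A1 r ?y) + ?\<xi> \<bullet> Wh r (Kf r ?y) + ?\<xi> \<bullet> ?G r ?y"
          by (simp add: adjoint_inner blinfun.add_right blinfun.diff_right inner_add_right inner_diff_right)
        moreover have "Q r = q * \<kappa> * M * e r + ((?\<xi> \<bullet> W r ?\<xi> + kf\<^sup>2 * M\<^sup>2 * e2 r) / 2 + (C \<pi> \<bullet> inv (R r) (C \<pi>) + (norm C)\<^sup>2 / \<rho> * M\<^sup>2 * e2 r) / 2)"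
          by (simp add: Q_def cost_def G_def \<pi>_def algebra_simps add_divide_distrib)
        ultimately show "\<bar>w \<bullet> UP t r (A0 r ?y + Wh r (Kf r ?y) - (A1 r ?y - ?G r ?y))\<bar> \<le> Q r"
          using t1 t2 t3 by linarith
      qed (use dA B dK in auto)
      moreover have "Y s s = id_blinfun" using Y_ev st unfolding evolution_operator_def by auto
      moreover have "\<bar>w \<bullet> Y t s v\<bar> \<le> M"
      proof -
        have "e t \<le> 1" using Y_exp(3) st by (simp add: e_def)
        then have "M * e t \<le> M * 1" using Y_exp(2) by (intro mult_left_mono)
        then show ?thesis using Cauchy_Schwarz_ineq2[of w "Y t s v"] nY[OF st(2)] w by simp
      qed
      ultimately have "w \<bullet> UP t s v \<le> M + I"
        using integral_unique[OF QI] by (simp add: inner_diff_right abs_le_iff)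
      then show "UP t s v \<bullet> w \<le> a + q / 2" using Ile by (simp add: inner_commute a_def)
    qed
    then show "(\<lambda>(t, s). norm (UP t s)) x \<le> a + q / 2" by (simp add: x_def)
  qed
  then show ?thesis by (simp add: a_def G_def)
qed

section \<open>The estimation error\<close>

text \<open>
  Duhamel followed by Gronwall for a trajectory whose forcing differs from the closed-loop generator by a
  small multiple of the trajectory.
\<close>

lemma error_bound:
  assumes Q: "\<And>s t. 0 \<le> s \<Longrightarrow> s \<le> t \<Longrightarrow> t \<le> \<tau> \<Longrightarrow> norm (UP t s) \<le> Q"
    and eh: "approx_mild S 0 \<tau> f eh" and cont: "continuous_on {0..\<tau>} eh"
    and f: "\<And>r. r \<in> {0..\<tau>} \<Longrightarrow> norm (f r - (A1 r (eh r) - observer_gain P C R r (C (eh r)))) \<le> L * norm (eh r)"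
    and L: "0 \<le> L" and t: "t \<in> {0..\<tau>}"
  shows "norm (eh t) \<le> 2 * (Q * norm (eh 0)) * exp (2 * (Q * L) * t)"
proof -
  have Q0: "0 \<le> Q" using order_trans[OF norm_ge_zero Q[of 0 0]] \<tau> by simp
  note D1 = closed_loop_family
  have D10: "0 \<le> dA + B * dK" using dA B dK by simp
  have "bounded (eh ` {0..\<tau>})" by (intro compact_imp_bounded compact_continuous_image cont) simp
  then have "\<exists>N. \<forall>r\<in>{0..\<tau>}. norm (eh r) \<le> N" by (simp only: bounded_iff ball_simps)
  then obtain N where N: "\<And>r. r \<in> {0..\<tau>} \<Longrightarrow> norm (eh r) \<le> N" by blast
  have N0: "0 \<le> N" using order_trans[OF norm_ge_zero N[of 0]] \<tau> by simp
  define N' where "N' = N + (dA + B * dK + L) * N"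
  have nf: "norm (f r) \<le> N'" "norm (eh r) \<le> N'" if r: "r \<in> {0..\<tau>}" for r
  proof -
    have "norm (A1 r (eh r) - observer_gain P C R r (C (eh r))) \<le> (dA + B * dK) * N"
      using D10 N[OF r] by (intro order_trans[OF linear_family_norm[OF D1 r]] mult_left_mono)
    moreover have "norm (f r - (A1 r (eh r) - observer_gain P C R r (C (eh r)))) \<le> L * N"
      using f[OF r] mult_left_mono[OF N[OF r] L] by linarith
    ultimately show "norm (f r) \<le> N'"
      using norm_triangle_sub[of "f r" "A1 r (eh r) - observer_gain P C R r (C (eh r))"] N0
      by (simp add: N'_def algebra_simps)
    show "norm (eh r) \<le> N'" using N[OF r] N0 D10 L by (simp add: N'_def add_increasing2)
  qed
  have K: "0 \<le> Q * L" using Q0 L by simp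
  show ?thesis
  proof (rule gronwall[where b = "\<lambda>t. norm (eh t)", OF _ K _ _ t])
    show "\<exists>c. \<forall>t\<in>{0..\<tau>}. norm (eh t) \<le> c" using N by blast
    show "0 \<le> Q * norm (eh 0)" using Q0 by simp
    fix t c assume t: "t \<in> {0..\<tau>}" and c: "0 \<le> c"
      and le: "\<And>s. s \<in> {0..t} \<Longrightarrow> norm (eh s) \<le> c * exp (2 * (Q * L) * s)"
    have qi: "(\<lambda>r. Q * L * norm (eh r)) integrable_on {0..t}"
      using t by (intro integrable_continuous_real continuous_intros continuous_on_subset[OF cont]) auto
    define d where "d = eh t - UP t 0 (eh 0)"
    have "\<bar>d \<bullet> d\<bar> \<le> integral {0..t} (\<lambda>r. norm d * (Q * L * norm (eh r)))"
      unfolding d_def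
    proof (rule duhamel_estimate[OF fo_UP D1 D10 S UP, where f = f and N = N'])
      show "approx_mild S 0 t f eh"
        using eh t unfolding approx_mild_def by (meson atLeastAtMost_iff order_trans)
      fix r assume r: "r \<in> {0..t}"
      then have r': "r \<in> {0..\<tau>}" using t by auto
      have "norm (UP t r (f r - (A1 r (eh r) - observer_gain P C R r (C (eh r))))) \<le> Q * (L * norm (eh r))"
        using r t by (intro norm_blinfun_le Q f r') auto
      then show "\<bar>(eh t - UP t 0 (eh 0)) \<bullet> UP t r (f r - (A1 r (eh r) - observer_gain P C R r (C (eh r))))\<bar>
         \<le> norm (eh t - UP t 0 (eh 0)) * (Q * L * norm (eh r))"
        by (intro order_trans[OF Cauchy_Schwarz_ineq2] mult_left_mono) (auto simp: mult.assoc)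
    qed (use t nf integrable_on_cmult_left[OF qi] in auto)
    then have "norm d * norm d \<le> norm d * integral {0..t} (\<lambda>r. Q * L * norm (eh r))"
      by (simp add: power2_norm_eq_inner[symmetric] power2_eq_square)
    moreover have i0: "0 \<le> integral {0..t} (\<lambda>r. Q * L * norm (eh r))"
      using K by (intro integral_nonneg qi) auto
    ultimately have "norm d \<le> integral {0..t} (\<lambda>r. Q * L * norm (eh r))"
      by (cases "norm d = 0") (auto simp: mult_le_cancel_left)
    also have "\<dots> \<le> norm (integral {0..t} (\<lambda>r. Q * L * norm (eh r)))" by simp
    also have "\<dots> \<le> c / 2 * exp (2 * (Q * L) * (t - 0))"
      using le K t c by (intro gronwall_integral_bound[OF integrable_integral[OF qi]]) (auto intro!: mult_left_mono)
    finally have "norm d \<le> c / 2 * exp (2 * (Q * L) * t)" by simp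
    moreover have "norm (UP t 0 (eh 0)) \<le> Q * norm (eh 0)" using t by (intro norm_blinfun_le Q) auto
    ultimately show "norm (eh t) \<le> Q * norm (eh 0) + c / 2 * exp (2 * (Q * L) * t)"
      using norm_triangle_sub[of "eh t" "UP t 0 (eh 0)"] by (simp add: d_def)
  qed
qed

end

text \<open>
  A prescribed lower bound \<open>B0\<close> on \<open>B\<close> leaves room for a further evolution operator with the same bound.
\<close>

lemma riccati_horizon_exists:
  fixes S :: "real \<Rightarrow> 'h::{real_inner,banach} \<Rightarrow>\<^sub>L 'h" and C :: "'h \<Rightarrow>\<^sub>L 'b::euclidean_space"
    and P0 :: "'h \<Rightarrow>\<^sub>L 'h" and R :: "real \<Rightarrow> 'b \<Rightarrow>\<^sub>L 'b" and W :: "real \<Rightarrow> 'h \<Rightarrow>\<^sub>L 'h"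
    and DF :: "'h \<Rightarrow> real \<Rightarrow> 'h \<Rightarrow>\<^sub>L 'h"
  assumes sol: "riccati_solution S DF C R W P0 x U UP P"
    and S: "\<And>v. continuous_on {0..} (\<lambda>t. S t v)"
    and DF: "\<And>t x. 0 \<le> t \<Longrightarrow> norm (DF x t) \<le> \<delta>" "0 \<le> \<delta>"
    and P0: "selfadjoint P0" "\<And>v. 0 \<le> v \<bullet> P0 v"
    and W: "\<And>t. 0 \<le> t \<Longrightarrow> selfadjoint (W t)" "\<And>t. 0 \<le> t \<Longrightarrow> nonneg_definite (W t)"
           "\<And>t. 0 \<le> t \<Longrightarrow> norm (W t) \<le> w\<^sub>W" "0 \<le> w\<^sub>W"
    and R: "\<And>t. 0 \<le> t \<Longrightarrow> selfadjoint (R t)" "0 < \<rho>"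
           "\<And>t v. 0 \<le> t \<Longrightarrow> \<rho> * (norm v)\<^sup>2 \<le> v \<bullet> R t v"
    and \<tau>: "0 \<le> \<tau>"
  shows "\<exists>B\<ge>B0. riccati_horizon C R P \<tau> B \<rho> S (\<lambda>r. DF (x r) r) UP W P0 \<delta> w\<^sub>W"
proof -
  have pe1: "perturbed_evolution (\<lambda>t s. S (t - s)) (\<lambda>r. DF (x r) r) U"
    and pe2: "perturbed_evolution U (\<lambda>r v. - observer_gain P C R r (C v)) UP"
    and Pc: "\<And>w. continuous_on {0..} (\<lambda>t. P t w)"
    using sol unfolding riccati_solution_def by auto
  have ric: "((\<lambda>s. UP t s (W s (adjoint (UP t s) w) + observer_gain P C R s (C (P s (adjoint (UP t s) w)))))
          has_integral (P t w - UP t 0 (P0 (adjoint (UP t 0) w)))) {0..t}" if "0 \<le> t" for t w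
    using sol that unfolding riccati_solution_def has_integral_iff by simp
  obtain BS where BS: "BS \<ge> 0" "\<forall>t\<in>{0..\<tau>}. norm (S t) \<le> BS"
    using strongly_continuous_bounded[of 0 \<tau> S] continuous_on_subset[OF S] by auto
  obtain BP where BP: "BP \<ge> 0" "\<forall>t\<in>{0..\<tau>}. norm (P t) \<le> BP"
    using strongly_continuous_bounded[of 0 \<tau> P] continuous_on_subset[OF Pc] by auto
  interpret gd: gain_data C R P \<tau> BP \<rho>
    by unfold_locales (use BP R in auto)
  have A: "linear_family \<tau> \<delta> (\<lambda>r. DF (x r) r)"
    unfolding linear_family_def
    by (intro ballI conjI allI bounded_linear.linear[OF blinfun.bounded_linear_right] norm_blinfun_le[OF DF(1) order_refl]) simp
  note G = linear_family_minus[OF gd.gain_family]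
  have G0: "0 \<le> BP * gd.dK" using BP gd.dK by simp
  obtain BU where BU: "BU \<ge> 0" "triangle_bounded \<tau> BU UP"
    using first_order_two_step(2)[OF S pe1 A DF(2) pe2 G G0] by blast
  have fo: "first_order S \<tau> (\<lambda>r v. DF (x r) r v - observer_gain P C R r (C v)) UP"
    using first_order_two_step(1)[OF S pe1 A DF(2) pe2 G G0] by simp
  define B where "B = max B0 (max BS (max BP BU))"
  have Bs: "B0 \<le> B" "BS \<le> B" "BP \<le> B" "BU \<le> B" by (auto simp: B_def)
  have ev: "evolution_operator UP" using pe2 unfolding perturbed_evolution_def by blast
  have "riccati_horizon C R P \<tau> B \<rho> S (\<lambda>r. DF (x r) r) UP W P0 \<delta> w\<^sub>W"
  proof unfold_locales
    show "0 \<le> B" using BS Bs by linarith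
    show "norm (P t) \<le> B" if "t \<in> {0..\<tau>}" for t using BP(2) that Bs(3) by (meson order_trans)
    show "norm (S h) \<le> B" if "h \<in> {0..\<tau>}" for h using BS(2) that Bs(2) by (meson order_trans)
    show "triangle_bounded \<tau> B UP" by (rule triangle_bounded_mono[OF BU(2) Bs(4)])
    show "linear_family \<tau> \<delta> (\<lambda>r. DF (x r) r)" by (rule A)
    show "first_order S \<tau> (\<lambda>r v. DF (x r) r v - observer_gain P C R r (C v)) UP" by (rule fo)
  qed (use ev ric \<tau> DF P0 W R in auto)
  then show ?thesis using Bs(1) by blast
qed

text \<open>
  The semigroup law moves the starting time of the mild equation from \<open>0\<close> to \<open>a\<close>.
\<close>

lemma mild_two_times:
  assumes T: "C0_semigroup T"
    and y: "\<And>t. 0 \<le> t \<Longrightarrow> ((\<lambda>s. T (t - s) (f s)) has_integral (y t - T t y0)) {0..t}"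
    and ab: "0 \<le> a" "a \<le> b"
  shows "((\<lambda>s. T (b - s) (f s)) has_integral (y b - T (b - a) (y a))) {a..b}"
proof -
  have comp: "T s (T t v) = T (s + t) v" if "0 \<le> s" "0 \<le> t" for s t v
    using T that unfolding C0_semigroup_def by (metis blinfun_apply_blinfun_compose)
  have "((\<lambda>s. T (b - a) (T (a - s) (f s))) has_integral (T (b - a) (y a - T a y0))) {0..a}"
    using has_integral_linear[OF y[OF ab(1)] blinfun.bounded_linear_right] by (simp add: o_def)
  then have "((\<lambda>s. T (b - a) (T (a - s) (f s))) has_integral (T (b - a) (y a) - T b y0)) {0..a}"
    using ab by (simp add: blinfun.diff_right comp)
  then have 1: "((\<lambda>s. T (b - s) (f s)) has_integral (T (b - a) (y a) - T b y0)) {0..a}"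
    by (rule has_integral_eq[rotated]) (use ab in \<open>simp add: comp\<close>)
  have 2: "((\<lambda>s. T (b - s) (f s)) has_integral (y b - T b y0)) {0..b}" using y ab by simp
  have 3: "(\<lambda>s. T (b - s) (f s)) integrable_on {a..b}"
    by (rule integrable_on_subinterval[of _ "{0..b}"]) (use 2 ab in auto)
  have "integral {0..a} (\<lambda>s. T (b - s) (f s)) + integral {a..b} (\<lambda>s. T (b - s) (f s)) = integral {0..b} (\<lambda>s. T (b - s) (f s))"
    by (rule Henstock_Kurzweil_Integration.integral_combine) (use 2 ab in auto)
  then have "integral {a..b} (\<lambda>s. T (b - s) (f s)) = y b - T (b - a) (y a)"
    using integral_unique[OF 1] integral_unique[OF 2] by (simp add: algebra_simps)
  then show ?thesis using 3 by (simp add: has_integral_iff)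
qed

text \<open>
  Passing from \<open>y\<close> to \<open>exp (\<alpha> r) *\<^sub>R y r\<close> turns the mild equation for \<open>T\<close> into the one for the shifted semigroup, in which \<open>UP\<close> is
  formulated.
\<close>

lemma approx_mild_rescaled:
  assumes T: "C0_semigroup T"
    and y: "\<And>t. 0 \<le> t \<Longrightarrow> ((\<lambda>s. T (t - s) (f s)) has_integral (y t - T t y0)) {0..t}"
    and Ta: "\<And>t. 0 \<le> t \<Longrightarrow> Ta t = exp (\<alpha> * t) *\<^sub>R T t"
  shows "approx_mild Ta 0 \<tau> (\<lambda>r. exp (\<alpha> * r) *\<^sub>R f r) (\<lambda>r. exp (\<alpha> * r) *\<^sub>R y r)"
  unfolding approx_mild_def
proof (intro exI[of _ 0] conjI allI impI)
  fix a b :: real assume ab: "0 \<le> a" "a \<le> b"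
  have e: "exp (\<alpha> * (b - s)) * exp (\<alpha> * s) = exp (\<alpha> * b)" for s by (simp add: algebra_simps flip: exp_add)
  have "((\<lambda>s. exp (\<alpha> * b) *\<^sub>R T (b - s) (f s)) has_integral exp (\<alpha> * b) *\<^sub>R (y b - T (b - a) (y a))) {a..b}"
    using has_integral_linear[OF mild_two_times[OF T y ab] bounded_linear_scaleR_right] by (simp add: o_def)
  moreover have "exp (\<alpha> * b) *\<^sub>R (y b - T (b - a) (y a)) = exp (\<alpha> * b) *\<^sub>R y b - Ta (b - a) (exp (\<alpha> * a) *\<^sub>R y a)"
    using ab e[of a] by (simp add: Ta blinfun.scaleR_left blinfun.scaleR_right scaleR_diff_right mult.commute)
  ultimately have "((\<lambda>s. exp (\<alpha> * b) *\<^sub>R T (b - s) (f s)) has_integral (exp (\<alpha> * b) *\<^sub>R y b - Ta (b - a) (exp (\<alpha> * a) *\<^sub>R y a))) {a..b}"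
    by simp
  then have "((\<lambda>s. Ta (b - s) (exp (\<alpha> * s) *\<^sub>R f s)) has_integral (exp (\<alpha> * b) *\<^sub>R y b - Ta (b - a) (exp (\<alpha> * a) *\<^sub>R y a))) {a..b}"
    by (rule has_integral_eq[rotated])
       (use e in \<open>simp add: Ta blinfun.scaleR_left blinfun.scaleR_right mult.commute\<close>)
  then show "\<exists>i. (i has_integral (exp (\<alpha> * b) *\<^sub>R y b - Ta (b - a) (exp (\<alpha> * a) *\<^sub>R y a))) {a..b} \<and>
      (\<forall>r\<in>{a..b}. norm (i r - Ta (b - r) (exp (\<alpha> * r) *\<^sub>R f r)) \<le> 0 * (b - a))"
    by (intro exI[of _ "\<lambda>s. Ta (b - s) (exp (\<alpha> * s) *\<^sub>R f s)"]) simp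
qed simp

lemma observer_error_equation:
  fixes C :: "'a::banach \<Rightarrow>\<^sub>L 'b::real_normed_vector"
  assumes z: "mild_solution T (\<lambda>x t. F x t + b t + d t) z0 z"
    and zh: "mild_solution T (\<lambda>x t. F x t + b t + L t (y t - C x)) zh0 zh"
    and d: "\<And>t. 0 \<le> t \<Longrightarrow> d t = 0" and y: "\<And>t. 0 \<le> t \<Longrightarrow> y t = C (z t)" and t: "0 \<le> t"
  shows "((\<lambda>s. T (t - s) (F (z s) s - F (zh s) s - L s (C (z s - zh s)))) has_integral
      ((z t - zh t) - T t (z0 - zh0))) {0..t}"
proof -
  let ?f = "\<lambda>s. T (t - s) (F (z s) s + b s + d s)" and ?h = "\<lambda>s. T (t - s) (F (zh s) s + b s + L s (y s - C (zh s)))"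
  have "((\<lambda>s. ?f s) has_integral (z t - T t z0)) {0..t}"
    using z t unfolding mild_solution_def by (auto simp: has_integral_iff)
  moreover have "((\<lambda>s. ?h s) has_integral (zh t - T t zh0)) {0..t}"
    using zh t unfolding mild_solution_def by (auto simp: has_integral_iff)
  ultimately have "((\<lambda>s. ?f s - ?h s)
      has_integral ((z t - T t z0) - (zh t - T t zh0))) {0..t}"
    by (rule has_integral_diff)
  moreover have "(z t - T t z0) - (zh t - T t zh0) = (z t - zh t) - T t (z0 - zh0)"
    by (simp add: blinfun.diff_right)
  ultimately have "((\<lambda>s. ?f s - ?h s)
      has_integral ((z t - zh t) - T t (z0 - zh0))) {0..t}" by simp
  then show ?thesis
  proof (rule has_integral_eq[rotated])
    fix s assume "s \<in> {0..t}"
    then have "0 \<le> s" by simp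
    have "?f s - ?h s
       = T (t - s) ((F (z s) s + b s + d s) - (F (zh s) s + b s + L s (y s - C (zh s))))"
      by (simp only: blinfun.diff_right)
    also have "(F (z s) s + b s + d s) - (F (zh s) s + b s + L s (y s - C (zh s))) = F (z s) s - F (zh s) s - L s (C (z s - zh s))"
      using \<open>0 \<le> s\<close> by (simp add: d y blinfun.diff_right)
    finally show "?f s - ?h s
       = T (t - s) (F (z s) s - F (zh s) s - L s (C (z s - zh s)))" .
  qed
qed

section \<open>Exponential decay of the estimation error\<close>

theorem theoremV1:
  fixes A :: "'h::{real_inner,banach} \<Rightarrow> 'h" and D :: "'h set"
    and T Ta :: "real \<Rightarrow> 'h \<Rightarrow>\<^sub>L 'h"
    and B :: "'h1::{real_inner,banach} \<Rightarrow>\<^sub>L 'h"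
    and G :: "'h2::{real_inner,banach} \<Rightarrow>\<^sub>L 'h"
    and C :: "'h \<Rightarrow>\<^sub>L (real ^ 'p)"
    and u :: "real \<Rightarrow> 'h1" and \<omega> :: "real \<Rightarrow> 'h2" and \<eta> :: "real \<Rightarrow> (real ^ 'p)"
    and F :: "'h \<Rightarrow> real \<Rightarrow> 'h" and DF :: "'h \<Rightarrow> real \<Rightarrow> 'h \<Rightarrow>\<^sub>L 'h"
    and P0 :: "'h \<Rightarrow>\<^sub>L 'h" and W Wh :: "real \<Rightarrow> 'h \<Rightarrow>\<^sub>L 'h"
    and R :: "real \<Rightarrow> (real ^ 'p) \<Rightarrow>\<^sub>L (real ^ 'p)"
    and z0 :: 'h and z :: "real \<Rightarrow> 'h" and y :: "real \<Rightarrow> (real ^ 'p)"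
    and zhat :: "'h \<Rightarrow> real \<Rightarrow> 'h"
    and U UP :: "'h \<Rightarrow> real \<Rightarrow> real \<Rightarrow> 'h \<Rightarrow>\<^sub>L 'h"
    and P :: "'h \<Rightarrow> real \<Rightarrow> 'h \<Rightarrow>\<^sub>L 'h"
    and \<alpha> \<delta>DF T\<phi> m \<epsilon>\<phi> \<delta>\<phi> :: real
  assumes "0 < \<alpha>"
    and "generates D A T"
    and "generates D (\<lambda>x. A x + \<alpha> *\<^sub>R x) Ta"
    and "continuous_on {0..} u" and "continuous_on {0..} \<omega>" and "continuous_on {0..} \<eta>"
    and "\<forall>x. continuous_on {0..} (F x)"
    and "\<forall>t\<ge>0. F 0 t = 0"
    and "\<forall>t\<ge>0. \<forall>x. ((\<lambda>x. F x t) has_derivative DF x t) (at x)"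
    and "0 < \<delta>DF" and "\<forall>t\<ge>0. \<forall>x. norm (DF x t) \<le> \<delta>DF"
    and "\<forall>\<delta>>0. \<exists>\<iota>>0. \<forall>t\<ge>0. \<forall>x1 x2.
           norm (x1 - x2) < \<delta> \<longrightarrow> norm (DF x1 t - DF x2 t) \<le> \<iota> * norm (x1 - x2)"
    and "selfadjoint P0" and "pos_definite P0"
    and "\<forall>t\<ge>0. selfadjoint (W t)" and "\<forall>t\<ge>0. nonneg_definite (W t)"
    and "continuous_on {0..} W" and "bounded (W ` {0..})"
    and "\<forall>t\<ge>0. selfadjoint (R t)" and "uniformly_coercive R"
    and "continuous_on {0..} R" and "bounded (R ` {0..})"
    and "\<forall>t\<ge>0. is_sqrt_of (Wh t) (W t)"
    (* the system, started at z0, and its measurement *)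
    and "mild_solution T (\<lambda>x t. F x t + B (u t) + G (\<omega> t)) z0 z"
    and "\<forall>t\<ge>0. y t = C (z t) + \<eta> t"
    (* the observer, for each of its possible initial states *)
    and "\<forall>zhat0. mild_solution T
           (\<lambda>x t. F x t + B (u t) + observer_gain (P zhat0) C R t (y t - C x)) zhat0 (zhat zhat0)"
    and "\<forall>zhat0. riccati_solution Ta DF C R W P0 (zhat zhat0) (U zhat0) (UP zhat0) (P zhat0)"
    and "\<forall>zhat0. uniformly_detectable (U zhat0) C"
    and "\<forall>zhat0. uniformly_stabilizable (U zhat0) Wh"
    and "0 < T\<phi>" and "1 < m" and "0 < \<epsilon>\<phi>" and "0 < \<delta>\<phi>"
    and "\<forall>z e t. norm e \<le> \<epsilon>\<phi> \<and> 0 \<le> t \<and> t \<le> T\<phi> \<longrightarrow>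
           norm (linearization_error F DF z e t) \<le> \<delta>\<phi> * norm e powr m"
    (* absence of disturbances *)
    and "\<forall>t\<ge>0. \<omega> t = 0" and "\<forall>t\<ge>0. \<eta> t = 0"
  shows "\<exists>\<epsilon>>0. \<exists>M\<^sub>e>0. \<exists>\<alpha>\<^sub>e>0. \<forall>zhat0.
           norm (z 0 - zhat zhat0 0) < \<epsilon> \<longrightarrow>
           (\<forall>t\<ge>0. norm (z t - zhat zhat0 t) \<le>
              M\<^sub>e * exp (- \<alpha>\<^sub>e * t) * norm (z 0 - zhat zhat0 0))"
proof -
  note DF_bd = assms(11)[rule_format]
  have T0: "C0_semigroup T" using assms(2) by (simp add: generates_def)
  have Ta_eq: "Ta t = exp (\<alpha> * t) *\<^sub>R T t" if "0 \<le> t" for t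
    by (rule generator_unique[OF assms(3) rescaled_semigroup_generates[OF assms(2)] that])
  have Tac: "continuous_on {0..} (\<lambda>t. Ta t v)" for v
    using assms(3) unfolding generates_def C0_semigroup_def by blast
  have Tc: "continuous_on {0..} (\<lambda>t. T t v)" for v
    using T0 unfolding C0_semigroup_def by blast
  obtain w\<^sub>W where w: "\<And>t. 0 \<le> t \<Longrightarrow> norm (W t) \<le> w\<^sub>W"
    using assms(18) by (auto simp: bounded_iff)
  have w0: "0 \<le> w\<^sub>W" using order_trans[OF norm_ge_zero w[of 0]] by simp
  obtain rr where rr: "\<And>t. 0 \<le> t \<Longrightarrow> norm (R t) \<le> rr"
    using assms(22) by (auto simp: bounded_iff)
  have rr0: "0 \<le> rr" using order_trans[OF norm_ge_zero rr[of 0]] by simp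
  obtain \<rho> where \<rho>: "0 < \<rho>" "\<And>t v. 0 \<le> t \<Longrightarrow> \<rho> * (norm v)\<^sup>2 \<le> v \<bullet> R t v"
    using assms(20) unfolding uniformly_coercive_def by blast
  obtain \<iota> where \<iota>: "0 < \<iota>" "\<And>t x1 x2. 0 \<le> t \<Longrightarrow> norm (x1 - x2) < 1 \<Longrightarrow> norm (DF x1 t - DF x2 t) \<le> \<iota> * norm (x1 - x2)"
    using assms(12)[rule_format, of 1] by auto
  have P0_pos: "0 \<le> v \<bullet> P0 v" for v
    using assms(14) unfolding pos_definite_def by (cases "v = 0") (auto intro: less_imp_le)
  note mild_z = assms(24) and mild_zhat = assms(26)[rule_format] and ric = assms(27)[rule_format]
  have der: "((\<lambda>x. F x t) has_derivative DF x t) (at x)" if "0 \<le> t" for x t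
    using assms(9) that by blast
  have zc: "continuous_on {0..} z" using mild_z unfolding mild_solution_def by blast
  have zhc: "continuous_on {0..} (zhat a)" for a using mild_zhat[of a] unfolding mild_solution_def by blast
  define e where "e a t = z t - zhat a t" for a t
  define f0 where "f0 a s = F (z s) s - F (zhat a s) s - observer_gain (P a) C R s (C (e a s))" for a s
  have e_eq: "((\<lambda>s. T (t - s) (f0 a s)) has_integral (e a t - T t (z0 - a))) {0..t}" if "0 \<le> t" for a t
    unfolding e_def f0_def
    by (rule observer_error_equation[OF mild_z mild_zhat[of a] _ _ that])
       (use assms(25,35,36) in \<open>simp_all add: blinfun.zero_right\<close>)
  have ec: "continuous_on {0..} (e a)" for a unfolding e_def by (intro continuous_intros zc zhc)
  have horizon: "\<exists>B\<ge>B0. riccati_horizon C R (P a) \<tau> B \<rho> Ta (\<lambda>r. DF (zhat a r) r) (UP a) W P0 \<delta>DF w\<^sub>W"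
    if "0 \<le> \<tau>" for a \<tau> B0
    by (rule riccati_horizon_exists[OF ric[of a] Tac])
       (use DF_bd assms(10,13,15,16,19) P0_pos w w0 \<rho> that in auto)
  \<comment> \<open>Gronwall for the error equation with zero initial error, where \<open>F\<close> is globally Lipschitz.\<close>
  have zhat_z0: "zhat z0 t = z t" if t: "0 \<le> t" for t
  proof -
    obtain BT where BT: "BT \<ge> 0" "\<forall>s\<in>{0..t}. norm (T s) \<le> BT"
      using strongly_continuous_bounded[of 0 t T] continuous_on_subset[OF Tc] by auto
    obtain B where "riccati_horizon C R (P z0) t B \<rho> Ta (\<lambda>r. DF (zhat z0 r) r) (UP z0) W P0 \<delta>DF w\<^sub>W"
      using horizon[OF t, of 0 z0] by blast
    then interpret rh: riccati_horizon C R "P z0" t B \<rho> Ta "\<lambda>r. DF (zhat z0 r) r" "UP z0" W P0 \<delta>DF w\<^sub>W .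
    define K where "K = BT * (\<delta>DF + B * rh.dK)"
    have K: "0 \<le> K" using BT(1) assms(10) rh.B rh.dK by (simp add: K_def)
    have "norm (e z0 t) \<le> 2 * 0 * exp (2 * K * t)"
    proof (rule gronwall[where b = "\<lambda>t. norm (e z0 t)" and \<tau> = t, OF _ K])
      have "bounded (e z0 ` {0..t})"
        by (intro compact_imp_bounded compact_continuous_image continuous_on_subset[OF ec]) auto
      then show "\<exists>c. \<forall>s\<in>{0..t}. norm (e z0 s) \<le> c" by (simp only: bounded_iff ball_simps)
      fix s c assume s: "s \<in> {0..t}" and c: "0 \<le> c"
        and le: "\<And>r. r \<in> {0..s} \<Longrightarrow> norm (e z0 r) \<le> c * exp (2 * K * r)"
      have "((\<lambda>r. T (s - r) (f0 z0 r)) has_integral (e z0 s)) {0..s}"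
        using e_eq[of s z0] s by simp
      then have "norm (e z0 s) \<le> c / 2 * exp (2 * K * (s - 0))"
      proof (rule gronwall_integral_bound[OF _ _ K c])
        fix r assume r: "r \<in> {0..s}"
        then have r': "r \<in> {0..t}" "0 \<le> r" using s by auto
        have "norm (F (z r) r - F (zhat z0 r) r) \<le> \<delta>DF * norm (e z0 r)"
          unfolding e_def by (rule lipschitz_of_derivative_bound[OF der[OF r'(2)] DF_bd[OF r'(2)]])
        moreover have "norm (observer_gain (P z0) C R r (C (e z0 r))) \<le> B * rh.dK * norm (e z0 r)"
          by (rule linear_family_norm[OF rh.gain_family r'(1)])
        ultimately have "norm (f0 z0 r) \<le> (\<delta>DF + B * rh.dK) * norm (e z0 r)"
          unfolding f0_def distrib_right by (rule order_trans[OF norm_triangle_ineq4 add_mono])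
        also have "\<dots> \<le> (\<delta>DF + B * rh.dK) * (c * exp (2 * K * r))"
          using le[OF r] assms(10) rh.B rh.dK by (intro mult_left_mono) auto
        finally have "norm (T (s - r) (f0 z0 r)) \<le> BT * ((\<delta>DF + B * rh.dK) * (c * exp (2 * K * r)))"
          using BT(2) r s by (intro norm_blinfun_le) auto
        then show "norm (T (s - r) (f0 z0 r)) \<le> K * (c * exp (2 * K * (r - 0)))"
          by (simp add: K_def mult.assoc)
      qed (use s in auto)
      then show "norm (e z0 s) \<le> 0 + c / 2 * exp (2 * K * s)" by simp
    qed (use t in auto)
    then show ?thesis by (simp add: e_def)
  qed
  obtain \<Lambda> :: "real \<Rightarrow> (real ^ 'p) \<Rightarrow>\<^sub>L 'h" and Z where \<Lambda>: "bounded (\<Lambda> ` {0..})"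
    and Z: "perturbed_evolution (U z0) (\<lambda>r v. \<Lambda> r (C v)) Z" "exponentially_stable Z"
    using assms(28) unfolding uniformly_detectable_def by blast
  obtain Kf :: "real \<Rightarrow> 'h \<Rightarrow>\<^sub>L 'h" and Y where Kf: "bounded (Kf ` {0..})"
    and Y: "perturbed_evolution (U z0) (\<lambda>r v. Wh r (Kf r v)) Y" "exponentially_stable Y"
    using assms(29) unfolding uniformly_stabilizable_def by blast
  obtain l where l: "\<And>t. 0 \<le> t \<Longrightarrow> norm (\<Lambda> t) \<le> l" using \<Lambda> by (auto simp: bounded_iff)
  have l0: "0 \<le> l" using order_trans[OF norm_ge_zero l[of 0]] by simp
  obtain kf where kf: "\<And>t. 0 \<le> t \<Longrightarrow> norm (Kf t) \<le> kf" using Kf by (auto simp: bounded_iff)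
  have kf0: "0 \<le> kf" using order_trans[OF norm_ge_zero kf[of 0]] by simp
  obtain M \<beta> where M: "0 \<le> M" "0 < \<beta>" "\<And>s t. 0 \<le> s \<Longrightarrow> s \<le> t \<Longrightarrow> norm (Z t s) \<le> M * exp (- \<beta> * (t - s))"
    using Z(2) unfolding exponentially_stable_def by blast
  obtain M' \<beta>' where M': "0 \<le> M'" "0 < \<beta>'" "\<And>s t. 0 \<le> s \<Longrightarrow> s \<le> t \<Longrightarrow> norm (Y t s) \<le> M' * exp (- \<beta>' * (t - s))"
    using Y(2) unfolding exponentially_stable_def by blast
  have Z_ev: "evolution_operator Z" and Y_ev: "evolution_operator Y"
    using Z(1) Y(1) unfolding perturbed_evolution_def by auto
  have pe_U: "perturbed_evolution (\<lambda>t s. Ta (t - s)) (\<lambda>r. DF (zhat z0 r) r) (U z0)"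
    using ric[of z0] unfolding riccati_solution_def by blast
  obtain M1 where M1: "0 \<le> M1" "\<forall>h\<in>{0..1}. norm (Ta h) \<le> M1"
    using strongly_continuous_bounded[of 0 1 Ta] continuous_on_subset[OF Tac] by auto
  have DF_fam: "linear_family \<tau> \<delta>DF (\<lambda>r. DF (zhat a r) r)" for a \<tau>
    unfolding linear_family_def
    by (intro ballI conjI allI bounded_linear.linear[OF blinfun.bounded_linear_right] norm_blinfun_le[OF DF_bd order_refl]) simp
  have LC: "linear_family \<tau> (l * norm C) (\<lambda>r v. \<Lambda> r (C v))" for \<tau>
    using linear_family_compose[of \<tau> \<Lambda> l "\<lambda>_. C" "norm C"] l by simp
  have WK: "linear_family \<tau> (sqrt w\<^sub>W * kf) (\<lambda>r v. Wh r (Kf r v))" for \<tau>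
    by (intro linear_family_compose norm_sqrt_le[OF _ w]) (use assms(23) kf in auto)
  have fo_Z: "first_order Ta \<tau> (\<lambda>r v. DF (zhat z0 r) r v + \<Lambda> r (C v)) Z" for \<tau>
    by (rule first_order_two_step(1)[OF Tac pe_U DF_fam _ Z(1) LC]) (use assms(10) l0 in auto)
  have fo_Y: "first_order Ta \<tau> (\<lambda>r v. DF (zhat z0 r) r v + Wh r (Kf r v)) Y" for \<tau>
    by (rule first_order_two_step(1)[OF Tac pe_U DF_fam _ Y(1) WK]) (use assms(10) w0 kf0 in auto)
  define g where "g = M1\<^sup>2 * M\<^sup>2 * exp (2 * \<beta>) / (2 * \<beta>)"
  define p where "p = 2 * (norm P0 * M\<^sup>2 + (w\<^sub>W + rr * l\<^sup>2) * g)"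
  define Q where "Q = 1 + 2 * (M' + p / 2 + (kf\<^sup>2 + (norm C)\<^sup>2 / \<rho>) * M'\<^sup>2 / (4 * \<beta>'))"
  have g0: "0 \<le> g" using M by (simp add: g_def)
  have p0: "0 \<le> p" using w0 rr0 g0 by (simp add: p_def)
  have Q1: "1 \<le> Q" using M' p0 \<rho>(1) by (simp add: Q_def)
  \<comment> \<open>Each summand of \<open>q\<close> secures one of the smallness conditions in \<open>r0\<close> below.\<close>
  define q where "q = 2 + 4 * \<iota> * g + 2 * \<iota> * M' / \<beta>' + 4 * Q * \<iota> / \<alpha>"
  define r0 where "r0 = 1 / q"
  have q_terms: "0 \<le> 4 * \<iota> * g" "0 \<le> 2 * \<iota> * M' / \<beta>'" "0 \<le> 4 * Q * \<iota> / \<alpha>"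
    using \<iota>(1) g0 M' Q1 assms(1) by auto
  then have q: "2 \<le> q" "4 * \<iota> * g \<le> q" "2 * \<iota> * M' / \<beta>' \<le> q" "4 * Q * \<iota> / \<alpha> \<le> q"
    unfolding q_def by linarith+
  have r0: "0 < r0" "r0 < 1" "4 * (\<iota> * r0) * g \<le> 1" "2 * (\<iota> * r0) * M' \<le> \<beta>'" "4 * Q * (\<iota> * r0) \<le> \<alpha>"
    using q M'(2) assms(1) by (auto simp: r0_def field_simps)
  \<comment> \<open>While the error stays below \<open>r0\<close>, the bounds hold with the constants \<open>p\<close> and \<open>Q\<close> of the reference trajectory.\<close>
  have decay: "norm (e a t) \<le> 2 * Q * exp (- (\<alpha> / 2) * t) * norm (e a 0)"
    if \<tau>: "0 \<le> \<tau>" and small: "\<And>s. s \<in> {0..\<tau>} \<Longrightarrow> norm (e a s) \<le> r0" and t: "t \<in> {0..\<tau>}" for a \<tau> t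
  proof -
    obtain B where B: "M' \<le> B" and "riccati_horizon C R (P a) \<tau> B \<rho> Ta (\<lambda>r. DF (zhat a r) r) (UP a) W P0 \<delta>DF w\<^sub>W"
      using horizon[OF \<tau>] by blast
    then interpret rh: riccati_horizon C R "P a" \<tau> B \<rho> Ta "\<lambda>r. DF (zhat a r) r" "UP a" W P0 \<delta>DF w\<^sub>W by simp
    \<comment> \<open>Because the reference observer equals \<open>z\<close>, the distance of the two trajectories is the error.\<close>
    have \<kappa>: "norm (DF (zhat z0 r) r v - DF (zhat a r) r v) \<le> \<iota> * r0 * norm v" if r: "r \<in> {0..\<tau>}" for r v
    proof -
      have "norm (DF (zhat z0 r) r - DF (zhat a r) r) \<le> \<iota> * norm (zhat z0 r - zhat a r)"
        using r small[OF r] r0(2) zhat_z0[of r] by (intro \<iota>(2)) (auto simp: e_def)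
      also have "\<dots> \<le> \<iota> * r0"
        using r small[OF r] zhat_z0[of r] \<iota>(1) by (intro mult_left_mono) (auto simp: e_def)
      finally show ?thesis
        using norm_blinfun_le[of "DF (zhat z0 r) r - DF (zhat a r) r" "\<iota> * r0" v "norm v"] by (simp add: blinfun.diff_left)
    qed
    have \<kappa>0: "0 \<le> \<iota> * r0" using \<iota>(1) r0(1) by simp
    have P_le: "norm (P a s) \<le> p" if "s \<in> {0..\<tau>}" for s
      unfolding p_def
      by (rule rh.riccati_uniform_bound[OF fo_Z Z_ev M(3,1,2) DF_fam _ l0 \<kappa> \<kappa>0 _ rr0 _ M1(1) g_def r0(3) that])
         (use l rr M1(2) in auto)
    have Y_bd: "triangle_bounded \<tau> B Y"
      unfolding triangle_bounded_def
    proof (intro allI impI)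
      fix s t :: real assume st: "0 \<le> s" "s \<le> t" "t \<le> \<tau>"
      have "M' * exp (- \<beta>' * (t - s)) \<le> M' * 1" using M' st by (intro mult_left_mono) auto
      then show "norm (Y t s) \<le> B" using M'(3)[OF st(1,2)] B by linarith
    qed
    have UP_le: "norm (UP a t s) \<le> Q" if "0 \<le> s" "s \<le> t" "t \<le> \<tau>" for s t
    proof -
      have "norm (UP a t s) \<le> 2 * (M' + p / 2 + (kf\<^sup>2 + (norm C)\<^sup>2 / \<rho>) * M'\<^sup>2 / (4 * \<beta>'))"
        by (rule rh.closed_loop_bound[OF fo_Y Y_ev M'(3,1,2) Y_bd DF_fam WK _ _ _ kf0 \<kappa> \<kappa>0 P_le p0 r0(4) that])
           (use assms(23) kf w0 kf0 in auto)
      then show ?thesis by (simp add: Q_def)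
    qed
    define eh where "eh r = exp (\<alpha> * r) *\<^sub>R e a r" for r
    have mild: "approx_mild Ta 0 \<tau> (\<lambda>r. exp (\<alpha> * r) *\<^sub>R f0 a r) eh"
      unfolding eh_def by (rule approx_mild_rescaled[OF T0 e_eq Ta_eq])
    have cont: "continuous_on {0..\<tau>} eh"
      unfolding eh_def by (intro continuous_intros continuous_on_subset[OF ec]) auto
    have L: "norm (exp (\<alpha> * r) *\<^sub>R f0 a r - (DF (zhat a r) r (eh r) - observer_gain (P a) C R r (C (eh r)))) \<le> \<iota> * r0 * norm (eh r)"
      if r: "r \<in> {0..\<tau>}" for r
    proof -
      have r': "0 \<le> r" using r by simp
      have "linear (\<lambda>v. observer_gain (P a) C R r (C v))"
        using rh.gain_family r by (simp add: linear_family_def)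
      from linear_cmul[OF this, of "exp (\<alpha> * r)" "e a r"]
      have "exp (\<alpha> * r) *\<^sub>R f0 a r - (DF (zhat a r) r (eh r) - observer_gain (P a) C R r (C (eh r)))
        = exp (\<alpha> * r) *\<^sub>R (F (z r) r - F (zhat a r) r - DF (zhat a r) r (e a r))"
        unfolding eh_def f0_def by (simp add: blinfun.scaleR_right algebra_simps)
      moreover have "norm (F (z r) r - F (zhat a r) r - DF (zhat a r) r (z r - zhat a r)) \<le> \<iota> * norm (z r - zhat a r) * norm (z r - zhat a r)"
        using small[OF r] r0(2) \<iota>(1)
        by (intro linearization_quadratic[where F = "\<lambda>x. F x r" and DF = "\<lambda>x. DF x r", OF der[OF r'] \<iota>(2)[OF r']]) (auto simp: e_def)
      moreover have "\<iota> * norm (z r - zhat a r) * norm (z r - zhat a r) \<le> \<iota> * r0 * norm (e a r)"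
        using small[OF r] \<iota>(1) unfolding e_def by (intro mult_right_mono mult_left_mono) auto
      ultimately show ?thesis by (simp add: eh_def e_def[symmetric] mult.left_commute)
    qed
    have "norm (eh t) \<le> 2 * (Q * norm (eh 0)) * exp (2 * (Q * (\<iota> * r0)) * t)"
      by (rule rh.error_bound[OF UP_le mild cont L \<kappa>0 t])
    then have "exp (\<alpha> * t) * norm (e a t) \<le> 2 * (Q * norm (e a 0)) * exp (2 * (Q * (\<iota> * r0)) * t)"
      by (simp add: eh_def)
    also have "\<dots> \<le> 2 * (Q * norm (e a 0)) * exp (\<alpha> / 2 * t)"
    proof -
      have "2 * (Q * (\<iota> * r0)) * t \<le> \<alpha> / 2 * t" using r0(5) t by (intro mult_right_mono) auto
      then show ?thesis using Q1 by (intro mult_left_mono) auto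
    qed
    finally have grow: "exp (\<alpha> * t) * norm (e a t) \<le> 2 * (Q * norm (e a 0)) * exp (\<alpha> / 2 * t)" .
    have "norm (e a t) = exp (- (\<alpha> * t)) * exp (\<alpha> * t) * norm (e a t)" by (simp flip: exp_add)
    also have "\<dots> \<le> exp (- (\<alpha> * t)) * (2 * (Q * norm (e a 0)) * exp (\<alpha> / 2 * t))"
      unfolding mult.assoc[of "exp (- (\<alpha> * t))"] using grow by (intro mult_left_mono) auto
    also have "\<dots> = 2 * Q * (exp (- (\<alpha> * t)) * exp (\<alpha> / 2 * t)) * norm (e a 0)"
      by (simp only: mult_ac)
    also have "exp (- (\<alpha> * t)) * exp (\<alpha> / 2 * t) = exp (- (\<alpha> / 2) * t)"
      by (simp flip: exp_add)
    finally show ?thesis .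
  qed
  define \<epsilon> where "\<epsilon> = r0 / (4 * Q)"
  have \<epsilon>0: "0 < \<epsilon>" using r0(1) Q1 by (simp add: \<epsilon>_def)
  have final: "norm (e a t) \<le> 2 * Q * exp (- (\<alpha> / 2) * t) * norm (e a 0)"
    if e0: "norm (e a 0) < \<epsilon>" and t: "0 \<le> t" for a t
  proof -
    have Qe: "2 * Q * norm (e a 0) < r0"
    proof -
      have "2 * Q * norm (e a 0) < 2 * Q * \<epsilon>" using e0 Q1 by (intro mult_strict_left_mono) auto
      also have "\<dots> \<le> r0" using Q1 r0(1) by (simp add: \<epsilon>_def)
      finally show ?thesis .
    qed
    have "norm (e a s) \<le> r0" if s: "0 \<le> s" for s
    proof (rule continuity_bootstrap[where g = "\<lambda>s. norm (e a s)", OF _ _ _ s])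
      show "continuous_on {0..} (\<lambda>s. norm (e a s))" by (intro continuous_intros ec)
      have "1 * norm (e a 0) \<le> 2 * Q * norm (e a 0)" using Q1 by (intro mult_right_mono) auto
      then show "norm (e a 0) \<le> r0" using Qe by linarith
      fix \<tau> :: real assume \<tau>: "0 \<le> \<tau>" and small: "\<And>t. t \<in> {0..\<tau>} \<Longrightarrow> norm (e a t) \<le> r0"
      have "norm (e a \<tau>) \<le> 2 * Q * exp (- (\<alpha> / 2) * \<tau>) * norm (e a 0)"
        using decay[OF \<tau> small, of \<tau>] \<tau> by simp
      also have "\<dots> \<le> 2 * Q * 1 * norm (e a 0)"
        using \<tau> assms(1) Q1 by (intro mult_right_mono mult_left_mono) auto
      finally show "norm (e a \<tau>) < r0" using Qe by simp
    qed
    then show ?thesis using decay[of t a t] t by simp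
  qed
  show ?thesis
    using \<epsilon>0 Q1 assms(1) final unfolding e_def
    by (intro exI[of _ \<epsilon>] exI[of _ "2 * Q"] exI[of _ "\<alpha> / 2"] conjI) auto
qed

end
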